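(* Let $(\mathcal{S}_1\times\mathcal{S}_2,\mathbb{W}_{S_1S_2})$ be a pair of finite-alphabet sources and $(\mathcal{X}_1\times\mathcal{X}_2,\mathcal{Y},\mathbb{W}_{Y|X_1X_2})$ a discrete memoryless MAC. Suppose there exist (i) finite sets $\mathcal{K},\mathcal{U},\mathcal{V}_1,\mathcal{V}_2$; (ii) maps $f_j:\mathcal{S}_j\to\mathcal{K}$, with $K_j=f_j(S_j)$ for $j\in\{1,2\}$; (iii) reals $\alpha,\beta\ge 0$, $\rho>0$, $\delta>0$; (iv) an integer $l\ge l^*(\mathcal{U},\mathcal{Y},\rho)$; (v) a pmf $p_U p_{V_1}p_{V_2}p_{X_1|UV_1}p_{X_2|UV_2}\mathbb{W}_{Y|X_1X_2}$ on $\mathcal{U}\times\mathcal{V}_1\times\mathcal{V}_2\times\mathcal{X}_1\times\mathcal{X}_2\times\mathcal{Y}$, where $p_U$ is a type of sequences in $\mathcal{U}^l$, such that $$(1+\delta)H(K_1)<\alpha+\beta,$$ $$H(S_j\mid S_{\bar j},K_1)+\mathcal{L}_l(\phi,|\mathcal{S}_j|)<I(V_j;Y\mid V_{\bar j})-\mathcal{L}(\phi,|\mathcal{V}_j|)\quad\text{for } j\in\{1,2\},$$ $$\beta+H(S_1,S_2\mid K_1)+\mathcal{L}_l(\phi,|\mathcal{S}_1||\mathcal{S}_2|)<I(V_1,V_2;Y)-\mathcal{L}(\phi,|\mathcal{V}_1||\mathcal{V}_2|),$$ and $\phi\in[0,0.5)$, where $\phi:=g(\alpha+\rho,l)+\xi^{[l]}(K_1,K_2)+\tau_{l,\delta}(K_1)$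 and $g(R,l):=(l+1)^{2|\mathcal{U}||\mathcal{Y}|}\exp\{-lE_r(R,p_U,p_{Y|U})\}$. Then $(S_1,S_2)$ is transmissible over the MAC.
   Context: Here $\bar j$ denotes the index in $\{1,2\}$ other than $j$. Entropies of $S_1,S_2,K_1,K_2$ are computed under $(S_1,S_2)\sim\mathbb{W}_{S_1S_2}$; mutual informations and the conditional pmf $p_{Y|U}$ are computed under the pmf in (v). All logarithms and exponentials use a common base, and $h_b$ is the binary entropy function. Transmissibility: $(S_1,S_2)$ is transmissible over the MAC if for every $\epsilon>0$ there is $N_\epsilon$ such that for every $n\ge N_\epsilon$ there exist encoders $e_j:\mathcal{S}_j^n\to\mathcal{X}_j^n$ ($j=1,2$) and a decoder $d:\mathcal{Y}^n\to\mathcal{S}_1^n\times\mathcal{S}_2^n$ with $\sum_{s_1^n,s_2^n}\mathbb{W}^n_{S_1S_2}(s_1^n,s_2^n)\sum_{y^n:d(y^n)\ne(s_1^n,s_2^n)}\mathbb{W}^n_{Y|X_1X_2}(y^n|e_1(s_1^n),e_2(s_2^n))\le\epsilon$, where superscript $n$ denotes the memoryless product. Definitions: For finite sets $\mathcal{A},\mathcal{B}$ and $\rho>0$, $l^*(\mathcal{A},\mathcal{B},\rho):=\min\{l\in\mathbb{N}:\exp(l\rho/2)\ge 2(l+1)^{2|\mathcal{A}|+2|\mathcal{A}||\mathcal{B}|}\}$. A pmf $p_U$ on $\mathcal{U}$ is a type of sequences in $\mathcal{U}^l$ if $l\,p_U(u)$ is an integer for all $u$. For $R\ge0$, a pmf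 $p_U$ and a channel $W_{Y|U}$, $E_r(R,p_U,W_{Y|U}):=\min_{V_{Y|U}}\{D(V_{Y|U}\|W_{Y|U}\mid p_U)+|I(p_U;V_{Y|U})-R|^+\}$, the minimum over all conditional pmfs $V_{Y|U}$, where $D(\cdot\|\cdot\mid p_U)$ is conditional divergence, $I(p_U;V_{Y|U})$ is the mutual information under $p_UV_{Y|U}$, and $|x|^+=\max\{x,0\}$. For $\mu\in[0,1]$, $l\in\mathbb{N}$, and a positive integer $N$: $\mathcal{L}_l(\mu,N):=\frac1l h_b(\mu)+\mu\log N$ and $\mathcal{L}(\mu,N):=\mathcal{L}_1(\mu,N)$. With $K_j=f_j(S_j)$, $\xi^{[l]}(K_1,K_2):=1-(1-P(K_1\ne K_2))^l$ (the probability that $l$ i.i.d. copies of $(K_1,K_2)$ form unequal $l$-tuples). For $\delta>0$, $\tau_{l,\delta}(K_1):=2|\mathcal{K}|\exp\{-2\delta^2p_{K_1}(b^* )^2l\}$, where $b^*$ is a symbol of least positive probability under the pmf $p_{K_1}$ of $K_1$. *)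

theory Defs
  imports "HOL-Analysis.Analysis" "HOL-Library.Extended_Real"
begin

text \<open>All logarithms/exponentials are natural (common base e).\<close>

definition is_pmf :: "('a::finite \<Rightarrow> real) \<Rightarrow> bool" where
  "is_pmf p \<longleftrightarrow> (\<forall>x. 0 \<le> p x) \<and> (\<Sum>x\<in>UNIV. p x) = 1"

definition plog :: "real \<Rightarrow> real \<Rightarrow> real" where
  "plog p r = (if p = 0 then 0 else p * ln r)"

definition push :: "('a::finite \<Rightarrow> real) \<Rightarrow> ('a \<Rightarrow> 'b) \<Rightarrow> 'b \<Rightarrow> real" where
  "push P X b = (\<Sum>a\<in>{a. X a = b}. P a)"

definition ent :: "('a::finite \<Rightarrow> real) \<Rightarrow> ('a \<Rightarrow> 'b) \<Rightarrow> real" where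
  "ent P X = - (\<Sum>b\<in>X ` UNIV. plog (push P X b) (push P X b))"

definition cent :: "('a::finite \<Rightarrow> real) \<Rightarrow> ('a \<Rightarrow> 'b) \<Rightarrow> ('a \<Rightarrow> 'c) \<Rightarrow> real" where
  "cent P X Z = - (\<Sum>(x,z)\<in>(\<lambda>a. (X a, Z a)) ` UNIV.
      plog (push P (\<lambda>a. (X a, Z a)) (x,z)) (push P (\<lambda>a. (X a, Z a)) (x,z) / push P Z z))"

definition mi :: "('a::finite \<Rightarrow> real) \<Rightarrow> ('a \<Rightarrow> 'b) \<Rightarrow> ('a \<Rightarrow> 'c) \<Rightarrow> real" where
  "mi P X Y = (\<Sum>(x,y)\<in>(\<lambda>a. (X a, Y a)) ` UNIV.
      plog (push P (\<lambda>a. (X a, Y a)) (x,y))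
        (push P (\<lambda>a. (X a, Y a)) (x,y) / (push P X x * push P Y y)))"

definition cmi :: "('a::finite \<Rightarrow> real) \<Rightarrow> ('a \<Rightarrow> 'b) \<Rightarrow> ('a \<Rightarrow> 'c) \<Rightarrow> ('a \<Rightarrow> 'd) \<Rightarrow> real" where
  "cmi P X Y Z = (\<Sum>(x,y,z)\<in>(\<lambda>a. (X a, Y a, Z a)) ` UNIV.
      plog (push P (\<lambda>a. (X a, Y a, Z a)) (x,y,z))
        (push P (\<lambda>a. (X a, Y a, Z a)) (x,y,z) * push P Z z
          / (push P (\<lambda>a. (X a, Z a)) (x,z) * push P (\<lambda>a. (Y a, Z a)) (y,z))))"

definition hb :: "real \<Rightarrow> real" where
  "hb \<mu> = - plog \<mu> \<mu> - plog (1 - \<mu>) (1 - \<mu>)"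

definition Ll :: "nat \<Rightarrow> real \<Rightarrow> nat \<Rightarrow> real" where
  "Ll l \<mu> N = hb \<mu> / real l + \<mu> * ln (real N)"

definition LL :: "real \<Rightarrow> nat \<Rightarrow> real" where
  "LL \<mu> N = Ll 1 \<mu> N"

text \<open>l*(A,B,rho) with |A| = a, |B| = b.\<close>
definition lstar :: "nat \<Rightarrow> nat \<Rightarrow> real \<Rightarrow> nat" where
  "lstar a b \<rho> = (LEAST l::nat. exp (real l * \<rho> / 2) \<ge> 2 * (real l + 1) ^ (2 * a + 2 * a * b))"

definition is_type :: "nat \<Rightarrow> ('u::finite \<Rightarrow> real) \<Rightarrow> bool" where
  "is_type l p \<longleftrightarrow> (\<forall>u. real l * p u \<in> \<int>)"

text \<open>Conditional divergence D(V||W|p), with value infinity when V is not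
  absolutely continuous w.r.t. W on the support of p.\<close>
definition dterm :: "real \<Rightarrow> real \<Rightarrow> ereal" where
  "dterm v w = (if v = 0 then 0 else if w = 0 then \<infinity> else ereal (v * ln (v / w)))"

definition cdiv :: "('u::finite \<Rightarrow> 'y::finite \<Rightarrow> real) \<Rightarrow> ('u \<Rightarrow> 'y \<Rightarrow> real) \<Rightarrow> ('u \<Rightarrow> real) \<Rightarrow> ereal" where
  "cdiv V W p = (\<Sum>u\<in>UNIV. ereal (p u) * (\<Sum>y\<in>UNIV. dterm (V u y) (W u y)))"

definition mi_ch :: "('u::finite \<Rightarrow> real) \<Rightarrow> ('u \<Rightarrow> 'y::finite \<Rightarrow> real) \<Rightarrow> real" where
  "mi_ch p V = (\<Sum>u\<in>UNIV. \<Sum>y\<in>UNIV.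
      plog (p u * V u y) (V u y / (\<Sum>u'\<in>UNIV. p u' * V u' y)))"

text \<open>Random-coding error exponent E_r(R,p,W); the minimum is written as an infimum
  (it is attained).\<close>
definition Er :: "real \<Rightarrow> ('u::finite \<Rightarrow> real) \<Rightarrow> ('u \<Rightarrow> 'y::finite \<Rightarrow> real) \<Rightarrow> ereal" where
  "Er R p W = Inf {cdiv V W p + ereal (max (mi_ch p V - R) 0) | V. \<forall>u. is_pmf (V u)}"

definition gfun :: "real \<Rightarrow> nat \<Rightarrow> ('u::finite \<Rightarrow> real) \<Rightarrow> ('u \<Rightarrow> 'y::finite \<Rightarrow> real) \<Rightarrow> real" where
  "gfun R l p W = (real l + 1) ^ (2 * CARD('u) * CARD('y)) * exp (- real l * real_of_ereal (Er R p W))"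

definition xi :: "nat \<Rightarrow> ('s1::finite \<times> 's2::finite \<Rightarrow> real) \<Rightarrow> ('s1 \<Rightarrow> 'k) \<Rightarrow> ('s2 \<Rightarrow> 'k) \<Rightarrow> real" where
  "xi l W f1 f2 = 1 - (1 - (\<Sum>s\<in>{(s1,s2). f1 s1 \<noteq> f2 s2}. W s)) ^ l"

definition tau :: "nat \<Rightarrow> real \<Rightarrow> ('s1::finite \<times> 's2::finite \<Rightarrow> real) \<Rightarrow> ('s1 \<Rightarrow> 'k::finite) \<Rightarrow> real" where
  "tau l \<delta> W f1 = 2 * real CARD('k) *
     exp (- 2 * \<delta>^2 * (Min {push W (\<lambda>(s1,s2). f1 s1) b | b. push W (\<lambda>(s1,s2). f1 s1) b > 0})^2 * real l)"

definition transmissible ::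
  "('s1::finite \<times> 's2::finite \<Rightarrow> real) \<Rightarrow> ('x1::finite \<Rightarrow> 'x2::finite \<Rightarrow> 'y::finite \<Rightarrow> real) \<Rightarrow> bool" where
  "transmissible W Wc \<longleftrightarrow>
    (\<forall>\<epsilon>>0. \<exists>N. \<forall>n\<ge>N. \<exists>(e1 :: 's1 list \<Rightarrow> 'x1 list) (e2 :: 's2 list \<Rightarrow> 'x2 list)
        (d :: 'y list \<Rightarrow> 's1 list \<times> 's2 list).
      (\<forall>s. length s = n \<longrightarrow> length (e1 s) = n) \<and>
      (\<forall>s. length s = n \<longrightarrow> length (e2 s) = n) \<and>
      (\<Sum>s1\<in>{xs. length xs = n}. \<Sum>s2\<in>{xs. length xs = n}.
          (\<Prod>i<n. W (s1 ! i, s2 ! i)) *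
          (\<Sum>y\<in>{ys. length ys = n \<and> d ys \<noteq> (s1, s2)}.
              \<Prod>i<n. Wc (e1 s1 ! i) (e2 s2 ! i) (y ! i))) \<le> \<epsilon>)"

end

theory Submission
  imports Defs "HOL-Probability.Hoeffding" "HOL-Combinatorics.Multiset_Permutations"
begin

text \<open>
  Cut the source into blocks of length \<open>l\<close>. In each block both encoders compute a bin index of their
  key block \<open>f1(S1)\<close> resp. \<open>f2(S2)\<close> and look up the codeword with that index in one fixed
  constant composition code of type \<open>pU\<close>; typical key blocks are binned with at most \<open>exp(l \<beta>)\<close> per bin,
  so about \<open>exp(l \<alpha>)\<close> indices suffice. With probability at least \<open>1 - \<phi>\<close> the keys agree and are typical,
  and the index can be decoded from the block output. On top of this inner code, whole source sequences
  are mapped to i.i.d. random \<open>V1\<close>- and \<open>V2\<close>-codewords. A threshold decoder compares the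
  product over blocks of \<open>T(s, v | rest) / p(v)\<close> with an exponential threshold, where \<open>T\<close> is any sub-conditional
  pmf: the union bound needs only that \<open>T\<close> sums to at most one, and by a Chernoff bound the correct
  pair passes as soon as the mean of \<open>ln (T / p)\<close> over one block is positive. For a suitable
  explicit \<open>T\<close> this positivity is the hypothesis of the theorem, so no entropy inequality is needed.
\<close>

text \<open>Since \<open>l\<close> is fixed, \<phi> does not vanish: the inner code may fail in a
  positive fraction of the blocks, and the decoder is not told in which. In such a block the
  encoders may use different letters, and little is known about the law of
  \<open>(V1, V2, Y)\<close>. The metric must therefore stay bounded away from zero on every block,
  and this is what the penalties in \<phi> pay for. They come on two scales. The source metric is
  one mixture per block and pays \<open>hb \<phi>\<close> once per block, which is
  \<open>Ll l\<close>; the codeword metric is a product over the letters of the block and pays in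
  every letter, which is \<open>LL\<close>. The letters of a block have no common law and depend on
  the whole source block. Single-letter quantities still appear, without any interleaving, because
  every codeword has exact type \<open>pU\<close>: a sum over positions then has mean exactly
  \<open>l\<close> times the mean under the law of the theorem. The excess rate \<rho> absorbs
  constants and polynomial factors in \<open>l\<close>, and \<delta> is the relative deviation
  allowed in typical key blocks.\<close>

declare sum_mult_of_bool_eq [simp del] sum_of_bool_mult_eq [simp del]

section \<open>Sums over lists\<close>

definition Len :: "nat \<Rightarrow> 'a list set" where
  "Len n = {xs. length xs = n}"

lemma Len_iff [simp]: "xs \<in> Len n \<longleftrightarrow> length xs = n"
  by (simp add: Len_def)

lemma finite_Len [simp]: "finite (Len n :: 'a::finite list set)"
  using finite_lists_length_eq[of "UNIV :: 'a set" n] by (simp add: Len_def)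

lemma Len_0 [simp]: "Len 0 = {[]}"
  by (auto simp: Len_def)

lemma sum_Len_append:
  "(\<Sum>z\<in>Len (l + k). f z) = (\<Sum>a\<in>Len l. \<Sum>b\<in>Len k. f (a @ b))"
proof -
  have "(\<Sum>z\<in>Len (l + k). f z) = (\<Sum>p\<in>Len l \<times> Len k. f (fst p @ snd p))"
    by (rule sum.reindex_bij_witness[of _ "\<lambda>p. fst p @ snd p" "\<lambda>z. (take l z, drop l z)"]) auto
  also have "\<dots> = (\<Sum>a\<in>Len l. \<Sum>b\<in>Len k. f (a @ b))"
    by (simp add: sum.cartesian_product split_def)
  finally show ?thesis .
qed

lemma sum_Len_Suc:
  "(\<Sum>z\<in>Len (Suc k). f z) = (\<Sum>a\<in>UNIV. \<Sum>b\<in>Len k. f (a # b))"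
proof -
  have "(\<Sum>z\<in>Len (Suc k). f z) = (\<Sum>p\<in>UNIV \<times> Len k. f (fst p # snd p))"
    by (rule sum.reindex_bij_witness[of _ "\<lambda>p. fst p # snd p" "\<lambda>z. (hd z, tl z)"])
       (auto, metis hd_Cons_tl length_0_conv nat.distinct(1), metis hd_Cons_tl length_0_conv nat.distinct(1))
  also have "\<dots> = (\<Sum>a\<in>UNIV. \<Sum>b\<in>Len k. f (a # b))"
    by (simp add: sum.cartesian_product split_def)
  finally show ?thesis .
qed

lemma sum_Len_zip:
  "(\<Sum>z\<in>Len n. f (map fst z) (map snd z)) = (\<Sum>a\<in>Len n. \<Sum>b\<in>Len n. f a b)"
proof -
  have "(\<Sum>z\<in>Len n. f (map fst z) (map snd z)) = (\<Sum>p\<in>Len n \<times> Len n. f (fst p) (snd p))"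
    by (rule sum.reindex_bij_witness[of _ "\<lambda>p. zip (fst p) (snd p)" "\<lambda>z. (map fst z, map snd z)"])
       (auto simp: zip_map_fst_snd)
  also have "\<dots> = (\<Sum>a\<in>Len n. \<Sum>b\<in>Len n. f a b)"
    by (simp add: sum.cartesian_product split_def)
  finally show ?thesis .
qed

lemma sum_Len_prod_list:
  "(\<Sum>z\<in>Len n. prod_list (map c z)) = (\<Sum>x\<in>UNIV. c x) ^ n" for c :: "'a::finite \<Rightarrow> real"
  by (induction n) (auto simp: sum_Len_Suc sum_distrib_left[symmetric] sum_distrib_right[symmetric])

lemma sum_Len_kernel:
  fixes f :: "'a \<Rightarrow> 'b::finite \<Rightarrow> real"
  shows "(\<Sum>y\<in>Len (length xs). prod_list (map2 f xs y)) = prod_list (map (\<lambda>x. \<Sum>y\<in>UNIV. f x y) xs)"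
  by (induction xs) (auto simp: sum_Len_Suc sum_distrib_left[symmetric] sum_distrib_right[symmetric])

text \<open>Each factor that a summand \<open>g\<close> does not touch sums to one, so only
  single-letter means remain. This is the passage from blocks to letters when the inputs
  \<open>xs\<close> are fixed but vary with the position.\<close>

lemma sum_Len_kernel_additive:
  fixes f :: "'a \<Rightarrow> 'b::finite \<Rightarrow> real"
  assumes "\<And>x. (\<Sum>y\<in>UNIV. f x y) = 1"
  shows "(\<Sum>y\<in>Len (length xs). prod_list (map2 f xs y) * sum_list (map g y))
    = sum_list (map (\<lambda>x. \<Sum>y\<in>UNIV. f x y * g y) xs)"
proof (induction xs)
  case Nil
  show ?case by simp
next
  case (Cons x xs)
  have 1: "(\<Sum>y\<in>Len (length xs). prod_list (map2 f xs y)) = 1"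
  proof -
    have "prod_list (map (\<lambda>x. 1 :: real) xs) = 1" by (induction xs) auto
    then show ?thesis by (simp add: sum_Len_kernel assms)
  qed
  have "(\<Sum>y\<in>Len (length (x # xs)). prod_list (map2 f (x # xs) y) * sum_list (map g y))
    = (\<Sum>a\<in>UNIV. \<Sum>y\<in>Len (length xs). (f x a * g a) * prod_list (map2 f xs y)
        + f x a * (prod_list (map2 f xs y) * sum_list (map g y)))"
    by (simp add: sum_Len_Suc algebra_simps)
  also have "\<dots> = (\<Sum>a\<in>UNIV. f x a * g a + f x a * sum_list (map (\<lambda>x. \<Sum>y\<in>UNIV. f x y * g y) xs))"
    by (simp only: sum.distrib sum_distrib_left[symmetric] 1 Cons.IH mult_1_right)
  also have "\<dots> = (\<Sum>a\<in>UNIV. f x a * g a) + sum_list (map (\<lambda>x. \<Sum>y\<in>UNIV. f x y * g y) xs)"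
    by (simp add: sum.distrib sum_distrib_right[symmetric] assms)
  finally show ?case by simp
qed

lemma sum_Len_additive:
  fixes c :: "'a::finite \<Rightarrow> real"
  assumes "(\<Sum>x\<in>UNIV. c x) = 1"
  shows "(\<Sum>z\<in>Len n. prod_list (map c z) * sum_list (map g z)) = n * (\<Sum>x\<in>UNIV. c x * g x)"
proof (induction n)
  case 0
  show ?case by simp
next
  case (Suc n)
  have "(\<Sum>z\<in>Len (Suc n). prod_list (map c z) * sum_list (map g z))
    = (\<Sum>a\<in>UNIV. \<Sum>y\<in>Len n. (c a * g a) * prod_list (map c y)
        + c a * (prod_list (map c y) * sum_list (map g y)))"
    by (simp add: sum_Len_Suc algebra_simps)
  also have "\<dots> = (\<Sum>a\<in>UNIV. c a * g a + c a * (n * (\<Sum>x\<in>UNIV. c x * g x)))"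
    by (simp only: sum.distrib sum_distrib_left[symmetric] Suc.IH sum_Len_prod_list assms power_one mult_1_right)
  also have "\<dots> = (\<Sum>a\<in>UNIV. c a * g a) + n * (\<Sum>x\<in>UNIV. c x * g x)"
    by (simp add: sum.distrib sum_distrib_right[symmetric] assms)
  finally show ?case by (simp add: algebra_simps)
qed

lemma sum_Len_fiber:
  fixes c :: "'a::finite \<Rightarrow> real"
  assumes "length b = n"
  shows "(\<Sum>z | length z = n \<and> map p z = b. prod_list (map c z))
    = prod_list (map (\<lambda>x. \<Sum>z | p z = x. c z) b)"
proof -
  \<comment> \<open>The constraint \<open>map p z = b\<close> becomes a zero weight in each
    violating position, so the sum over the fibre extends to all lists and factorises by
    \<open>sum_Len_kernel\<close>.\<close>
  have "(\<Sum>z | length z = n \<and> map p z = b. prod_list (map c z))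
    = (\<Sum>z\<in>Len n. prod_list (map2 (\<lambda>x z. if p z = x then c z else 0) b z))"
  proof (rule sum.mono_neutral_cong_left)
    have *: "prod_list (map2 (\<lambda>x z. if p z = x then c z else 0) b z) = 0"
      if "length z = length b" "map p z \<noteq> b" for z
      using that
    proof (induction b arbitrary: z)
      case (Cons a b)
      then show ?case by (cases z) auto
    qed simp
    then show "\<forall>i\<in>Len n - {z. length z = n \<and> map p z = b}.
       prod_list (map2 (\<lambda>x z. if p z = x then c z else 0) b i) = 0"
      using assms by auto
    have **: "prod_list (map c z) = prod_list (map2 (\<lambda>x z. if p z = x then c z else 0) (map p z) z)" for z
      by (induction z) auto
    show "\<And>x. x \<in> {z. length z = n \<and> map p z = b} \<Longrightarrow>
       prod_list (map c x) = prod_list (map2 (\<lambda>x z. if p z = x then c z else 0) b x)"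
      using ** by auto
  qed auto
  also have "\<dots> = prod_list (map (\<lambda>x. \<Sum>z\<in>UNIV. if p z = x then c z else 0) b)"
    using assms by (simp add: sum_Len_kernel[symmetric])
  also have "(\<lambda>x. \<Sum>z\<in>UNIV. if p z = x then c z else 0) = (\<lambda>x. \<Sum>z | p z = x. c z)"
    by (rule ext) (simp add: sum.If_cases)
  finally show ?thesis .
qed

lemma prod_list_nonneg_map:
  "(\<And>x. x \<in> set xs \<Longrightarrow> 0 \<le> f x) \<Longrightarrow> 0 \<le> prod_list (map f xs)" for f :: "'a \<Rightarrow> real"
  by (induction xs) auto

lemma prod_list_pos_map:
  "(\<And>x. x \<in> set xs \<Longrightarrow> 0 < f x) \<Longrightarrow> 0 < prod_list (map f xs)" for f :: "'a \<Rightarrow> real"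
  by (induction xs) auto

lemma prod_list_le_power_map:
  "(\<And>x. x \<in> set xs \<Longrightarrow> 0 \<le> f x \<and> f x \<le> c) \<Longrightarrow> prod_list (map f xs) \<le> c ^ length xs" for f :: "'a \<Rightarrow> real"
  by (induction xs) (auto intro!: mult_mono prod_list_nonneg_map order_trans[of 0 "f _" c])

lemma prod_list_eq_0_map:
  "prod_list (map f xs) = 0 \<longleftrightarrow> (\<exists>x\<in>set xs. f x = 0)" for f :: "'a \<Rightarrow> real"
  by (induction xs) auto

lemma ln_prod_list_map:
  "(\<And>x. x \<in> set xs \<Longrightarrow> 0 < f x) \<Longrightarrow> ln (prod_list (map f xs)) = sum_list (map (\<lambda>x. ln (f x)) xs)"
  for f :: "'a \<Rightarrow> real"
proof (induction xs)
  case (Cons a xs)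
  have "0 < f a" "0 < prod_list (map f xs)"
    using Cons.prems by (auto intro!: prod_list_pos_map)
  then show ?case
    using Cons by (simp add: ln_mult_pos)
qed simp

lemma prod_list_mult_map:
  "prod_list (map (\<lambda>x. f x * g x) xs) = prod_list (map f xs) * prod_list (map g xs)" for f :: "'a \<Rightarrow> real"
  by (induction xs) auto

lemma prod_list_const_map: "prod_list (map (\<lambda>x. c) xs) = c ^ length xs" for c :: real
  by (induction xs) auto

lemma exp_sum_list: "exp (sum_list (map f xs)) = prod_list (map (\<lambda>x. exp (f x)) xs)" for f :: "'q \<Rightarrow> real"
  by (induction xs) (auto simp: exp_add)

lemma prod_list_cong_map: "(\<And>x. x \<in> set xs \<Longrightarrow> f x = g x) \<Longrightarrow> prod_list (map f xs) = prod_list (map g xs)"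
  for f :: "'q \<Rightarrow> real"
  by (induction xs) auto

lemma prod_list_fst_zip: "length u = length y \<Longrightarrow> prod_list (map f u) = prod_list (map (\<lambda>x. f (fst x)) (zip u y))"
  for f :: "'q \<Rightarrow> real"
  by (induction u y rule: list_induct2) auto

section \<open>Random codebooks\<close>

lemma codebook_total:
  fixes R :: "'a \<Rightarrow> 'z \<Rightarrow> real"
  assumes "finite A" "finite Z" "\<And>a. a \<in> A \<Longrightarrow> (\<Sum>z\<in>Z. R a z) = 1"
  shows "(\<Sum>c\<in>(\<Pi>\<^sub>E a\<in>A. Z). \<Prod>a\<in>A. R a (c a)) = 1"
  using assms by (subst prod_sum_PiE[symmetric]) auto

text \<open>The product weight makes the codewords independent: \<open>F\<close> is absorbed into
  the factor of index \<open>a\<close>, and every other factor sums to one.\<close>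

lemma codebook_one:
  fixes R :: "'a \<Rightarrow> 'z \<Rightarrow> real"
  assumes "finite A" "finite Z" "\<And>a. a \<in> A \<Longrightarrow> (\<Sum>z\<in>Z. R a z) = 1" "a \<in> A"
  shows "(\<Sum>c\<in>(\<Pi>\<^sub>E a\<in>A. Z). (\<Prod>a\<in>A. R a (c a)) * F (c a)) = (\<Sum>z\<in>Z. R a z * F z)"
proof -
  have "(\<Sum>c\<in>(\<Pi>\<^sub>E a\<in>A. Z). (\<Prod>a\<in>A. R a (c a)) * F (c a))
    = (\<Sum>c\<in>(\<Pi>\<^sub>E a\<in>A. Z). \<Prod>b\<in>A. (if b = a then R b (c b) * F (c b) else R b (c b)))"
  proof (rule sum.cong[OF refl])
    fix c
    have "(\<Prod>b\<in>A. (if b = a then R b (c b) * F (c b) else R b (c b)))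
      = (\<Prod>b\<in>A. R b (c b) * (if b = a then F (c b) else 1))"
      by (rule prod.cong) auto
    also have "\<dots> = (\<Prod>a\<in>A. R a (c a)) * F (c a)"
      using assms by (simp add: prod.distrib prod.delta)
    finally show "(\<Prod>a\<in>A. R a (c a)) * F (c a) = (\<Prod>b\<in>A. (if b = a then R b (c b) * F (c b) else R b (c b)))" ..
  qed
  also have "\<dots> = (\<Prod>b\<in>A. \<Sum>z\<in>Z. (if b = a then R b z * F z else R b z))"
    using assms by (subst prod_sum_PiE) auto
  also have "\<dots> = (\<Prod>b\<in>A. if b = a then (\<Sum>z\<in>Z. R a z * F z) else 1)"
    using assms by (intro prod.cong) auto
  finally show ?thesis using assms by (simp add: prod.delta)
qed

text \<open>Pairwise independence of codewords. A function of two codewords is not a product over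
  the indices, so the value \<open>w\<close> of the first one is fixed by an indicator and summed
  over afterwards.\<close>

lemma codebook_two:
  fixes R :: "'a \<Rightarrow> 'z \<Rightarrow> real"
  assumes "finite A" "finite Z" "\<And>a. a \<in> A \<Longrightarrow> (\<Sum>z\<in>Z. R a z) = 1" "a \<in> A" "a' \<in> A" "a \<noteq> a'"
  shows "(\<Sum>c\<in>(\<Pi>\<^sub>E a\<in>A. Z). (\<Prod>a\<in>A. R a (c a)) * F (c a) (c a'))
    = (\<Sum>z\<in>Z. \<Sum>z'\<in>Z. R a z * R a' z' * F z z')"
proof -
  have pt: "(\<Sum>c\<in>(\<Pi>\<^sub>E a\<in>A. Z). (\<Prod>a\<in>A. R a (c a)) * (of_bool (c a = w) * G (c a')))
    = R a w * (\<Sum>z'\<in>Z. R a' z' * G z')" if "w \<in> Z" for w and G :: "'z \<Rightarrow> real"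
  proof -
    let ?h = "\<lambda>b z. (if b = a then of_bool (z = w) else if b = a' then G z else 1) :: real"
    have "(\<Sum>c\<in>(\<Pi>\<^sub>E a\<in>A. Z). (\<Prod>a\<in>A. R a (c a)) * (of_bool (c a = w) * G (c a')))
      = (\<Sum>c\<in>(\<Pi>\<^sub>E a\<in>A. Z). \<Prod>b\<in>A. R b (c b) * ?h b (c b))"
    proof (rule sum.cong[OF refl])
      fix c
      have "(\<Prod>b\<in>A. ?h b (c b)) = (\<Prod>b\<in>A. (if b = a then of_bool (c b = w) else 1) * (if b = a' then G (c b) else 1))"
        using assms by (intro prod.cong) auto
      also have "\<dots> = of_bool (c a = w) * G (c a')"
        using assms by (simp add: prod.distrib prod.delta)
      finally show "(\<Prod>a\<in>A. R a (c a)) * (of_bool (c a = w) * G (c a')) = (\<Prod>b\<in>A. R b (c b) * ?h b (c b))"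
        by (simp add: prod.distrib)
    qed
    also have "\<dots> = (\<Prod>b\<in>A. \<Sum>z\<in>Z. R b z * ?h b z)"
      using assms by (subst prod_sum_PiE) auto
    also have "\<dots> = (\<Prod>b\<in>A. (if b = a then R a w else 1) * (if b = a' then (\<Sum>z'\<in>Z. R a' z' * G z') else 1))"
    proof (rule prod.cong[OF refl])
      fix b assume b: "b \<in> A"
      have "(\<Sum>z\<in>Z. R a z * of_bool (z = w)) = R a w"
        using that assms by (simp add: of_bool_def if_distrib sum.delta cong: if_cong)
      then show "(\<Sum>z\<in>Z. R b z * ?h b z) = (if b = a then R a w else 1) * (if b = a' then (\<Sum>z'\<in>Z. R a' z' * G z') else 1)"
        using b assms by (auto simp: of_bool_def)
    qed
    also have "\<dots> = R a w * (\<Sum>z'\<in>Z. R a' z' * G z')"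
      using assms by (simp add: prod.distrib prod.delta)
    finally show ?thesis .
  qed
  have "(\<Sum>c\<in>(\<Pi>\<^sub>E a\<in>A. Z). (\<Prod>a\<in>A. R a (c a)) * F (c a) (c a'))
    = (\<Sum>c\<in>(\<Pi>\<^sub>E a\<in>A. Z). \<Sum>w\<in>Z. (\<Prod>a\<in>A. R a (c a)) * (of_bool (c a = w) * F w (c a')))"
  proof (rule sum.cong[OF refl])
    fix c assume "c \<in> (\<Pi>\<^sub>E a\<in>A. Z)"
    then have "c a \<in> Z" using assms by auto
    have "(\<Sum>w\<in>Z. (\<Prod>a\<in>A. R a (c a)) * (of_bool (c a = w) * F w (c a')))
       = (\<Sum>w\<in>Z. if c a = w then (\<Prod>a\<in>A. R a (c a)) * F w (c a') else 0)"
      by (rule sum.cong) auto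
    also have "\<dots> = (\<Prod>a\<in>A. R a (c a)) * F (c a) (c a')"
      using assms \<open>c a \<in> Z\<close> by (simp add: sum.delta)
    finally show "(\<Prod>a\<in>A. R a (c a)) * F (c a) (c a') = (\<Sum>w\<in>Z. (\<Prod>a\<in>A. R a (c a)) * (of_bool (c a = w) * F w (c a')))" ..
  qed
  also have "\<dots> = (\<Sum>w\<in>Z. R a w * (\<Sum>z'\<in>Z. R a' z' * F w z'))"
    by (subst sum.swap) (intro sum.cong refl pt)
  finally show ?thesis by (simp add: sum_distrib_left mult.assoc)
qed

lemma exists_le_average:
  fixes w F :: "'c \<Rightarrow> real"
  assumes "finite A" "\<And>c. c \<in> A \<Longrightarrow> 0 \<le> w c" "(\<Sum>c\<in>A. w c) = 1" "(\<Sum>c\<in>A. w c * F c) \<le> e"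
  shows "\<exists>c\<in>A. F c \<le> e"
proof (rule ccontr)
  assume "\<not> ?thesis"
  then have gt: "e < F c" if "c \<in> A" for c using that by force
  have "\<exists>c\<in>A. 0 < w c"
    using assms(2,3) by (metis less_le sum.neutral zero_neq_one)
  then obtain c where "c \<in> A" "0 < w c" by blast
  then have "w c * e < w c * F c" using gt by simp
  moreover have "\<forall>c\<in>A. w c * e \<le> w c * F c"
    using assms(2) gt by (simp add: mult_left_mono less_imp_le)
  ultimately have "(\<Sum>c\<in>A. w c * e) < (\<Sum>c\<in>A. w c * F c)"
    using assms(1) \<open>c \<in> A\<close> by (intro sum_strict_mono_ex1) auto
  with assms(3,4) show False by (simp add: sum_distrib_right[symmetric])
qed

text \<open>The decoder looks for a message pair in the acceptance region \<^term>\<open>G\<close>. Codewords of wrong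
  messages are independent of the channel output, so \<open>e1\<close>, \<open>e2\<close>, \<open>e3\<close> are union bounds for errors in the
  first, the second and both components.\<close>

lemma one_shot_random_coding:
  fixes P :: "'a \<Rightarrow> 'b \<Rightarrow> real" and R1 :: "'a \<Rightarrow> 'z1 \<Rightarrow> real" and R2 :: "'b \<Rightarrow> 'z2 \<Rightarrow> real"
    and ch :: "'z1 \<Rightarrow> 'z2 \<Rightarrow> 'y \<Rightarrow> real" and G :: "'a \<Rightarrow> 'b \<Rightarrow> 'z1 \<Rightarrow> 'z2 \<Rightarrow> 'y \<Rightarrow> bool"
  assumes fin: "finite A1" "finite A2" "finite Z1" "finite Z2" "finite Y"
    and P0: "\<And>a b. 0 \<le> P a b" and P1: "(\<Sum>a\<in>A1. \<Sum>b\<in>A2. P a b) = 1"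
    and R10: "\<And>a z. 0 \<le> R1 a z" and R11: "\<And>a. a \<in> A1 \<Longrightarrow> (\<Sum>z\<in>Z1. R1 a z) = 1"
    and R20: "\<And>a z. 0 \<le> R2 a z" and R21: "\<And>a. a \<in> A2 \<Longrightarrow> (\<Sum>z\<in>Z2. R2 a z) = 1"
    and ch0: "\<And>z1 z2 y. 0 \<le> ch z1 z2 y"
    and ch1: "\<And>z1 z2. z1 \<in> Z1 \<Longrightarrow> z2 \<in> Z2 \<Longrightarrow> (\<Sum>y\<in>Y. ch z1 z2 y) = 1"
    and e0: "(\<Sum>a\<in>A1. \<Sum>b\<in>A2. P a b * (\<Sum>z1\<in>Z1. \<Sum>z2\<in>Z2. R1 a z1 * R2 b z2 *
              (\<Sum>y\<in>Y. ch z1 z2 y * of_bool (\<not> G a b z1 z2 y)))) \<le> \<epsilon>0"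
    and e1: "\<And>b z2 y. b \<in> A2 \<Longrightarrow> z2 \<in> Z2 \<Longrightarrow> y \<in> Y \<Longrightarrow>
              (\<Sum>a\<in>A1. \<Sum>z1\<in>Z1. R1 a z1 * of_bool (G a b z1 z2 y)) \<le> \<epsilon>1"
    and e2: "\<And>a z1 y. a \<in> A1 \<Longrightarrow> z1 \<in> Z1 \<Longrightarrow> y \<in> Y \<Longrightarrow>
              (\<Sum>b\<in>A2. \<Sum>z2\<in>Z2. R2 b z2 * of_bool (G a b z1 z2 y)) \<le> \<epsilon>2"
    and e3: "\<And>y. y \<in> Y \<Longrightarrow>
              (\<Sum>a\<in>A1. \<Sum>b\<in>A2. \<Sum>z1\<in>Z1. \<Sum>z2\<in>Z2. R1 a z1 * R2 b z2 * of_bool (G a b z1 z2 y)) \<le> \<epsilon>3"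
  shows "\<exists>c1 c2 d. c1 \<in> (\<Pi>\<^sub>E a\<in>A1. Z1) \<and> c2 \<in> (\<Pi>\<^sub>E b\<in>A2. Z2) \<and>
    (\<Sum>a\<in>A1. \<Sum>b\<in>A2. P a b * (\<Sum>y | y \<in> Y \<and> d y \<noteq> (a, b). ch (c1 a) (c2 b) y)) \<le> \<epsilon>0 + \<epsilon>1 + \<epsilon>2 + \<epsilon>3"
proof -
  define C1 where "C1 = (\<Pi>\<^sub>E a\<in>A1. Z1)"
  define C2 where "C2 = (\<Pi>\<^sub>E b\<in>A2. Z2)"
  define w1 where "w1 = (\<lambda>c. \<Prod>a\<in>A1. R1 a (c a))"
  define w2 where "w2 = (\<lambda>c. \<Prod>a\<in>A2. R2 a (c a))"
  define ok where "ok = (\<lambda>c1 c2 y p. p \<in> A1 \<times> A2 \<and> G (fst p) (snd p) (c1 (fst p)) (c2 (snd p)) y)"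
  \<comment> \<open>When no pair is accepted the choice is arbitrary. This is harmless: the
    transmitted pair is then rejected too, which \<open>b0\<close> already counts.\<close>
  define d where "d = (\<lambda>c1 c2 y. SOME p. ok c1 c2 y p)"
  define b0 where "b0 = (\<lambda>a b z1 z2 y. of_bool (\<not> G a b z1 z2 y) :: real)"
  define bb where "bb = (\<lambda>a b z1 z2 y. of_bool (G a b z1 z2 y) :: real)"
  have finC: "finite C1" "finite C2"
    unfolding C1_def C2_def using fin by (auto intro: finite_PiE)
  have w0: "0 \<le> w1 c" "0 \<le> w2 c'" for c c'
    by (auto simp: w1_def w2_def R10 R20 intro: prod_nonneg)
  have wt: "(\<Sum>c\<in>C1. w1 c) = 1" "(\<Sum>c\<in>C2. w2 c) = 1"
    unfolding C1_def C2_def w1_def w2_def using fin R11 R21 by (auto intro: codebook_total)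
  have inC: "c1 a \<in> Z1" if "c1 \<in> C1" "a \<in> A1" for c1 a using that by (auto simp: C1_def)
  have inC2: "c2 b \<in> Z2" if "c2 \<in> C2" "b \<in> A2" for c2 b using that by (auto simp: C2_def)
  define err where "err = (\<lambda>c1 c2 a b. \<Sum>y | y \<in> Y \<and> d c1 c2 y \<noteq> (a, b). ch (c1 a) (c2 b) y)"
  define t0 where "t0 = (\<lambda>a b. \<Sum>z1\<in>Z1. \<Sum>z2\<in>Z2. R1 a z1 * R2 b z2 * (\<Sum>y\<in>Y. ch z1 z2 y * b0 a b z1 z2 y))"
  \<comment> \<open>This holds for each codebook; averaging starts with \<open>E0\<close> to
    \<open>E3\<close>. The three sums over wrong pairs are kept apart because they share different
    codewords with the transmitted pair.\<close>
  have err_le: "err c1 c2 a b \<le> (\<Sum>y\<in>Y. ch (c1 a) (c2 b) y * b0 a b (c1 a) (c2 b) y)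
      + (\<Sum>a'\<in>A1-{a}. \<Sum>y\<in>Y. ch (c1 a) (c2 b) y * bb a' b (c1 a') (c2 b) y)
      + (\<Sum>b'\<in>A2-{b}. \<Sum>y\<in>Y. ch (c1 a) (c2 b) y * bb a b' (c1 a) (c2 b') y)
      + (\<Sum>a'\<in>A1-{a}. \<Sum>b'\<in>A2-{b}. \<Sum>y\<in>Y. ch (c1 a) (c2 b) y * bb a' b' (c1 a') (c2 b') y)"
    (is "_ \<le> ?rhs") if ab: "a \<in> A1" "b \<in> A2" for c1 c2 a b
  proof -
    define B where "B = (\<lambda>y. b0 a b (c1 a) (c2 b) y + (\<Sum>a'\<in>A1-{a}. bb a' b (c1 a') (c2 b) y)
      + (\<Sum>b'\<in>A2-{b}. bb a b' (c1 a) (c2 b') y)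
      + (\<Sum>a'\<in>A1-{a}. \<Sum>b'\<in>A2-{b}. bb a' b' (c1 a') (c2 b') y))"
    have nn: "0 \<le> b0 a b (c1 a) (c2 b) y" "0 \<le> (\<Sum>a'\<in>A1-{a}. bb a' b (c1 a') (c2 b) y)"
        "0 \<le> (\<Sum>b'\<in>A2-{b}. bb a b' (c1 a) (c2 b') y)"
        "0 \<le> (\<Sum>a'\<in>A1-{a}. \<Sum>b'\<in>A2-{b}. bb a' b' (c1 a') (c2 b') y)" for y
      by (auto simp: b0_def bb_def intro!: sum_nonneg)
    have B0: "0 \<le> B y" for y
      unfolding B_def using nn[of y] by linarith
    have B1: "1 \<le> B y" if "d c1 c2 y \<noteq> (a, b)" for y
    proof (cases "G a b (c1 a) (c2 b) y")
      case False
      then have "b0 a b (c1 a) (c2 b) y = 1" by (simp add: b0_def)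
      then show ?thesis unfolding B_def using nn[of y] by linarith
    next
      case True
      then have "ok c1 c2 y (a, b)" using ab by (simp add: ok_def)
      then have "ok c1 c2 y (d c1 c2 y)" unfolding d_def by (rule someI)
      moreover obtain a' b' where "d c1 c2 y = (a', b')" by (cases "d c1 c2 y")
      ultimately have p: "a' \<in> A1" "b' \<in> A2" "G a' b' (c1 a') (c2 b') y" "(a', b') \<noteq> (a, b)"
        using that by (auto simp: ok_def)
      then consider "a' \<noteq> a" "b' = b" | "a' = a" "b' \<noteq> b" | "a' \<noteq> a" "b' \<noteq> b" by auto
      then show ?thesis
      proof cases
        case 1
        have "bb a' b (c1 a') (c2 b) y \<le> (\<Sum>a'\<in>A1-{a}. bb a' b (c1 a') (c2 b) y)"
          using fin p 1 by (intro member_le_sum) (auto simp: bb_def)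
        moreover have "bb a' b (c1 a') (c2 b) y = 1" using p 1 by (simp add: bb_def)
        ultimately show ?thesis unfolding B_def using nn[of y] by linarith
      next
        case 2
        have "bb a b' (c1 a) (c2 b') y \<le> (\<Sum>b'\<in>A2-{b}. bb a b' (c1 a) (c2 b') y)"
          using fin p 2 by (intro member_le_sum) (auto simp: bb_def)
        moreover have "bb a b' (c1 a) (c2 b') y = 1" using p 2 by (simp add: bb_def)
        ultimately show ?thesis unfolding B_def using nn[of y] by linarith
      next
        case 3
        have "bb a' b' (c1 a') (c2 b') y \<le> (\<Sum>b'\<in>A2-{b}. bb a' b' (c1 a') (c2 b') y)"
          using fin p 3 by (intro member_le_sum) (auto simp: bb_def)
        also have "\<dots> \<le> (\<Sum>a'\<in>A1-{a}. \<Sum>b'\<in>A2-{b}. bb a' b' (c1 a') (c2 b') y)"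
          using fin p 3 by (intro member_le_sum[where f = "\<lambda>a'. \<Sum>b'\<in>A2-{b}. bb a' b' (c1 a') (c2 b') y"])
            (auto simp: bb_def intro!: sum_nonneg)
        finally have "bb a' b' (c1 a') (c2 b') y \<le> \<dots>" .
        moreover have "bb a' b' (c1 a') (c2 b') y = 1" using p 3 by (simp add: bb_def)
        ultimately show ?thesis unfolding B_def using nn[of y] by linarith
      qed
    qed
    have "err c1 c2 a b \<le> (\<Sum>y | y \<in> Y \<and> d c1 c2 y \<noteq> (a, b). ch (c1 a) (c2 b) y * B y)"
      unfolding err_def
    proof (rule sum_mono)
      fix y assume "y \<in> {y \<in> Y. d c1 c2 y \<noteq> (a, b)}"
      then have "1 \<le> B y" using B1 by auto
      then show "ch (c1 a) (c2 b) y \<le> ch (c1 a) (c2 b) y * B y"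
        using ch0[of "c1 a" "c2 b" y] mult_left_mono by fastforce
    qed
    also have "\<dots> \<le> (\<Sum>y\<in>Y. ch (c1 a) (c2 b) y * B y)"
      using fin B0 ch0 by (intro sum_mono2) auto
    also have "\<dots> = ?rhs"
      unfolding B_def distrib_left sum.distrib sum_distrib_left
      by (subst (2 3 4) sum.swap, subst (7) sum.swap) simp
    finally show ?thesis .
  qed
  have R1R2: "(\<Sum>z1\<in>Z1. \<Sum>z2\<in>Z2. R1 a z1 * R2 b z2 * (\<Sum>y\<in>Y. ch z1 z2 y * e)) = e" if "a \<in> A1" "b \<in> A2" for a b e
  proof -
    have "(\<Sum>z1\<in>Z1. \<Sum>z2\<in>Z2. R1 a z1 * R2 b z2 * (\<Sum>y\<in>Y. ch z1 z2 y * e))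
      = (\<Sum>z1\<in>Z1. \<Sum>z2\<in>Z2. R1 a z1 * (R2 b z2 * e))"
      by (intro sum.cong refl) (simp add: sum_distrib_right[symmetric] ch1)
    also have "\<dots> = e"
      by (simp only: sum_distrib_left[symmetric] sum_distrib_right[symmetric] R11[OF that(1)] R21[OF that(2)] mult_1_left mult_1_right)
    finally show ?thesis .
  qed
  have EB1: "(\<Sum>c2\<in>C2. w2 c2 * H (c2 b)) = (\<Sum>z2\<in>Z2. R2 b z2 * H z2)" if "b \<in> A2" for b H
    unfolding w2_def C2_def by (rule codebook_one[OF fin(2) fin(4) R21 that])
  have EB2: "(\<Sum>c2\<in>C2. w2 c2 * H (c2 b) (c2 b')) = (\<Sum>z2\<in>Z2. \<Sum>z'\<in>Z2. R2 b z2 * R2 b' z' * H z2 z')"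
    if "b \<in> A2" "b' \<in> A2" "b \<noteq> b'" for b b' H
    unfolding w2_def C2_def by (rule codebook_two[OF fin(2) fin(4) R21 that])
  have E0: "(\<Sum>c1\<in>C1. \<Sum>c2\<in>C2. w1 c1 * w2 c2 * F (c1 a) (c2 b)) =
      (\<Sum>z1\<in>Z1. \<Sum>z2\<in>Z2. R1 a z1 * R2 b z2 * F z1 z2)" if "a \<in> A1" "b \<in> A2" for a b F
  proof -
    have "(\<Sum>c1\<in>C1. \<Sum>c2\<in>C2. w1 c1 * w2 c2 * F (c1 a) (c2 b)) =
      (\<Sum>c1\<in>C1. w1 c1 * (\<Sum>z2\<in>Z2. R2 b z2 * F (c1 a) z2))"
      unfolding EB1[OF that(2), where H = "F (_ a)", symmetric] by (simp add: sum_distrib_left mult.assoc)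
    also have "\<dots> = (\<Sum>z1\<in>Z1. R1 a z1 * (\<Sum>z2\<in>Z2. R2 b z2 * F z1 z2))"
      unfolding w1_def C1_def using codebook_one[OF fin(1) fin(3) R11 that(1), where F = "\<lambda>z. \<Sum>z2\<in>Z2. R2 b z2 * F z z2"] by simp
    finally show ?thesis by (simp add: sum_distrib_left mult.assoc)
  qed
  have E1: "(\<Sum>c1\<in>C1. \<Sum>c2\<in>C2. w1 c1 * w2 c2 * F (c1 a) (c1 a') (c2 b)) =
      (\<Sum>z1\<in>Z1. \<Sum>z'\<in>Z1. \<Sum>z2\<in>Z2. R1 a z1 * R1 a' z' * R2 b z2 * F z1 z' z2)"
    if "a \<in> A1" "a' \<in> A1" "a \<noteq> a'" "b \<in> A2" for a a' b F
  proof -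
    have "(\<Sum>c1\<in>C1. \<Sum>c2\<in>C2. w1 c1 * w2 c2 * F (c1 a) (c1 a') (c2 b)) =
      (\<Sum>c1\<in>C1. w1 c1 * (\<Sum>z2\<in>Z2. R2 b z2 * F (c1 a) (c1 a') z2))"
      unfolding EB1[OF that(4), where H = "F (_ a) (_ a')", symmetric] by (simp add: sum_distrib_left mult.assoc)
    also have "\<dots> = (\<Sum>z1\<in>Z1. \<Sum>z'\<in>Z1. R1 a z1 * R1 a' z' * (\<Sum>z2\<in>Z2. R2 b z2 * F z1 z' z2))"
      unfolding w1_def C1_def using codebook_two[OF fin(1) fin(3) R11 that(1-3), where F = "\<lambda>z z'. \<Sum>z2\<in>Z2. R2 b z2 * F z z' z2"] by simp
    finally show ?thesis by (simp add: sum_distrib_left mult.assoc)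
  qed
  have E2: "(\<Sum>c1\<in>C1. \<Sum>c2\<in>C2. w1 c1 * w2 c2 * F (c1 a) (c2 b) (c2 b')) =
      (\<Sum>z1\<in>Z1. \<Sum>z2\<in>Z2. \<Sum>z'\<in>Z2. R1 a z1 * (R2 b z2 * R2 b' z') * F z1 z2 z')"
    if "b \<in> A2" "b' \<in> A2" "b \<noteq> b'" "a \<in> A1" for a b b' F
  proof -
    have "(\<Sum>c1\<in>C1. \<Sum>c2\<in>C2. w1 c1 * w2 c2 * F (c1 a) (c2 b) (c2 b')) =
      (\<Sum>c1\<in>C1. w1 c1 * (\<Sum>z2\<in>Z2. \<Sum>z'\<in>Z2. R2 b z2 * R2 b' z' * F (c1 a) z2 z'))"
      unfolding EB2[OF that(1-3), where H = "F (_ a)", symmetric] by (simp add: sum_distrib_left mult.assoc)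
    also have "\<dots> = (\<Sum>z1\<in>Z1. R1 a z1 * (\<Sum>z2\<in>Z2. \<Sum>z'\<in>Z2. R2 b z2 * R2 b' z' * F z1 z2 z'))"
      unfolding w1_def C1_def using codebook_one[OF fin(1) fin(3) R11 that(4), where F = "\<lambda>z. \<Sum>z2\<in>Z2. \<Sum>z'\<in>Z2. R2 b z2 * R2 b' z' * F z z2 z'"] by simp
    finally show ?thesis by (simp add: sum_distrib_left mult.assoc)
  qed
  have E3: "(\<Sum>c1\<in>C1. \<Sum>c2\<in>C2. w1 c1 * w2 c2 * F (c1 a) (c1 a') (c2 b) (c2 b')) =
      (\<Sum>z1\<in>Z1. \<Sum>z1'\<in>Z1. \<Sum>z2\<in>Z2. \<Sum>z2'\<in>Z2. R1 a z1 * R1 a' z1' * (R2 b z2 * R2 b' z2') * F z1 z1' z2 z2')"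
    if "b \<in> A2" "b' \<in> A2" "b \<noteq> b'" "a \<in> A1" "a' \<in> A1" "a \<noteq> a'" for a a' b b' F
  proof -
    have "(\<Sum>c1\<in>C1. \<Sum>c2\<in>C2. w1 c1 * w2 c2 * F (c1 a) (c1 a') (c2 b) (c2 b')) =
      (\<Sum>c1\<in>C1. w1 c1 * (\<Sum>z2\<in>Z2. \<Sum>z'\<in>Z2. R2 b z2 * R2 b' z' * F (c1 a) (c1 a') z2 z'))"
      unfolding EB2[OF that(1-3), where H = "F (_ a) (_ a')", symmetric] by (simp add: sum_distrib_left mult.assoc)
    also have "\<dots> = (\<Sum>z1\<in>Z1. \<Sum>z1'\<in>Z1. R1 a z1 * R1 a' z1' * (\<Sum>z2\<in>Z2. \<Sum>z'\<in>Z2. R2 b z2 * R2 b' z' * F z1 z1' z2 z'))"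
      unfolding w1_def C1_def using codebook_two[OF fin(1) fin(3) R11 that(4-6), where F = "\<lambda>z z1'. \<Sum>z2\<in>Z2. \<Sum>z'\<in>Z2. R2 b z2 * R2 b' z' * F z z1' z2 z'"] by simp
    finally show ?thesis by (simp add: sum_distrib_left mult.assoc)
  qed
  \<comment> \<open>For \<open>a' \<noteq> a\<close> the codeword of \<open>a'\<close> is
    independent of both transmitted codewords and of \<open>y\<close>. Its sum is moved innermost
    and bounded by \<epsilon>1 for all \<open>z2\<close> and \<open>y\<close>; the remaining weights
    sum to one by \<open>R1R2\<close>. \<open>T2\<close> and \<open>T3\<close> have the same
    plan.\<close>
  have T1: "(\<Sum>c1\<in>C1. \<Sum>c2\<in>C2. w1 c1 * w2 c2 * (\<Sum>a'\<in>A1-{a}. \<Sum>y\<in>Y. ch (c1 a) (c2 b) y * bb a' b (c1 a') (c2 b) y)) \<le> \<epsilon>1"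
    (is "?l \<le> _") if ab: "a \<in> A1" "b \<in> A2" for a b
  proof -
    have "?l = (\<Sum>a'\<in>A1-{a}. \<Sum>c1\<in>C1. \<Sum>c2\<in>C2. w1 c1 * w2 c2 * (\<Sum>y\<in>Y. ch (c1 a) (c2 b) y * bb a' b (c1 a') (c2 b) y))"
      unfolding sum_distrib_left[of _ _ "A1-{a}"] by (subst sum.swap[of _ "A1-{a}"], subst sum.swap[of _ "A1-{a}"]) (rule refl)
    also have "\<dots> = (\<Sum>a'\<in>A1-{a}. \<Sum>z1\<in>Z1. \<Sum>z'\<in>Z1. \<Sum>z2\<in>Z2. R1 a z1 * R1 a' z' * R2 b z2 * (\<Sum>y\<in>Y. ch z1 z2 y * bb a' b z' z2 y))"
      using ab by (intro sum.cong refl E1[where F = "\<lambda>z z' z2. \<Sum>y\<in>Y. ch z z2 y * bb _ b z' z2 y"]) auto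
    also have "\<dots> = (\<Sum>z1\<in>Z1. \<Sum>z2\<in>Z2. R1 a z1 * R2 b z2 * (\<Sum>y\<in>Y. ch z1 z2 y * (\<Sum>a'\<in>A1-{a}. \<Sum>z'\<in>Z1. R1 a' z' * bb a' b z' z2 y)))"
      apply (subst sum.swap[of _ _ "A1-{a}"])
      apply (rule sum.cong[OF refl])
      apply (simp only: sum_distrib_left)
      apply (subst sum.swap[of _ Z2 Z1])
      apply (subst sum.swap[of _ Z2 "A1-{a}"])
      apply (rule sum.cong[OF refl])
      apply (subst sum.swap[of _ Y Z1])
      apply (subst sum.swap[of _ Y "A1-{a}"])
      apply (simp add: mult_ac)
      done
    also have "\<dots> \<le> (\<Sum>z1\<in>Z1. \<Sum>z2\<in>Z2. R1 a z1 * R2 b z2 * (\<Sum>y\<in>Y. ch z1 z2 y * \<epsilon>1))"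
    proof (intro sum_mono mult_left_mono)
      fix z2 y assume "z2 \<in> Z2" "y \<in> Y"
      have "(\<Sum>a'\<in>A1-{a}. \<Sum>z'\<in>Z1. R1 a' z' * bb a' b z' z2 y) \<le> (\<Sum>a'\<in>A1. \<Sum>z'\<in>Z1. R1 a' z' * bb a' b z' z2 y)"
        using fin R10 by (intro sum_mono2) (auto simp: bb_def intro!: sum_nonneg)
      also have "\<dots> \<le> \<epsilon>1" unfolding bb_def using e1 \<open>z2 \<in> Z2\<close> \<open>y \<in> Y\<close> ab by blast
      finally show "(\<Sum>a'\<in>A1-{a}. \<Sum>z'\<in>Z1. R1 a' z' * bb a' b z' z2 y) \<le> \<epsilon>1" .
    qed (auto simp: ch0 R10 R20)
    also have "\<dots> = \<epsilon>1" using R1R2 ab by blast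
    finally show ?thesis .
  qed
  have T2: "(\<Sum>c1\<in>C1. \<Sum>c2\<in>C2. w1 c1 * w2 c2 * (\<Sum>b'\<in>A2-{b}. \<Sum>y\<in>Y. ch (c1 a) (c2 b) y * bb a b' (c1 a) (c2 b') y)) \<le> \<epsilon>2"
    (is "?l \<le> _") if ab: "a \<in> A1" "b \<in> A2" for a b
  proof -
    have "?l = (\<Sum>b'\<in>A2-{b}. \<Sum>c1\<in>C1. \<Sum>c2\<in>C2. w1 c1 * w2 c2 * (\<Sum>y\<in>Y. ch (c1 a) (c2 b) y * bb a b' (c1 a) (c2 b') y))"
      unfolding sum_distrib_left[of _ _ "A2-{b}"] by (subst sum.swap[of _ "A2-{b}"], subst sum.swap[of _ "A2-{b}"]) (rule refl)
    also have "\<dots> = (\<Sum>b'\<in>A2-{b}. \<Sum>z1\<in>Z1. \<Sum>z2\<in>Z2. \<Sum>z'\<in>Z2. R1 a z1 * (R2 b z2 * R2 b' z') * (\<Sum>y\<in>Y. ch z1 z2 y * bb a b' z1 z' y))"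
      using ab by (intro sum.cong refl E2[where F = "\<lambda>z1 z2 z'. \<Sum>y\<in>Y. ch z1 z2 y * bb a _ z1 z' y"]) auto
    also have "\<dots> = (\<Sum>z1\<in>Z1. \<Sum>z2\<in>Z2. R1 a z1 * R2 b z2 * (\<Sum>y\<in>Y. ch z1 z2 y * (\<Sum>b'\<in>A2-{b}. \<Sum>z'\<in>Z2. R2 b' z' * bb a b' z1 z' y)))"
      apply (subst sum.swap[of _ _ "A2-{b}"])
      apply (rule sum.cong[OF refl])
      apply (simp only: sum_distrib_left)
      apply (subst sum.swap[of _ Z2 "A2-{b}"])
      apply (rule sum.cong[OF refl])
      apply (subst sum.swap[of _ Y Z2])
      apply (subst sum.swap[of _ Y "A2-{b}"])
      apply (simp add: mult_ac)
      done
    also have "\<dots> \<le> (\<Sum>z1\<in>Z1. \<Sum>z2\<in>Z2. R1 a z1 * R2 b z2 * (\<Sum>y\<in>Y. ch z1 z2 y * \<epsilon>2))"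
    proof (intro sum_mono mult_left_mono)
      fix z1 y assume "z1 \<in> Z1" "y \<in> Y"
      have "(\<Sum>b'\<in>A2-{b}. \<Sum>z'\<in>Z2. R2 b' z' * bb a b' z1 z' y) \<le> (\<Sum>b'\<in>A2. \<Sum>z'\<in>Z2. R2 b' z' * bb a b' z1 z' y)"
        using fin R20 by (intro sum_mono2) (auto simp: bb_def intro!: sum_nonneg)
      also have "\<dots> \<le> \<epsilon>2" unfolding bb_def using e2 \<open>z1 \<in> Z1\<close> \<open>y \<in> Y\<close> ab by blast
      finally show "(\<Sum>b'\<in>A2-{b}. \<Sum>z'\<in>Z2. R2 b' z' * bb a b' z1 z' y) \<le> \<epsilon>2" .
    qed (auto simp: ch0 R10 R20)
    also have "\<dots> = \<epsilon>2" using R1R2 ab by blast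
    finally show ?thesis .
  qed
  have T3: "(\<Sum>c1\<in>C1. \<Sum>c2\<in>C2. w1 c1 * w2 c2 * (\<Sum>a'\<in>A1-{a}. \<Sum>b'\<in>A2-{b}. \<Sum>y\<in>Y. ch (c1 a) (c2 b) y * bb a' b' (c1 a') (c2 b') y)) \<le> \<epsilon>3"
    (is "?l \<le> _") if ab: "a \<in> A1" "b \<in> A2" for a b
  proof -
    have "?l = (\<Sum>a'\<in>A1-{a}. \<Sum>b'\<in>A2-{b}. \<Sum>c1\<in>C1. \<Sum>c2\<in>C2. w1 c1 * w2 c2 * (\<Sum>y\<in>Y. ch (c1 a) (c2 b) y * bb a' b' (c1 a') (c2 b') y))"
      unfolding sum_distrib_left[of _ _ "A2-{b}"] sum_distrib_left[of _ _ "A1-{a}"]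
      by (subst sum.swap[of _ "A1-{a}" C2], subst sum.swap[of _ "A1-{a}" C1],
          subst sum.swap[of _ "A2-{b}" C2], subst sum.swap[of _ "A2-{b}" C1]) (rule refl)
    also have "\<dots> = (\<Sum>a'\<in>A1-{a}. \<Sum>b'\<in>A2-{b}. \<Sum>z1\<in>Z1. \<Sum>z1'\<in>Z1. \<Sum>z2\<in>Z2. \<Sum>z'\<in>Z2. R1 a z1 * R1 a' z1' * (R2 b z2 * R2 b' z') * (\<Sum>y\<in>Y. ch z1 z2 y * bb a' b' z1' z' y))"
      using ab by (intro sum.cong refl E3[where F = "\<lambda>z1 z1' z2 z'. \<Sum>y\<in>Y. ch z1 z2 y * bb _ _ z1' z' y"]) auto
    also have "\<dots> = (\<Sum>z1\<in>Z1. \<Sum>z2\<in>Z2. R1 a z1 * R2 b z2 * (\<Sum>y\<in>Y. ch z1 z2 y * (\<Sum>a'\<in>A1-{a}. \<Sum>b'\<in>A2-{b}. \<Sum>z1'\<in>Z1. \<Sum>z'\<in>Z2. R1 a' z1' * R2 b' z' * bb a' b' z1' z' y)))"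
      apply (simp only: sum_distrib_left)
      apply (subst sum.swap[of _ Z1 "A2-{b}"])
      apply (subst sum.swap[of _ Z1 "A1-{a}"])
      apply (rule sum.cong[OF refl])
      apply (subst sum.swap[of _ Z2 Z1])
      apply (subst sum.swap[of _ Z2 "A2-{b}"])
      apply (subst sum.swap[of _ Z2 "A1-{a}"])
      apply (rule sum.cong[OF refl])
      apply (subst sum.swap[of _ Y Z2])
      apply (subst sum.swap[of _ Y Z1])
      apply (subst sum.swap[of _ Y "A2-{b}"])
      apply (subst sum.swap[of _ Y "A1-{a}"])
      apply (simp add: mult_ac)
      done
    also have "\<dots> \<le> (\<Sum>z1\<in>Z1. \<Sum>z2\<in>Z2. R1 a z1 * R2 b z2 * (\<Sum>y\<in>Y. ch z1 z2 y * \<epsilon>3))"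
    proof (intro sum_mono mult_left_mono)
      fix y assume "y \<in> Y"
      have "(\<Sum>a'\<in>A1-{a}. \<Sum>b'\<in>A2-{b}. \<Sum>z1'\<in>Z1. \<Sum>z'\<in>Z2. R1 a' z1' * R2 b' z' * bb a' b' z1' z' y)
        \<le> (\<Sum>a'\<in>A1-{a}. \<Sum>b'\<in>A2. \<Sum>z1'\<in>Z1. \<Sum>z'\<in>Z2. R1 a' z1' * R2 b' z' * bb a' b' z1' z' y)"
        using fin R20 R10 by (intro sum_mono sum_mono2) (auto simp: bb_def intro!: sum_nonneg)
      also have "\<dots> \<le> (\<Sum>a'\<in>A1. \<Sum>b'\<in>A2. \<Sum>z1'\<in>Z1. \<Sum>z'\<in>Z2. R1 a' z1' * R2 b' z' * bb a' b' z1' z' y)"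
        using fin R20 R10 by (intro sum_mono2) (auto simp: bb_def intro!: sum_nonneg)
      also have "\<dots> \<le> \<epsilon>3" unfolding bb_def using e3 \<open>y \<in> Y\<close> by blast
      finally show "(\<Sum>a'\<in>A1-{a}. \<Sum>b'\<in>A2-{b}. \<Sum>z1'\<in>Z1. \<Sum>z'\<in>Z2. R1 a' z1' * R2 b' z' * bb a' b' z1' z' y) \<le> \<epsilon>3" .
    qed (auto simp: ch0 R10 R20)
    also have "\<dots> = \<epsilon>3" using R1R2 ab by blast
    finally show ?thesis .
  qed
  have T: "(\<Sum>c1\<in>C1. \<Sum>c2\<in>C2. w1 c1 * w2 c2 * err c1 c2 a b) \<le> t0 a b + (\<epsilon>1 + \<epsilon>2 + \<epsilon>3)"
    if ab: "a \<in> A1" "b \<in> A2" for a b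
  proof -
    have "(\<Sum>c1\<in>C1. \<Sum>c2\<in>C2. w1 c1 * w2 c2 * err c1 c2 a b) \<le>
      (\<Sum>c1\<in>C1. \<Sum>c2\<in>C2. w1 c1 * w2 c2 * (
       (\<Sum>y\<in>Y. ch (c1 a) (c2 b) y * b0 a b (c1 a) (c2 b) y)
      + (\<Sum>a'\<in>A1-{a}. \<Sum>y\<in>Y. ch (c1 a) (c2 b) y * bb a' b (c1 a') (c2 b) y)
      + (\<Sum>b'\<in>A2-{b}. \<Sum>y\<in>Y. ch (c1 a) (c2 b) y * bb a b' (c1 a) (c2 b') y)
      + (\<Sum>a'\<in>A1-{a}. \<Sum>b'\<in>A2-{b}. \<Sum>y\<in>Y. ch (c1 a) (c2 b) y * bb a' b' (c1 a') (c2 b') y)))"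
      using w0 by (intro sum_mono mult_left_mono err_le[OF ab]) auto
    also have "\<dots> \<le> t0 a b + (\<epsilon>1 + \<epsilon>2 + \<epsilon>3)"
      unfolding distrib_left[of "w1 _ * w2 _"] sum.distrib t0_def
      using T1[OF ab] T2[OF ab] T3[OF ab] E0[OF ab, where F = "\<lambda>z1 z2. \<Sum>y\<in>Y. ch z1 z2 y * b0 a b z1 z2 y"]
      by linarith
    finally show ?thesis .
  qed
  define tot where "tot = (\<lambda>c1 c2. \<Sum>a\<in>A1. \<Sum>b\<in>A2. P a b * err c1 c2 a b)"
  have "(\<Sum>c1\<in>C1. \<Sum>c2\<in>C2. w1 c1 * w2 c2 * tot c1 c2)
      = (\<Sum>a\<in>A1. \<Sum>b\<in>A2. P a b * (\<Sum>c1\<in>C1. \<Sum>c2\<in>C2. w1 c1 * w2 c2 * err c1 c2 a b))"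
    unfolding tot_def
    apply (simp only: sum_distrib_left)
    apply (subst sum.swap[of _ A1 C2])
    apply (subst sum.swap[of _ A2 C2])
    apply (subst sum.swap[of _ A1 C1])
    apply (subst sum.swap[of _ A2 C1])
    apply (simp add: mult_ac)
    done
  also have "\<dots> \<le> (\<Sum>a\<in>A1. \<Sum>b\<in>A2. P a b * (t0 a b + (\<epsilon>1 + \<epsilon>2 + \<epsilon>3)))"
    using P0 by (intro sum_mono mult_left_mono T) auto
  also have "\<dots> = (\<Sum>a\<in>A1. \<Sum>b\<in>A2. P a b * t0 a b) + (\<epsilon>1 + \<epsilon>2 + \<epsilon>3)"
    unfolding distrib_left[of "P _ _"] sum.distrib sum_distrib_right[symmetric] P1 by simp
  also have "\<dots> \<le> \<epsilon>0 + (\<epsilon>1 + \<epsilon>2 + \<epsilon>3)"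
    using e0 unfolding t0_def b0_def by simp
  finally have avg: "(\<Sum>c1\<in>C1. \<Sum>c2\<in>C2. w1 c1 * w2 c2 * tot c1 c2) \<le> \<epsilon>0 + (\<epsilon>1 + \<epsilon>2 + \<epsilon>3)" .
  have "\<exists>c\<in>C1 \<times> C2. tot (fst c) (snd c) \<le> \<epsilon>0 + (\<epsilon>1 + \<epsilon>2 + \<epsilon>3)"
  proof (rule exists_le_average[where w = "\<lambda>c. w1 (fst c) * w2 (snd c)"])
    show "(\<Sum>c\<in>C1 \<times> C2. w1 (fst c) * w2 (snd c)) = 1"
      by (simp add: sum.cartesian_product' sum_distrib_left[symmetric] wt)
    show "(\<Sum>c\<in>C1 \<times> C2. w1 (fst c) * w2 (snd c) * tot (fst c) (snd c)) \<le> \<epsilon>0 + (\<epsilon>1 + \<epsilon>2 + \<epsilon>3)"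
      using avg by (simp add: sum.cartesian_product')
  qed (use finC w0 in auto)
  then obtain c1 c2 where "c1 \<in> C1" "c2 \<in> C2" "tot c1 c2 \<le> \<epsilon>0 + (\<epsilon>1 + \<epsilon>2 + \<epsilon>3)" by auto
  then show ?thesis
    unfolding tot_def err_def C1_def C2_def
    by (intro exI[of _ c1] exI[of _ c2] exI[of _ "d c1 c2"]) (auto simp: add.assoc)
qed

section \<open>Concatenation of blocks\<close>

text \<open>A list of length \<open>m * l + r\<close> is cut into \<open>m\<close> blocks of length \<open>l\<close>; the weight \<open>c\<close> and the
  letter \<open>u\<close> serve the \<open>r\<close> left-over symbols, over which the decoder simply enumerates.\<close>

fun chunk_prod :: "('z list \<Rightarrow> real) \<Rightarrow> ('z \<Rightarrow> real) \<Rightarrow> nat \<Rightarrow> nat \<Rightarrow> 'z list \<Rightarrow> real" where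
  "chunk_prod F c l 0 z = prod_list (map c z)"
| "chunk_prod F c l (Suc m) z = F (take l z) * chunk_prod F c l m (drop l z)"

fun chunk_map :: "('a list \<Rightarrow> 'u list) \<Rightarrow> 'u \<Rightarrow> nat \<Rightarrow> nat \<Rightarrow> 'a list \<Rightarrow> 'u list" where
  "chunk_map C u l 0 s = replicate (length s) u"
| "chunk_map C u l (Suc m) s = C (take l s) @ chunk_map C u l m (drop l s)"

lemma length_chunk_map:
  assumes "\<And>s. length s = l \<Longrightarrow> length (C s) = l" "length s = m * l + r"
  shows "length (chunk_map C u l m s) = length s"
  using assms(2) by (induction m arbitrary: s) (auto simp: assms(1))

lemma sum_chunk_prod:
  "(\<Sum>z\<in>Len (m * l + r). chunk_prod F c l m z) = (\<Sum>z\<in>Len l. F z) ^ m * (\<Sum>x\<in>UNIV. c x) ^ r"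
  for c :: "'z::finite \<Rightarrow> real"
proof (induction m)
  case 0
  show ?case by (simp add: sum_Len_prod_list)
next
  case (Suc m)
  have "(\<Sum>z\<in>Len (l + (m * l + r)). chunk_prod F c l (Suc m) z)
    = (\<Sum>a\<in>Len l. \<Sum>b\<in>Len (m * l + r). F a * chunk_prod F c l m b)"
    unfolding sum_Len_append by (intro sum.cong refl) auto
  also have "\<dots> = (\<Sum>z\<in>Len l. F z) * ((\<Sum>z\<in>Len l. F z) ^ m * (\<Sum>x\<in>UNIV. c x) ^ r)"
    by (simp add: sum_distrib_left[symmetric] sum_distrib_right[symmetric] Suc.IH)
  finally show ?case by (simp add: add.assoc mult_ac)
qed

lemma chunk_prod_nonneg:
  assumes "\<And>z. 0 \<le> F z" "\<And>x. 0 \<le> c x"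
  shows "0 \<le> chunk_prod F c l m z"
  using assms by (induction m arbitrary: z) (auto intro!: prod_list_nonneg_map)

lemma chunk_prod_mult:
  "chunk_prod F c l m z * chunk_prod F' c' l m z = chunk_prod (\<lambda>z. F z * F' z) (\<lambda>x. c x * c' x) l m z"
proof (induction m arbitrary: z)
  case (Suc m)
  then show ?case by (simp add: Suc.IH[symmetric] mult_ac)
qed (simp add: prod_list_mult_map)

lemma prod_list_eq_chunk_prod:
  "prod_list (map c z) = chunk_prod (\<lambda>z. prod_list (map c z)) c l m z"
proof (induction m arbitrary: z)
  case (Suc m)
  have "prod_list (map c z) = prod_list (map c (take l z @ drop l z))" by (simp only: append_take_drop_id)
  also have "\<dots> = prod_list (map c (take l z)) * prod_list (map c (drop l z))"
    by (simp only: map_append prod_list.append)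
  finally show ?case by (simp add: Suc.IH[symmetric])
qed simp

lemma sum_fiber_append:
  fixes f :: "'z::finite list \<Rightarrow> real"
  assumes "length b = l + k"
  shows "(\<Sum>z | length z = l + k \<and> map p z = b. f z)
    = (\<Sum>x | length x = l \<and> map p x = take l b. \<Sum>y | length y = k \<and> map p y = drop l b. f (x @ y))"
proof -
  have F: "finite {x :: 'z list. length x = j \<and> Q x}" for j Q
    by (rule finite_subset[OF _ finite_Len[of j]]) auto
  have "(\<Sum>z | length z = l + k \<and> map p z = b. f z) = (\<Sum>q\<in>{x. length x = l \<and> map p x = take l b} \<times> {y. length y = k \<and> map p y = drop l b}. f (fst q @ snd q))"
    by (rule sum.reindex_bij_witness[of _ "\<lambda>q. fst q @ snd q" "\<lambda>z. (take l z, drop l z)"])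
       (use assms in \<open>auto simp: take_map drop_map\<close>)
  also have "\<dots> = (\<Sum>x | length x = l \<and> map p x = take l b. \<Sum>y | length y = k \<and> map p y = drop l b. f (x @ y))"
    by (subst sum.cartesian_product) (simp add: split_def)
  finally show ?thesis .
qed

text \<open>Every full block contributes at most one by \<open>F1\<close>. The \<open>r\<close>
  left-over symbols are bounded crudely by counting them all, which is affordable because
  \<open>r\<close> stays below the block length in the application.\<close>

lemma sum_fiber_chunk_prod_le:
  fixes c :: "'z::finite \<Rightarrow> real"
  assumes F0: "\<And>z. 0 \<le> F z" and c01: "\<And>x. 0 \<le> c x \<and> c x \<le> 1"
    and F1: "\<And>b. length b = l \<Longrightarrow> (\<Sum>z | length z = l \<and> map p z = b. F z) \<le> 1"
    and "length b = m * l + r"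
  shows "(\<Sum>z | length z = m * l + r \<and> map p z = b. chunk_prod F c l m z) \<le> real CARD('z) ^ r"
  using assms(4)
proof (induction m arbitrary: b)
  case 0
  have "(\<Sum>z | length z = 0 * l + r \<and> map p z = b. chunk_prod F c l 0 z)
    \<le> (\<Sum>z\<in>Len r. prod_list (map c z))"
    using c01 by (auto intro!: sum_mono2 prod_list_nonneg_map)
  also have "\<dots> = (\<Sum>x\<in>UNIV. c x) ^ r" by (rule sum_Len_prod_list)
  also have "\<dots> \<le> (\<Sum>x\<in>(UNIV :: 'z set). 1) ^ r"
    using c01 by (intro power_mono sum_mono sum_nonneg) auto
  finally show ?case by simp
next
  case (Suc m)
  let ?k = "m * l + r"
  have len: "length b = l + ?k" using Suc.prems by simp
  have "(\<Sum>z | length z = Suc m * l + r \<and> map p z = b. chunk_prod F c l (Suc m) z)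
    = (\<Sum>x | length x = l \<and> map p x = take l b. \<Sum>y | length y = ?k \<and> map p y = drop l b. F x * chunk_prod F c l m y)"
  proof -
    have "(\<Sum>z | length z = Suc m * l + r \<and> map p z = b. chunk_prod F c l (Suc m) z)
      = (\<Sum>x | length x = l \<and> map p x = take l b. \<Sum>y | length y = ?k \<and> map p y = drop l b. chunk_prod F c l (Suc m) (x @ y))"
      using sum_fiber_append[OF len, where p = p and f = "chunk_prod F c l (Suc m)"]
      by (simp only: mult_Suc add.assoc)
    also have "\<dots> = (\<Sum>x | length x = l \<and> map p x = take l b. \<Sum>y | length y = ?k \<and> map p y = drop l b. F x * chunk_prod F c l m y)"
      by (intro sum.cong refl) auto
    finally show ?thesis .
  qed
  also have "\<dots> = (\<Sum>x | length x = l \<and> map p x = take l b. F x) * (\<Sum>y | length y = ?k \<and> map p y = drop l b. chunk_prod F c l m y)"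
    by (simp add: sum_distrib_left[symmetric] sum_distrib_right[symmetric])
  also have "\<dots> \<le> 1 * real CARD('z) ^ r"
    using len F0 c01 by (intro mult_mono F1 Suc.IH sum_nonneg chunk_prod_nonneg) auto
  finally show ?case by simp
qed

text \<open>\<open>ln\<close> takes a default value outside the positive reals, so it turns the
  product over blocks into a sum only where every \<open>D\<close> is positive; on the support of
  \<open>J\<close> this is guaranteed.\<close>

lemma chunk_prod_exp_ln:
  assumes "\<And>z. length z = l \<Longrightarrow> J z \<noteq> 0 \<Longrightarrow> 0 < D z" "length z = m * l + r" "chunk_prod J j l m z \<noteq> 0"
  shows "0 < chunk_prod D (\<lambda>_. 1) l m z \<and>
    chunk_prod (\<lambda>z. exp (- t * ln (D z))) (\<lambda>_. 1) l m z = exp (- t * ln (chunk_prod D (\<lambda>_. 1) l m z))"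
  using assms(2,3)
proof (induction m arbitrary: z)
  case 0
  then show ?case by (simp add: prod_list_const_map)
next
  case (Suc m)
  have "length (drop l z) = m * l + r" "length (take l z) = l" "J (take l z) \<noteq> 0" "chunk_prod J j l m (drop l z) \<noteq> 0"
    using Suc.prems by auto
  with Suc.IH[of "drop l z"] assms(1)[of "take l z"]
  show ?case by (simp add: ln_mult_pos exp_add[symmetric] algebra_simps)
qed

text \<open>The moment generating function of \<open>- ln D\<close> equals one at zero and has a
  negative slope there, so a small positive \<open>t\<close> brings it below one. The claim covers
  all \<open>g\<close> up to \<gamma> so that several metrics can share one threshold rate.\<close>

lemma chernoff_exponent:
  fixes J D :: "'z \<Rightarrow> real"
  assumes "finite A" "(\<Sum>z\<in>A. J z) = 1" "0 < (\<Sum>z\<in>A. J z * ln (D z))" "\<And>z. 0 \<le> J z"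
  shows "\<exists>t>0. \<exists>\<gamma>>0. \<forall>g\<le>\<gamma>. exp (t * g) * (\<Sum>z\<in>A. J z * exp (- t * ln (D z))) < 1"
proof -
  define M where "M = (\<Sum>z\<in>A. J z * ln (D z))"
  \<comment> \<open>Spending half of the mean on the threshold leaves the slope
    \<open>M / 2 - M = - M / 2\<close> at zero.\<close>
  define f where "f = (\<lambda>t. exp (t * (M / 2)) * (\<Sum>z\<in>A. J z * exp (- t * ln (D z))))"
  have "(f has_real_derivative (exp (0 * (M/2)) * (M / 2) * (\<Sum>z\<in>A. J z * exp (- 0 * ln (D z)))
      + exp (0 * (M/2)) * (\<Sum>z\<in>A. J z * (exp (- 0 * ln (D z)) * (- ln (D z)))))) (at 0)"
    unfolding f_def by (auto intro!: derivative_eq_intros simp: mult.commute)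
  also have "exp (0 * (M/2)) * (M / 2) * (\<Sum>z\<in>A. J z * exp (- 0 * ln (D z)))
      + exp (0 * (M/2)) * (\<Sum>z\<in>A. J z * (exp (- 0 * ln (D z)) * (- ln (D z)))) = - M / 2"
    using assms by (simp add: M_def sum_negf)
  finally have der: "(f has_real_derivative (- M / 2)) (at 0)" .
  have "- M / 2 < 0" using assms by (simp add: M_def)
  from DERIV_neg_dec_right[OF der this] obtain d where d: "d > 0" "\<And>h. 0 < h \<Longrightarrow> h < d \<Longrightarrow> f (0 + h) < f 0"
    by auto
  have "f 0 = 1" using assms by (simp add: f_def)
  with d(2)[of "d/2"] d(1) have fd: "f (d/2) < 1" by simp
  have "\<forall>g\<le>M/2. exp (d/2 * g) * (\<Sum>z\<in>A. J z * exp (- (d/2) * ln (D z))) < 1"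
  proof (intro allI impI)
    fix g assume "g \<le> M/2"
    have "exp (d/2 * g) * (\<Sum>z\<in>A. J z * exp (- (d/2) * ln (D z))) \<le> f (d/2)"
      unfolding f_def using \<open>g \<le> M/2\<close> d(1) assms(4)
      by (intro mult_right_mono sum_nonneg) auto
    with fd show "exp (d/2 * g) * (\<Sum>z\<in>A. J z * exp (- (d/2) * ln (D z))) < 1" by simp
  qed
  moreover have "d/2 > 0" "M/2 > 0" using d assms by (auto simp: M_def)
  ultimately show ?thesis by blast
qed

lemma prod_list_map2_nth:
  "length xs = n \<Longrightarrow> length ys = n \<Longrightarrow> prod_list (map2 f xs ys) = (\<Prod>i<n. f (xs ! i) (ys ! i))"
  for f :: "'a \<Rightarrow> 'b \<Rightarrow> real"
  by (subst prod.list_conv_set_nth) (auto simp: atLeast0LessThan intro!: prod.cong)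

lemma prod_list_map_nth:
  "length xs = n \<Longrightarrow> prod_list (map f xs) = (\<Prod>i<n. f (xs ! i))"
  for f :: "'a \<Rightarrow> real"
  by (subst prod.list_conv_set_nth) (auto simp: atLeast0LessThan intro!: prod.cong)

lemma sum_Len_nth:
  fixes f :: "nat \<Rightarrow> 'b::finite \<Rightarrow> real"
  shows "(\<Sum>y\<in>Len n. \<Prod>i<n. f i (y ! i)) = (\<Prod>i<n. \<Sum>y\<in>UNIV. f i y)"
proof -
  have "(\<Sum>y\<in>Len n. \<Prod>i<n. f i (y ! i)) = (\<Sum>y\<in>Len (length [0..<n]). prod_list (map2 f [0..<n] y))"
    by (intro sum.cong) (auto simp: prod_list_map2_nth intro!: prod.cong)
  also have "\<dots> = (\<Prod>i<n. \<Sum>y\<in>UNIV. f i y)"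
    by (subst sum_Len_kernel) (auto simp: prod_list_map_nth[where n = n] intro!: prod.cong)
  finally show ?thesis .
qed

lemma sum_Len_nth2:
  fixes f :: "nat \<Rightarrow> 'a::finite \<Rightarrow> 'b::finite \<Rightarrow> real"
  shows "(\<Sum>x\<in>Len n. \<Sum>y\<in>Len n. \<Prod>i<n. f i (x ! i) (y ! i)) = (\<Prod>i<n. \<Sum>x\<in>UNIV. \<Sum>y\<in>UNIV. f i x y)"
proof -
  have "(\<Sum>x\<in>Len n. \<Sum>y\<in>Len n. \<Prod>i<n. f i (x ! i) (y ! i))
      = (\<Sum>z\<in>Len n. \<Prod>i<n. f i (map fst z ! i) (map snd z ! i))"
    by (rule sum_Len_zip[symmetric])
  also have "\<dots> = (\<Sum>z\<in>Len n. \<Prod>i<n. f i (fst (z ! i)) (snd (z ! i)))"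
    by (intro sum.cong prod.cong) auto
  also have "\<dots> = (\<Prod>i<n. \<Sum>x\<in>UNIV. \<Sum>y\<in>UNIV. f i x y)"
    by (subst sum_Len_nth[where f = "\<lambda>i p. f i (fst p) (snd p)"])
       (simp add: sum.cartesian_product split_def)
  finally show ?thesis .
qed

lemma sum_inj_le:
  fixes h :: "'b \<Rightarrow> real"
  assumes "finite B" "inj_on g A" "g ` A \<subseteq> B" "\<And>y. y \<in> B \<Longrightarrow> 0 \<le> h y"
  shows "(\<Sum>x\<in>A. h (g x)) \<le> (\<Sum>y\<in>B. h y)"
proof -
  have "(\<Sum>x\<in>A. h (g x)) = (\<Sum>y\<in>g ` A. h y)"
    using assms by (simp add: sum.reindex)
  also have "\<dots> \<le> (\<Sum>y\<in>B. h y)"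
    using assms by (intro sum_mono2) auto
  finally show ?thesis .
qed

section \<open>The law of one coded block\<close>

definition kernel_prod :: "('u \<Rightarrow> 'u \<Rightarrow> 'w \<Rightarrow> real) \<Rightarrow> 'u list \<Rightarrow> 'u list \<Rightarrow> 'w list \<Rightarrow> real" where
  "kernel_prod k us us' ws = prod_list (map2 (\<lambda>(u, u') w. k u u' w) (zip us us') ws)"

text \<open>A list entry bundles the source letters with the letters of \<open>V1\<close>,
  \<open>V2\<close> and the output, so that whatever a wrong candidate shares with the truth is a
  letterwise image. The entries are dependent, since the inner codewords depend on whole source
  blocks.\<close>

definition block_law :: "('s1 \<times> 's2 \<Rightarrow> real) \<Rightarrow> ('u \<Rightarrow> 'u \<Rightarrow> 'w \<Rightarrow> real) \<Rightarrow> ('s1 list \<Rightarrow> 'u list) \<Rightarrow>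
    ('s2 list \<Rightarrow> 'u list) \<Rightarrow> (('s1 \<times> 's2) \<times> 'w) list \<Rightarrow> real" where
  "block_law W k C1 C2 z = prod_list (map (\<lambda>x. W (fst x)) z) *
     kernel_prod k (C1 (map (\<lambda>x. fst (fst x)) z)) (C2 (map (\<lambda>x. snd (fst x)) z)) (map snd z)"

text \<open>The law of \<open>(V1, V2, Y)\<close> when the two encoders use the possibly different letters \<open>u\<close> and \<open>u'\<close>;
  the law of the theorem is recovered for \<open>u = u'\<close>.\<close>

definition mac_kernel :: "('v1 \<Rightarrow> real) \<Rightarrow> ('v2 \<Rightarrow> real) \<Rightarrow> ('u \<Rightarrow> 'v1 \<Rightarrow> 'x1::finite \<Rightarrow> real) \<Rightarrow>
    ('u \<Rightarrow> 'v2 \<Rightarrow> 'x2::finite \<Rightarrow> real) \<Rightarrow> ('x1 \<Rightarrow> 'x2 \<Rightarrow> 'y \<Rightarrow> real) \<Rightarrow> 'u \<Rightarrow> 'u \<Rightarrow> 'v1 \<times> 'v2 \<times> 'y \<Rightarrow> real" where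
  "mac_kernel pV1 pV2 pX1 pX2 Wc u u' = (\<lambda>(v1, v2, y). pV1 v1 * pV2 v2 *
     (\<Sum>x1\<in>UNIV. \<Sum>x2\<in>UNIV. pX1 u v1 x1 * pX2 u' v2 x2 * Wc x1 x2 y))"

lemma kernel_prod_append:
  assumes "length us = length us'" "length us = length ws"
  shows "kernel_prod k (us @ vs) (us' @ vs') (ws @ xs) = kernel_prod k us us' ws * kernel_prod k vs vs' xs"
  using assms by (simp add: kernel_prod_def)

lemma kernel_prod_replicate:
  "length w = n \<Longrightarrow> kernel_prod k (replicate n u) (replicate n u) w = prod_list (map (k u u) w)"
  unfolding kernel_prod_def by (induction w arbitrary: n) auto

lemma kernel_prod_nonneg:
  "(\<And>u u' w. 0 \<le> k u u' w) \<Longrightarrow> 0 \<le> kernel_prod k us us' ws"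
  unfolding kernel_prod_def by (rule prod_list_nonneg_map) auto

lemma block_law_nonneg:
  "(\<And>u u' w. 0 \<le> k u u' w) \<Longrightarrow> (\<And>s. 0 \<le> W s) \<Longrightarrow> 0 \<le> block_law W k C1 C2 z"
  unfolding block_law_def by (intro mult_nonneg_nonneg prod_list_nonneg_map kernel_prod_nonneg)

lemma kernel_prod_nth:
  assumes "length us = n" "length us' = n" "length ws = n"
  shows "kernel_prod k us us' ws = (\<Prod>i<n. k (us ! i) (us' ! i) (ws ! i))"
  unfolding kernel_prod_def using assms by (subst prod_list_map2_nth[where n = n]) auto

lemma sum_kernel_prod:
  fixes k :: "'u \<Rightarrow> 'u \<Rightarrow> 'w::finite \<Rightarrow> real"
  assumes "\<And>u u'. (\<Sum>w\<in>UNIV. k u u' w) = 1" "length us = n" "length us' = n"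
  shows "(\<Sum>w\<in>Len n. kernel_prod k us us' w) = 1"
proof -
  have "(\<Sum>w\<in>Len n. kernel_prod k us us' w) = (\<Sum>w\<in>Len n. \<Prod>i<n. k (us ! i) (us' ! i) (w ! i))"
    using assms by (intro sum.cong) (auto simp: kernel_prod_nth)
  also have "\<dots> = 1" by (subst sum_Len_nth) (simp add: assms)
  finally show ?thesis .
qed

lemma sum_block_law:
  fixes k :: "'u \<Rightarrow> 'u \<Rightarrow> 'w::finite \<Rightarrow> real" and W :: "'s1::finite \<times> 's2::finite \<Rightarrow> real"
  assumes "\<And>u u'. (\<Sum>w\<in>UNIV. k u u' w) = 1" "(\<Sum>s\<in>UNIV. W s) = 1"
    and "\<And>s. length s = l \<Longrightarrow> length (C1 s) = l" "\<And>s. length s = l \<Longrightarrow> length (C2 s) = l"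
  shows "(\<Sum>z\<in>Len l. block_law W k C1 C2 z) = 1"
proof -
  have "(\<Sum>z\<in>Len l. block_law W k C1 C2 z) = (\<Sum>z\<in>Len l. prod_list (map W (map fst z)) *
     kernel_prod k (C1 (map fst (map fst z))) (C2 (map snd (map fst z))) (map snd z))"
    by (simp add: block_law_def o_def)
  also have "\<dots> = (\<Sum>s\<in>Len l. \<Sum>w\<in>Len l. prod_list (map W s) * kernel_prod k (C1 (map fst s)) (C2 (map snd s)) w)"
    by (rule sum_Len_zip[where f = "\<lambda>s w. prod_list (map W s) * kernel_prod k (C1 (map fst s)) (C2 (map snd s)) w"])
  also have "\<dots> = (\<Sum>s\<in>Len l. prod_list (map W s))"
    unfolding sum_distrib_left[symmetric] using assms(1,3,4)
    by (intro sum.cong refl) (auto simp: sum_kernel_prod)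
  also have "\<dots> = 1" by (simp add: sum_Len_prod_list assms(2))
  finally show ?thesis .
qed

text \<open>The source is memoryless and each block is encoded by itself, so the blocks are
  independent; this is what the Chernoff argument rests on. On the left-over symbols both encoders
  use the same letter \<open>u\<close>.\<close>

lemma block_law_chunk_map:
  assumes "\<And>s. length s = l \<Longrightarrow> length (C1 s) = l" "\<And>s. length s = l \<Longrightarrow> length (C2 s) = l"
    and "length z = m * l + r"
  shows "block_law W k (chunk_map C1 u l m) (chunk_map C2 u l m) z
    = chunk_prod (block_law W k C1 C2) (\<lambda>x. W (fst x) * k u u (snd x)) l m z"
  using assms(3)
proof (induction m arbitrary: z)
  case 0
  have "kernel_prod k (replicate r u) (replicate r u) (map snd z) = prod_list (map (\<lambda>x. k u u (snd x)) z)"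
    using 0 by (subst kernel_prod_replicate) (auto simp: o_def)
  then show ?case using 0 by (simp add: block_law_def prod_list_mult_map)
next
  case (Suc m)
  let ?a = "take l z" and ?b = "drop l z"
  have len: "length ?a = l" "length ?b = m * l + r" using Suc.prems by auto
  have z: "z = ?a @ ?b" by simp
  have 1: "prod_list (map (\<lambda>x. W (fst x)) z) = prod_list (map (\<lambda>x. W (fst x)) ?a) * prod_list (map (\<lambda>x. W (fst x)) ?b)"
    by (subst (1) z) (simp only: map_append prod_list.append)
  have 2: "kernel_prod k (chunk_map C1 u l (Suc m) (map (\<lambda>x. fst (fst x)) z)) (chunk_map C2 u l (Suc m) (map (\<lambda>x. snd (fst x)) z)) (map snd z)
    = kernel_prod k (C1 (map (\<lambda>x. fst (fst x)) ?a)) (C2 (map (\<lambda>x. snd (fst x)) ?a)) (map snd ?a)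
    * kernel_prod k (chunk_map C1 u l m (map (\<lambda>x. fst (fst x)) ?b)) (chunk_map C2 u l m (map (\<lambda>x. snd (fst x)) ?b)) (map snd ?b)"
  proof -
    have s: "map snd z = map snd ?a @ map snd ?b" by (simp only: map_append[symmetric] append_take_drop_id)
    show ?thesis
      unfolding chunk_map.simps s take_map drop_map
      using len assms(1,2) by (intro kernel_prod_append) auto
  qed
  show ?case
    unfolding chunk_prod.simps Suc.IH[OF len(2), symmetric]
    unfolding block_law_def 1 2 by (simp only: mult_ac)
qed

text \<open>The part of a letter that a wrong candidate shares with the transmitted one, when the first, the
  second or both messages are decoded wrongly.\<close>

definition fix1 :: "('s1 \<times> 's2) \<times> ('v1 \<times> 'v2 \<times> 'y) \<Rightarrow> 's2 \<times> 'v2 \<times> 'y" where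
  "fix1 = (\<lambda>((s1, s2), (v1, v2, y)). (s2, v2, y))"
definition fix2 :: "('s1 \<times> 's2) \<times> ('v1 \<times> 'v2 \<times> 'y) \<Rightarrow> 's1 \<times> 'v1 \<times> 'y" where
  "fix2 = (\<lambda>((s1, s2), (v1, v2, y)). (s1, v1, y))"
definition fix3 :: "('s1 \<times> 's2) \<times> ('v1 \<times> 'v2 \<times> 'y) \<Rightarrow> 'y" where
  "fix3 = (\<lambda>((s1, s2), (v1, v2, y)). y)"

abbreviation wt1 :: "('v1 \<Rightarrow> real) \<Rightarrow> ('s1 \<times> 's2) \<times> ('v1 \<times> 'v2 \<times> 'y) \<Rightarrow> real" where
  "wt1 p \<equiv> (\<lambda>x. p (fst (snd x)))"
abbreviation wt2 :: "('v2 \<Rightarrow> real) \<Rightarrow> ('s1 \<times> 's2) \<times> ('v1 \<times> 'v2 \<times> 'y) \<Rightarrow> real" where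
  "wt2 p \<equiv> (\<lambda>x. p (fst (snd (snd x))))"

section \<open>Random coding for sequences of letters\<close>

lemma sum_prod_kernels:
  fixes pX1 :: "'u \<Rightarrow> 'v1 \<Rightarrow> 'x1::finite \<Rightarrow> real" and pX2 :: "'u \<Rightarrow> 'v2 \<Rightarrow> 'x2::finite \<Rightarrow> real"
  shows "(\<Sum>x1\<in>Len n. \<Sum>x2\<in>Len n. (\<Prod>i<n. pX1 (us ! i) (v1 ! i) (x1 ! i)) * (\<Prod>i<n. pX2 (us' ! i) (v2 ! i) (x2 ! i)) *
     (\<Prod>i<n. Wc (x1 ! i) (x2 ! i) (y ! i)))
    = (\<Prod>i<n. \<Sum>x1\<in>UNIV. \<Sum>x2\<in>UNIV. pX1 (us ! i) (v1 ! i) x1 * pX2 (us' ! i) (v2 ! i) x2 * Wc x1 x2 (y ! i))"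
  using sum_Len_nth2[where n = n and f = "\<lambda>i x1 x2. pX1 (us ! i) (v1 ! i) x1 * pX2 (us' ! i) (v2 ! i) x2 * Wc x1 x2 (y ! i)"]
  by (simp add: prod.distrib)

text \<open>Literally the inner part of \<open>transmissible\<close> for one \<open>n\<close> and
  \<epsilon>, so that \<open>transmissible_def\<close> can be folded with it.\<close>

definition code_exists ::
  "('s1::finite \<times> 's2::finite \<Rightarrow> real) \<Rightarrow> ('x1::finite \<Rightarrow> 'x2::finite \<Rightarrow> 'y::finite \<Rightarrow> real) \<Rightarrow> nat \<Rightarrow> real \<Rightarrow> bool" where
  "code_exists W Wc n \<epsilon> \<longleftrightarrow> (\<exists>(e1 :: 's1 list \<Rightarrow> 'x1 list) (e2 :: 's2 list \<Rightarrow> 'x2 list) (d :: 'y list \<Rightarrow> 's1 list \<times> 's2 list).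
      (\<forall>s. length s = n \<longrightarrow> length (e1 s) = n) \<and>
      (\<forall>s. length s = n \<longrightarrow> length (e2 s) = n) \<and>
      (\<Sum>s1\<in>{xs. length xs = n}. \<Sum>s2\<in>{xs. length xs = n}.
          (\<Prod>i<n. W (s1 ! i, s2 ! i)) *
          (\<Sum>y\<in>{ys. length ys = n \<and> d ys \<noteq> (s1, s2)}.
              \<Prod>i<n. Wc (e1 s1 ! i) (e2 s2 ! i) (y ! i))) \<le> \<epsilon>)"

lemma code_exists_mono: "code_exists W Wc n \<epsilon> \<Longrightarrow> \<epsilon> \<le> \<epsilon>' \<Longrightarrow> code_exists W Wc n \<epsilon>'"
  unfolding code_exists_def by (meson order_trans)

text \<open>\<open>one_shot_random_coding\<close> with codewords that are pairs: an i.i.d. sequence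
  \<open>v\<close> and a channel input drawn from \<open>v\<close> and the inner codeword. The test
  \<open>G\<close> sees only \<open>v\<close>, so the inputs sum out. In \<open>e1\<close> to
  \<open>e3\<close> the wrong source sequences are counted without weights, as a union bound
  requires.\<close>

lemma random_coding_lists:
  fixes W :: "'s1::finite \<times> 's2::finite \<Rightarrow> real"
    and Wc :: "'x1::finite \<Rightarrow> 'x2::finite \<Rightarrow> 'y::finite \<Rightarrow> real"
    and pV1 :: "'v1::finite \<Rightarrow> real" and pV2 :: "'v2::finite \<Rightarrow> real"
    and pX1 :: "'u \<Rightarrow> 'v1 \<Rightarrow> 'x1 \<Rightarrow> real" and pX2 :: "'u \<Rightarrow> 'v2 \<Rightarrow> 'x2 \<Rightarrow> real"
    and G :: "(('s1 \<times> 's2) \<times> ('v1 \<times> 'v2 \<times> 'y)) list \<Rightarrow> bool"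
  assumes W: "is_pmf W" and Wc: "\<And>x1 x2. is_pmf (Wc x1 x2)" and V1: "is_pmf pV1" and V2: "is_pmf pV2"
    and X1: "\<And>u v. is_pmf (pX1 u v)" and X2: "\<And>u v. is_pmf (pX2 u v)"
    and C1: "\<And>s. length s = n \<Longrightarrow> length (C1 s) = n" and C2: "\<And>s. length s = n \<Longrightarrow> length (C2 s) = n"
    and e0: "(\<Sum>z\<in>Len n. block_law W (mac_kernel pV1 pV2 pX1 pX2 Wc) C1 C2 z * of_bool (\<not> G z)) \<le> \<epsilon>0"
    and e1: "\<And>b. length b = n \<Longrightarrow> (\<Sum>z | length z = n \<and> map fix1 z = b. prod_list (map (wt1 pV1) z) * of_bool (G z)) \<le> \<epsilon>1"
    and e2: "\<And>b. length b = n \<Longrightarrow> (\<Sum>z | length z = n \<and> map fix2 z = b. prod_list (map (wt2 pV2) z) * of_bool (G z)) \<le> \<epsilon>2"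
    and e3: "\<And>b. length b = n \<Longrightarrow> (\<Sum>z | length z = n \<and> map fix3 z = b.
                prod_list (map (wt1 pV1) z) * prod_list (map (wt2 pV2) z) * of_bool (G z)) \<le> \<epsilon>3"
  shows "code_exists W Wc n (\<epsilon>0 + \<epsilon>1 + \<epsilon>2 + \<epsilon>3)"
proof -
  define zz where "zz = (\<lambda>(a :: 's1 list) (b :: 's2 list) (v1 :: 'v1 list) (v2 :: 'v2 list) (y :: 'y list).
     zip (zip a b) (zip v1 (zip v2 y)))"
  define P where "P = (\<lambda>a b. \<Prod>i<n. W (a ! i, b ! i))"
  define q1 where "q1 = (\<lambda>v. \<Prod>i<n. pV1 (v ! i))"
  define q2 where "q2 = (\<lambda>v. \<Prod>i<n. pV2 (v ! i))"
  define k1 where "k1 = (\<lambda>a v x. \<Prod>i<n. pX1 (C1 a ! i) (v ! i) (x ! i))"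
  define k2 where "k2 = (\<lambda>a v x. \<Prod>i<n. pX2 (C2 a ! i) (v ! i) (x ! i))"
  define R1 where "R1 = (\<lambda>a z. q1 (fst z) * k1 a (fst z) (snd z))"
  define R2 where "R2 = (\<lambda>a z. q2 (fst z) * k2 a (fst z) (snd z))"
  define c where "c = (\<lambda>x1 x2 y. \<Prod>i<n. Wc (x1 ! i) (x2 ! i) (y ! i))"
  define ch where "ch = (\<lambda>(z1 :: 'v1 list \<times> 'x1 list) (z2 :: 'v2 list \<times> 'x2 list) y. c (snd z1) (snd z2) y)"
  define G' where "G' = (\<lambda>a b (z1 :: 'v1 list \<times> 'x1 list) (z2 :: 'v2 list \<times> 'x2 list) y. G (zz a b (fst z1) (fst z2) y))"
  have nn: "0 \<le> W s" "0 \<le> Wc x1 x2 y" "0 \<le> pV1 v1" "0 \<le> pV2 v2" "0 \<le> pX1 u v1 x1" "0 \<le> pX2 u v2 x2"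
    for s x1 x2 y v1 v2 u using assms(1-6) unfolding is_pmf_def by blast+
  have s1: "(\<Sum>s\<in>UNIV. W s) = 1" "(\<Sum>y\<in>UNIV. Wc x1 x2 y) = 1" "(\<Sum>v\<in>UNIV. pV1 v) = 1" "(\<Sum>v\<in>UNIV. pV2 v) = 1"
    "(\<Sum>x\<in>UNIV. pX1 u v1 x) = 1" "(\<Sum>x\<in>UNIV. pX2 u v2 x) = 1" for x1 x2 v1 v2 u
    using assms(1-6) unfolding is_pmf_def by blast+
  have nnp: "0 \<le> P a b" "0 \<le> q1 v1" "0 \<le> q2 v2" "0 \<le> k1 a v1 x1" "0 \<le> k2 b v2 x2" "0 \<le> c x1 x2 y" for a b v1 v2 x1 x2 y
    unfolding P_def q1_def q2_def k1_def k2_def c_def by (auto intro!: prod_nonneg nn)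
  have sP: "(\<Sum>a\<in>Len n. \<Sum>b\<in>Len n. P a b) = 1"
    unfolding P_def using sum_Len_nth2[where n = n and f = "\<lambda>i a b. W (a, b)"] s1(1)
    by (simp add: sum.cartesian_product' UNIV_Times_UNIV[symmetric] del: UNIV_Times_UNIV)
  have sq: "(\<Sum>v\<in>Len n. q1 v) = 1" "(\<Sum>v\<in>Len n. q2 v) = 1"
    unfolding q1_def q2_def by (subst sum_Len_nth, simp add: s1)+
  have sk: "(\<Sum>x\<in>Len n. k1 a v1 x) = 1" "(\<Sum>x\<in>Len n. k2 b v2 x) = 1" "(\<Sum>y\<in>Len n. c x1 x2 y) = 1" for a b v1 v2 x1 x2
    unfolding k1_def k2_def c_def by (subst sum_Len_nth, simp add: s1)+
  \<comment> \<open>Once the channel inputs are summed out, source, codebook and channel weights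
    together are the block law of the zipped letters.\<close>
  have law: "P a b * (q1 v1 * q2 v2 * (\<Sum>x1\<in>Len n. \<Sum>x2\<in>Len n. k1 a v1 x1 * k2 b v2 x2 * c x1 x2 y))
      = block_law W (mac_kernel pV1 pV2 pX1 pX2 Wc) C1 C2 (zz a b v1 v2 y)"
    if "length a = n" "length b = n" "length v1 = n" "length v2 = n" "length y = n" for a b v1 v2 y
  proof -
    have m: "map (\<lambda>x. fst (fst x)) (zz a b v1 v2 y) = a" "map (\<lambda>x. snd (fst x)) (zz a b v1 v2 y) = b"
      "map snd (zz a b v1 v2 y) = zip v1 (zip v2 y)"
      using that by (auto simp: zz_def intro!: nth_equalityI)
    have "P a b = prod_list (map (\<lambda>x. W (fst x)) (zz a b v1 v2 y))"
      using that by (subst prod_list_map_nth[where n = n]) (auto simp: zz_def P_def)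
    moreover have "kernel_prod (mac_kernel pV1 pV2 pX1 pX2 Wc) (C1 a) (C2 b) (zip v1 (zip v2 y))
      = q1 v1 * q2 v2 * (\<Sum>x1\<in>Len n. \<Sum>x2\<in>Len n. k1 a v1 x1 * k2 b v2 x2 * c x1 x2 y)"
      unfolding k1_def k2_def c_def sum_prod_kernels
      using that C1 C2 by (subst kernel_prod_nth[where n = n]) (auto simp: mac_kernel_def q1_def q2_def prod.distrib)
    ultimately show ?thesis by (simp add: block_law_def m)
  qed
  have qz: "prod_list (map (wt1 pV1) (zz a b v1 v2 y)) = q1 v1" "prod_list (map (wt2 pV2) (zz a b v1 v2 y)) = q2 v2"
    if "length a = n" "length b = n" "length v1 = n" "length v2 = n" "length y = n" for a b v1 v2 y
    using that by (simp_all add: zz_def q1_def q2_def prod_list_map_nth[where n = n])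
  have "\<exists>c1 c2 d. c1 \<in> (\<Pi>\<^sub>E a\<in>Len n. Len n \<times> Len n) \<and> c2 \<in> (\<Pi>\<^sub>E b\<in>Len n. Len n \<times> Len n) \<and>
    (\<Sum>a\<in>Len n. \<Sum>b\<in>Len n. P a b * (\<Sum>y | y \<in> Len n \<and> d y \<noteq> (a, b). ch (c1 a) (c2 b) y)) \<le> \<epsilon>0 + \<epsilon>1 + \<epsilon>2 + \<epsilon>3"
  proof (rule one_shot_random_coding[where ?R1.0 = R1 and ?R2.0 = R2 and G = G'])
    show "(\<Sum>a\<in>Len n. \<Sum>b\<in>Len n. P a b) = 1" by (rule sP)
    show "(\<Sum>z\<in>Len n \<times> Len n. R1 a z) = 1" "(\<Sum>z\<in>Len n \<times> Len n. R2 b z) = 1" for a b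
      by (simp_all add: R1_def R2_def sum.cartesian_product' sum_distrib_left[symmetric] sk sq)
    show "(\<Sum>y\<in>Len n. ch z1 z2 y) = 1" for z1 z2 by (simp add: ch_def sk)
    \<comment> \<open>The channel input of a wrong codeword does not enter the test and sums to one;
      only the \<open>pV1\<close> weight of \<open>v\<close> is left.\<close>
    have red: "(\<Sum>z1\<in>Len n \<times> Len n. R1 a z1 * F (fst z1)) = (\<Sum>v\<in>Len n. q1 v * F v)" for a and F :: "'v1 list \<Rightarrow> real"
      by (simp add: R1_def sum.cartesian_product' sum_distrib_left[symmetric] sum_distrib_right[symmetric] sk)
    have red2: "(\<Sum>z1\<in>Len n \<times> Len n. R2 a z1 * F (fst z1)) = (\<Sum>v\<in>Len n. q2 v * F v)" for a and F :: "'v2 list \<Rightarrow> real"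
      by (simp add: R2_def sum.cartesian_product' sum_distrib_left[symmetric] sum_distrib_right[symmetric] sk)
    show "(\<Sum>a\<in>Len n. \<Sum>b\<in>Len n. P a b * (\<Sum>z1\<in>Len n \<times> Len n. \<Sum>z2\<in>Len n \<times> Len n. R1 a z1 * R2 b z2 *
              (\<Sum>y\<in>Len n. ch z1 z2 y * of_bool (\<not> G' a b z1 z2 y)))) \<le> \<epsilon>0"
    proof -
      let ?h = "\<lambda>z. block_law W (mac_kernel pV1 pV2 pX1 pX2 Wc) C1 C2 z * of_bool (\<not> G z)"
      have "(\<Sum>z1\<in>Len n \<times> Len n. \<Sum>z2\<in>Len n \<times> Len n. R1 a z1 * R2 b z2 *
              (\<Sum>y\<in>Len n. ch z1 z2 y * of_bool (\<not> G' a b z1 z2 y)))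
        = (\<Sum>v1\<in>Len n. \<Sum>v2\<in>Len n. \<Sum>y\<in>Len n. q1 v1 * q2 v2 *
            (\<Sum>x1\<in>Len n. \<Sum>x2\<in>Len n. k1 a v1 x1 * k2 b v2 x2 * c x1 x2 y) * of_bool (\<not> G (zz a b v1 v2 y)))" for a b
      proof -
        have "(\<Sum>z1\<in>Len n \<times> Len n. \<Sum>z2\<in>Len n \<times> Len n. R1 a z1 * R2 b z2 *
              (\<Sum>y\<in>Len n. ch z1 z2 y * of_bool (\<not> G' a b z1 z2 y)))
           = (\<Sum>v1\<in>Len n. \<Sum>x1\<in>Len n. \<Sum>v2\<in>Len n. \<Sum>x2\<in>Len n. \<Sum>y\<in>Len n. q1 v1 * k1 a v1 x1 * (q2 v2 * k2 b v2 x2) *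
              (c x1 x2 y * of_bool (\<not> G (zz a b v1 v2 y))))"
          by (simp add: R1_def R2_def ch_def G'_def sum.cartesian_product' sum_distrib_left)
        also have "\<dots> = (\<Sum>v1\<in>Len n. \<Sum>v2\<in>Len n. \<Sum>y\<in>Len n. \<Sum>x1\<in>Len n. \<Sum>x2\<in>Len n. q1 v1 * k1 a v1 x1 * (q2 v2 * k2 b v2 x2) *
              (c x1 x2 y * of_bool (\<not> G (zz a b v1 v2 y))))"
          apply (rule sum.cong[OF refl])
          apply (subst sum.swap[of _ "Len n :: 'v2 list set" "Len n :: 'x1 list set"])
          apply (rule sum.cong[OF refl])
          apply (subst sum.swap[of _ "Len n :: 'y list set" "Len n :: 'x2 list set"])
          apply (subst sum.swap[of _ "Len n :: 'y list set" "Len n :: 'x1 list set"])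
          apply (rule refl)
          done
        finally show ?thesis by (simp add: sum_distrib_left sum_distrib_right mult_ac)
      qed
      then have "(\<Sum>a\<in>Len n. \<Sum>b\<in>Len n. P a b * (\<Sum>z1\<in>Len n \<times> Len n. \<Sum>z2\<in>Len n \<times> Len n. R1 a z1 * R2 b z2 *
              (\<Sum>y\<in>Len n. ch z1 z2 y * of_bool (\<not> G' a b z1 z2 y))))
        = (\<Sum>a\<in>Len n. \<Sum>b\<in>Len n. \<Sum>v1\<in>Len n. \<Sum>v2\<in>Len n. \<Sum>y\<in>Len n. ?h (zz a b v1 v2 y))"
        by (simp add: sum_distrib_left mult.assoc[symmetric] law[symmetric])
      also have "\<dots> = (\<Sum>p\<in>Len n \<times> Len n \<times> Len n \<times> Len n \<times> Len n. ?h (zz (fst p) (fst (snd p)) (fst (snd (snd p))) (fst (snd (snd (snd p)))) (snd (snd (snd (snd p))))))"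
        by (simp add: sum.cartesian_product')
      also have "\<dots> \<le> (\<Sum>z\<in>Len n. ?h z)"
      proof (rule sum_inj_le[where g = "\<lambda>p. zz (fst p) (fst (snd p)) (fst (snd (snd p))) (fst (snd (snd (snd p)))) (snd (snd (snd (snd p))))"])
        show "inj_on (\<lambda>p. zz (fst p) (fst (snd p)) (fst (snd (snd p))) (fst (snd (snd (snd p)))) (snd (snd (snd (snd p))))) (Len n \<times> Len n \<times> Len n \<times> Len n \<times> Len n)"
          by (rule inj_on_inverseI[where g = "\<lambda>z. (map (\<lambda>x. fst (fst x)) z, map (\<lambda>x. snd (fst x)) z, map (\<lambda>x. fst (snd x)) z, map (\<lambda>x. fst (snd (snd x))) z, map (\<lambda>x. snd (snd (snd x))) z)"])
             (auto simp: zz_def intro!: nth_equalityI)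
      qed (auto simp: zz_def intro!: mult_nonneg_nonneg block_law_nonneg nn sum_nonneg simp: mac_kernel_def split: prod.splits)
      also have "\<dots> \<le> \<epsilon>0" by (rule e0)
      finally show ?thesis .
    qed
    show "(\<Sum>a\<in>Len n. \<Sum>z1\<in>Len n \<times> Len n. R1 a z1 * of_bool (G' a b z1 z2 y)) \<le> \<epsilon>1"
      if "b \<in> Len n" "z2 \<in> Len n \<times> Len n" "y \<in> Len n" for b z2 y
    proof -
      let ?h = "\<lambda>z. prod_list (map (wt1 pV1) z) * of_bool (G z)"
      have "(\<Sum>a\<in>Len n. \<Sum>z1\<in>Len n \<times> Len n. R1 a z1 * of_bool (G' a b z1 z2 y))
        = (\<Sum>a\<in>Len n. \<Sum>v1\<in>Len n. q1 v1 * of_bool (G (zz a b v1 (fst z2) y)))"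
        unfolding G'_def by (rule sum.cong[OF refl], rule red)
      also have "\<dots> = (\<Sum>p\<in>Len n \<times> Len n. ?h (zz (fst p) b (snd p) (fst z2) y))"
        using that unfolding sum.cartesian_product' by (intro sum.cong refl) (auto simp: qz mem_Times_iff)
      also have "\<dots> \<le> (\<Sum>z | length z = n \<and> map fix1 z = zip b (zip (fst z2) y). ?h z)"
      proof (rule sum_inj_le[where g = "\<lambda>p. zz (fst p) b (snd p) (fst z2) y"])
        show "inj_on (\<lambda>p. zz (fst p) b (snd p) (fst z2) y) (Len n \<times> Len n)"
          using that by (intro inj_on_inverseI[where g = "\<lambda>z. (map (\<lambda>x. fst (fst x)) z, map (\<lambda>x. fst (snd x)) z)"])
             (auto simp: zz_def intro!: nth_equalityI)
        show "(\<lambda>p. zz (fst p) b (snd p) (fst z2) y) ` (Len n \<times> Len n) \<subseteq> {z. length z = n \<and> map fix1 z = zip b (zip (fst z2) y)}"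
          using that by (auto simp: zz_def fix1_def intro!: nth_equalityI)
        show "finite {z :: (('s1 \<times> 's2) \<times> ('v1 \<times> 'v2 \<times> 'y)) list. length z = n \<and> map fix1 z = zip b (zip (fst z2) y)}"
          by (rule finite_subset[OF _ finite_Len[of n]]) auto
      qed (auto intro!: mult_nonneg_nonneg prod_list_nonneg_map nn)
      also have "\<dots> \<le> \<epsilon>1" using that by (intro e1) auto
      finally show ?thesis .
    qed
    show "(\<Sum>b\<in>Len n. \<Sum>z2\<in>Len n \<times> Len n. R2 b z2 * of_bool (G' a b z1 z2 y)) \<le> \<epsilon>2"
      if "a \<in> Len n" "z1 \<in> Len n \<times> Len n" "y \<in> Len n" for a z1 y
    proof -
      let ?h = "\<lambda>z. prod_list (map (wt2 pV2) z) * of_bool (G z)"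
      have "(\<Sum>b\<in>Len n. \<Sum>z2\<in>Len n \<times> Len n. R2 b z2 * of_bool (G' a b z1 z2 y))
        = (\<Sum>b\<in>Len n. \<Sum>v2\<in>Len n. q2 v2 * of_bool (G (zz a b (fst z1) v2 y)))"
        unfolding G'_def by (rule sum.cong[OF refl], rule red2)
      also have "\<dots> = (\<Sum>p\<in>Len n \<times> Len n. ?h (zz a (fst p) (fst z1) (snd p) y))"
        using that unfolding sum.cartesian_product' by (intro sum.cong refl) (auto simp: qz mem_Times_iff)
      also have "\<dots> \<le> (\<Sum>z | length z = n \<and> map fix2 z = zip a (zip (fst z1) y). ?h z)"
      proof (rule sum_inj_le[where g = "\<lambda>p. zz a (fst p) (fst z1) (snd p) y"])
        show "inj_on (\<lambda>p. zz a (fst p) (fst z1) (snd p) y) (Len n \<times> Len n)"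
          using that by (intro inj_on_inverseI[where g = "\<lambda>z. (map (\<lambda>x. snd (fst x)) z, map (\<lambda>x. fst (snd (snd x))) z)"])
             (auto simp: zz_def intro!: nth_equalityI)
        show "(\<lambda>p. zz a (fst p) (fst z1) (snd p) y) ` (Len n \<times> Len n) \<subseteq> {z. length z = n \<and> map fix2 z = zip a (zip (fst z1) y)}"
          using that by (auto simp: zz_def fix2_def intro!: nth_equalityI)
        show "finite {z :: (('s1 \<times> 's2) \<times> ('v1 \<times> 'v2 \<times> 'y)) list. length z = n \<and> map fix2 z = zip a (zip (fst z1) y)}"
          by (rule finite_subset[OF _ finite_Len[of n]]) auto
      qed (auto intro!: mult_nonneg_nonneg prod_list_nonneg_map nn)
      also have "\<dots> \<le> \<epsilon>2" using that by (intro e2) auto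
      finally show ?thesis .
    qed
    show "(\<Sum>a\<in>Len n. \<Sum>b\<in>Len n. \<Sum>z1\<in>Len n \<times> Len n. \<Sum>z2\<in>Len n \<times> Len n. R1 a z1 * R2 b z2 * of_bool (G' a b z1 z2 y)) \<le> \<epsilon>3"
      if "y \<in> Len n" for y
    proof -
      let ?h = "\<lambda>z. prod_list (map (wt1 pV1) z) * prod_list (map (wt2 pV2) z) * of_bool (G z)"
      have "(\<Sum>z1\<in>Len n \<times> Len n. \<Sum>z2\<in>Len n \<times> Len n. R1 a z1 * R2 b z2 * of_bool (G' a b z1 z2 y))
         = (\<Sum>v1\<in>Len n. \<Sum>v2\<in>Len n. q1 v1 * q2 v2 * of_bool (G (zz a b v1 v2 y)))" for a b
      proof -
        have "(\<Sum>z1\<in>Len n \<times> Len n. \<Sum>z2\<in>Len n \<times> Len n. R1 a z1 * R2 b z2 * of_bool (G' a b z1 z2 y))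
          = (\<Sum>z1\<in>Len n \<times> Len n. R1 a z1 * (\<Sum>v2\<in>Len n. q2 v2 * of_bool (G (zz a b (fst z1) v2 y))))"
          unfolding G'_def mult.assoc sum_distrib_left[symmetric]
          by (rule sum.cong[OF refl], rule arg_cong[where f = "\<lambda>x. R1 a _ * x"], rule red2)
        also have "\<dots> = (\<Sum>v1\<in>Len n. q1 v1 * (\<Sum>v2\<in>Len n. q2 v2 * of_bool (G (zz a b v1 v2 y))))"
          by (rule red)
        finally show ?thesis by (simp add: sum_distrib_left mult.assoc)
      qed
      then have "(\<Sum>a\<in>Len n. \<Sum>b\<in>Len n. \<Sum>z1\<in>Len n \<times> Len n. \<Sum>z2\<in>Len n \<times> Len n. R1 a z1 * R2 b z2 * of_bool (G' a b z1 z2 y))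
        = (\<Sum>a\<in>Len n. \<Sum>b\<in>Len n. \<Sum>v1\<in>Len n. \<Sum>v2\<in>Len n. q1 v1 * q2 v2 * of_bool (G (zz a b v1 v2 y)))"
        by simp
      also have "\<dots> = (\<Sum>p\<in>Len n \<times> Len n \<times> Len n \<times> Len n. ?h (zz (fst p) (fst (snd p)) (fst (snd (snd p))) (snd (snd (snd p))) y))"
        using that unfolding sum.cartesian_product' by (intro sum.cong refl) (auto simp: qz)
      also have "\<dots> \<le> (\<Sum>z | length z = n \<and> map fix3 z = y. ?h z)"
      proof (rule sum_inj_le[where g = "\<lambda>p. zz (fst p) (fst (snd p)) (fst (snd (snd p))) (snd (snd (snd p))) y"])
        show "inj_on (\<lambda>p. zz (fst p) (fst (snd p)) (fst (snd (snd p))) (snd (snd (snd p))) y) (Len n \<times> Len n \<times> Len n \<times> Len n)"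
          using that by (intro inj_on_inverseI[where g = "\<lambda>z. (map (\<lambda>x. fst (fst x)) z, map (\<lambda>x. snd (fst x)) z, map (\<lambda>x. fst (snd x)) z, map (\<lambda>x. fst (snd (snd x))) z)"])
             (auto simp: zz_def intro!: nth_equalityI)
        show "(\<lambda>p. zz (fst p) (fst (snd p)) (fst (snd (snd p))) (snd (snd (snd p))) y) ` (Len n \<times> Len n \<times> Len n \<times> Len n) \<subseteq> {z. length z = n \<and> map fix3 z = y}"
          using that by (auto simp: zz_def fix3_def intro!: nth_equalityI)
        show "finite {z :: (('s1 \<times> 's2) \<times> ('v1 \<times> 'v2 \<times> 'y)) list. length z = n \<and> map fix3 z = y}"
          by (rule finite_subset[OF _ finite_Len[of n]]) auto
      qed (auto intro!: mult_nonneg_nonneg prod_list_nonneg_map nn)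
      also have "\<dots> \<le> \<epsilon>3" using that by (intro e3) auto
      finally show ?thesis .
    qed
  qed (auto simp: nnp R1_def R2_def ch_def)
  then obtain c1 c2 d where c12: "c1 \<in> (\<Pi>\<^sub>E a\<in>Len n. Len n \<times> Len n)" "c2 \<in> (\<Pi>\<^sub>E b\<in>Len n. Len n \<times> Len n)"
    and err: "(\<Sum>a\<in>Len n. \<Sum>b\<in>Len n. P a b * (\<Sum>y | y \<in> Len n \<and> d y \<noteq> (a, b). ch (c1 a) (c2 b) y)) \<le> \<epsilon>0 + \<epsilon>1 + \<epsilon>2 + \<epsilon>3"
    by blast
  have len1: "\<forall>s. length s = n \<longrightarrow> length (snd (c1 s)) = n" "\<forall>s. length s = n \<longrightarrow> length (snd (c2 s)) = n"
    using c12 by (auto simp: PiE_def Pi_def mem_Times_iff)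
  show ?thesis
    using err len1 unfolding code_exists_def P_def ch_def c_def Len_def mem_Collect_eq by (intro exI[of _ "snd \<circ> c1"] exI[of _ "snd \<circ> c2"] exI[of _ d]) auto
qed

text \<open>Markov's inequality for the power \<open>- t\<close> of the product of the
  \<open>D\<close>; its mean under the product law is the power \<open>m\<close> of a one-block
  mean. The left-over symbols have total weight one.\<close>

lemma chunk_prod_tail_bound:
  fixes J D :: "'z::finite list \<Rightarrow> real"
  assumes "\<And>z. 0 \<le> J z" "\<And>x. 0 \<le> j x" "(\<Sum>x\<in>UNIV. j x) = 1" "0 \<le> t"
    and pos: "\<And>z. length z = l \<Longrightarrow> J z \<noteq> 0 \<Longrightarrow> 0 < D z"
  shows "(\<Sum>z\<in>Len (m * l + r). chunk_prod J j l m z * of_bool (chunk_prod D (\<lambda>_. 1) l m z \<le> exp (g * m)))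
    \<le> (exp (t * g) * (\<Sum>z\<in>Len l. J z * exp (- t * ln (D z)))) ^ m"
proof -
  have "(\<Sum>z\<in>Len (m * l + r). chunk_prod J j l m z * of_bool (chunk_prod D (\<lambda>_. 1) l m z \<le> exp (g * m)))
    \<le> (\<Sum>z\<in>Len (m * l + r). exp (t * (g * m)) * chunk_prod (\<lambda>z. J z * exp (- t * ln (D z))) j l m z)"
  proof (rule sum_mono)
    fix z :: "'z list" assume z: "z \<in> Len (m * l + r)"
    let ?D = "chunk_prod D (\<lambda>_. 1) l m z"
    have nn: "0 \<le> chunk_prod (\<lambda>z. J z * exp (- t * ln (D z))) j l m z"
      using assms by (intro chunk_prod_nonneg) auto
    show "chunk_prod J j l m z * of_bool (?D \<le> exp (g * m))
        \<le> exp (t * (g * m)) * chunk_prod (\<lambda>z. J z * exp (- t * ln (D z))) j l m z"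
    proof (cases "chunk_prod J j l m z = 0 \<or> \<not> ?D \<le> exp (g * m)")
      case True
      then show ?thesis using nn by auto
    next
      case False
      then have nz: "chunk_prod J j l m z \<noteq> 0" and le: "?D \<le> exp (g * m)" by auto
      from chunk_prod_exp_ln[OF pos _ nz] z
      have "0 < ?D" "chunk_prod (\<lambda>z. exp (- t * ln (D z))) (\<lambda>_. 1) l m z = exp (- t * ln ?D)" by auto
      moreover have "chunk_prod (\<lambda>z. J z * exp (- t * ln (D z))) j l m z
        = chunk_prod J j l m z * chunk_prod (\<lambda>z. exp (- t * ln (D z))) (\<lambda>_. 1) l m z"
        by (simp add: chunk_prod_mult)
      moreover have "ln ?D \<le> ln (exp (g * m))" using le \<open>0 < ?D\<close> by (subst ln_le_cancel_iff) auto
      then have "1 \<le> exp (t * (g * m)) * exp (- t * ln ?D)"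
        using \<open>0 \<le> t\<close> by (simp add: exp_add[symmetric] mult_left_mono)
      moreover have "0 \<le> chunk_prod J j l m z" using assms by (intro chunk_prod_nonneg) auto
      ultimately show ?thesis
        using mult_left_mono[of 1 "exp (t * (g * m)) * exp (- t * ln ?D)" "chunk_prod J j l m z"] le
        by (simp add: mult_ac)
    qed
  qed
  also have "\<dots> = exp (t * (g * m)) * (\<Sum>z\<in>Len l. J z * exp (- t * ln (D z))) ^ m"
    by (simp add: sum_distrib_left[symmetric] sum_chunk_prod assms)
  also have "\<dots> = (exp (t * g) * (\<Sum>z\<in>Len l. J z * exp (- t * ln (D z)))) ^ m"
    by (simp add: power_mult_distrib exp_of_nat_mult[symmetric] mult_ac)
  finally show ?thesis .
qed

text \<open>A change of measure: on the acceptance region the indicator is at most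
  \<open>D / \<theta>\<close>, and the codeword weight times \<open>D\<close> is sub-normalised on
  each fibre. This bounds all wrong candidates together.\<close>

lemma fiber_threshold_bound:
  fixes D :: "'z::finite list \<Rightarrow> real"
  assumes "\<And>z. 0 \<le> D z" "\<And>x. 0 \<le> c x \<and> c x \<le> 1"
    and F1: "\<And>b. length b = l \<Longrightarrow> (\<Sum>z | length z = l \<and> map p z = b. prod_list (map c z) * D z) \<le> 1"
    and "length b = m * l + r" "0 < \<theta>"
  shows "(\<Sum>z | length z = m * l + r \<and> map p z = b. prod_list (map c z) * of_bool (\<theta> < chunk_prod D (\<lambda>_. 1) l m z))
    \<le> real CARD('z) ^ r / \<theta>"
proof -
  have "(\<Sum>z | length z = m * l + r \<and> map p z = b. prod_list (map c z) * of_bool (\<theta> < chunk_prod D (\<lambda>_. 1) l m z))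
    \<le> (\<Sum>z | length z = m * l + r \<and> map p z = b. chunk_prod (\<lambda>z. prod_list (map c z) * D z) c l m z / \<theta>)"
  proof (rule sum_mono)
    fix z :: "'z list"
    have 0: "0 \<le> prod_list (map c z)" using assms by (intro prod_list_nonneg_map) auto
    have "of_bool (\<theta> < chunk_prod D (\<lambda>_. 1) l m z) \<le> chunk_prod D (\<lambda>_. 1) l m z / \<theta>"
      using \<open>0 < \<theta>\<close> chunk_prod_nonneg[of D "\<lambda>_. 1" l m z] assms(1) by (auto simp: of_bool_def)
    from mult_left_mono[OF this 0]
    show "prod_list (map c z) * of_bool (\<theta> < chunk_prod D (\<lambda>_. 1) l m z)
      \<le> chunk_prod (\<lambda>z. prod_list (map c z) * D z) c l m z / \<theta>"
      using chunk_prod_mult[of "\<lambda>z. prod_list (map c z)" c l m z D "\<lambda>_. 1"] prod_list_eq_chunk_prod[of c z l m]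
      by simp
  qed
  also have "\<dots> = (\<Sum>z | length z = m * l + r \<and> map p z = b. chunk_prod (\<lambda>z. prod_list (map c z) * D z) c l m z) / \<theta>"
    by (simp add: sum_divide_distrib)
  also have "\<dots> \<le> real CARD('z) ^ r / \<theta>"
    using assms by (intro divide_right_mono sum_fiber_chunk_prod_le F1) (auto intro!: mult_nonneg_nonneg prod_list_nonneg_map)
  finally show ?thesis .
qed

section \<open>From a metric for one block to codes of every length\<close>

lemma is_pmf_le_1: "is_pmf p \<Longrightarrow> p x \<le> 1"
  unfolding is_pmf_def using member_le_sum[of x UNIV p] by auto

text \<open>Summing out the output and then the inputs removes all dependence on \<open>u\<close>
  and \<open>u'\<close>. Hence the mean of the log codebook weight is the same in blocks where the
  encoders disagree.\<close>

lemma mac_kernel_marginal: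
  fixes pX1 :: "'u \<Rightarrow> 'v1::finite \<Rightarrow> 'x1::finite \<Rightarrow> real" and pX2 :: "'u \<Rightarrow> 'v2::finite \<Rightarrow> 'x2::finite \<Rightarrow> real"
    and Wc :: "'x1 \<Rightarrow> 'x2 \<Rightarrow> 'y::finite \<Rightarrow> real"
  assumes "\<And>u v. is_pmf (pX1 u v)" "\<And>u v. is_pmf (pX2 u v)" "\<And>x1 x2. is_pmf (Wc x1 x2)"
  shows "(\<Sum>y\<in>UNIV. mac_kernel pV1 pV2 pX1 pX2 Wc u u' (v1, v2, y)) = pV1 v1 * pV2 v2"
    "(\<Sum>w\<in>UNIV. mac_kernel pV1 pV2 pX1 pX2 Wc u u' w * g (fst w) (fst (snd w))) = (\<Sum>v1\<in>UNIV. \<Sum>v2\<in>UNIV. pV1 v1 * pV2 v2 * g v1 v2)"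
proof -
  have s1: "(\<Sum>y\<in>UNIV. Wc x1 x2 y) = 1" "(\<Sum>x\<in>UNIV. pX1 u v1 x) = 1" "(\<Sum>x\<in>UNIV. pX2 u v2 x) = 1" for x1 x2 v1 v2 u
    using assms unfolding is_pmf_def by blast+
  show 1: "(\<Sum>y\<in>UNIV. mac_kernel pV1 pV2 pX1 pX2 Wc u u' (v1, v2, y)) = pV1 v1 * pV2 v2" for v1 v2
  proof -
    have "(\<Sum>y\<in>UNIV. mac_kernel pV1 pV2 pX1 pX2 Wc u u' (v1, v2, y))
      = pV1 v1 * pV2 v2 * (\<Sum>x1\<in>UNIV. \<Sum>x2\<in>UNIV. pX1 u v1 x1 * pX2 u' v2 x2 * (\<Sum>y\<in>UNIV. Wc x1 x2 y))"
      unfolding mac_kernel_def prod.case sum_distrib_left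
      apply (subst sum.swap[of _ "UNIV :: 'x1 set" "UNIV :: 'y set"])
      apply (subst sum.swap[of _ "UNIV :: 'x2 set" "UNIV :: 'y set"])
      apply (rule refl)
      done
    then show ?thesis by (simp add: s1 sum_distrib_left[symmetric])
  qed
  have "(\<Sum>w\<in>UNIV. mac_kernel pV1 pV2 pX1 pX2 Wc u u' w * g (fst w) (fst (snd w)))
    = (\<Sum>v1\<in>UNIV. \<Sum>v2\<in>UNIV. \<Sum>y\<in>UNIV. mac_kernel pV1 pV2 pX1 pX2 Wc u u' (v1, v2, y) * g v1 v2)"
    by (simp add: UNIV_Times_UNIV[symmetric] sum.cartesian_product' del: UNIV_Times_UNIV)
  then show "(\<Sum>w\<in>UNIV. mac_kernel pV1 pV2 pX1 pX2 Wc u u' w * g (fst w) (fst (snd w))) = (\<Sum>v1\<in>UNIV. \<Sum>v2\<in>UNIV. pV1 v1 * pV2 v2 * g v1 v2)"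
    by (simp add: sum_distrib_right[symmetric] 1)
qed

lemma is_pmf_mac_kernel:
  fixes pX1 :: "'u \<Rightarrow> 'v1::finite \<Rightarrow> 'x1::finite \<Rightarrow> real" and pX2 :: "'u \<Rightarrow> 'v2::finite \<Rightarrow> 'x2::finite \<Rightarrow> real"
    and Wc :: "'x1 \<Rightarrow> 'x2 \<Rightarrow> 'y::finite \<Rightarrow> real"
  assumes "is_pmf pV1" "is_pmf pV2" "\<And>u v. is_pmf (pX1 u v)" "\<And>u v. is_pmf (pX2 u v)" "\<And>x1 x2. is_pmf (Wc x1 x2)"
  shows "is_pmf (mac_kernel pV1 pV2 pX1 pX2 Wc u u')"
proof -
  have nn: "0 \<le> Wc x1 x2 y" "0 \<le> pV1 v1" "0 \<le> pV2 v2" "0 \<le> pX1 u v1 x1" "0 \<le> pX2 u v2 x2"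
    for x1 x2 y v1 v2 u using assms(1-5) unfolding is_pmf_def by blast+
  have "(\<Sum>w\<in>UNIV. mac_kernel pV1 pV2 pX1 pX2 Wc u u' w) = (\<Sum>v1\<in>UNIV. \<Sum>v2\<in>UNIV. pV1 v1 * pV2 v2)"
    using mac_kernel_marginal(2)[OF assms(3-5), where g = "\<lambda>_ _. 1"] by simp
  also have "\<dots> = 1" using assms(1,2) by (simp add: is_pmf_def sum_distrib_left[symmetric])
  finally show ?thesis
    unfolding is_pmf_def by (auto simp: mac_kernel_def intro!: mult_nonneg_nonneg sum_nonneg nn split: prod.splits)
qed

text \<open>Reduces the coding problem to one block of fixed length. The conditions
  \<open>f1\<close> to \<open>f3\<close> control wrong candidates and the positive means
  \<open>m\<close> the true pair; the total error decays geometrically in the number of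
  blocks.\<close>

lemma transmissible_block_coding:
  fixes W :: "'s1::finite \<times> 's2::finite \<Rightarrow> real"
    and Wc :: "'x1::finite \<Rightarrow> 'x2::finite \<Rightarrow> 'y::finite \<Rightarrow> real"
    and pV1 :: "'v1::finite \<Rightarrow> real" and pV2 :: "'v2::finite \<Rightarrow> real"
    and pX1 :: "'u \<Rightarrow> 'v1 \<Rightarrow> 'x1 \<Rightarrow> real" and pX2 :: "'u \<Rightarrow> 'v2 \<Rightarrow> 'x2 \<Rightarrow> real"
    and C1 :: "'s1 list \<Rightarrow> 'u list" and C2 :: "'s2 list \<Rightarrow> 'u list"
    and D1 D2 D3 :: "(('s1 \<times> 's2) \<times> ('v1 \<times> 'v2 \<times> 'y)) list \<Rightarrow> real"
  defines "J \<equiv> block_law W (mac_kernel pV1 pV2 pX1 pX2 Wc) C1 C2"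
  assumes W: "is_pmf W" and Wc: "\<And>x1 x2. is_pmf (Wc x1 x2)" and V1: "is_pmf pV1" and V2: "is_pmf pV2"
    and X1: "\<And>u v. is_pmf (pX1 u v)" and X2: "\<And>u v. is_pmf (pX2 u v)" and "0 < l"
    and C1: "\<And>s. length s = l \<Longrightarrow> length (C1 s) = l" and C2: "\<And>s. length s = l \<Longrightarrow> length (C2 s) = l"
    and D0: "\<And>z. 0 \<le> D1 z" "\<And>z. 0 \<le> D2 z" "\<And>z. 0 \<le> D3 z"
    and pos: "\<And>z. length z = l \<Longrightarrow> J z \<noteq> 0 \<Longrightarrow> 0 < D1 z" "\<And>z. length z = l \<Longrightarrow> J z \<noteq> 0 \<Longrightarrow> 0 < D2 z"
       "\<And>z. length z = l \<Longrightarrow> J z \<noteq> 0 \<Longrightarrow> 0 < D3 z"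
    and f1: "\<And>b. length b = l \<Longrightarrow> (\<Sum>z | length z = l \<and> map fix1 z = b. prod_list (map (wt1 pV1) z) * D1 z) \<le> 1"
    and f2: "\<And>b. length b = l \<Longrightarrow> (\<Sum>z | length z = l \<and> map fix2 z = b. prod_list (map (wt2 pV2) z) * D2 z) \<le> 1"
    and f3: "\<And>b. length b = l \<Longrightarrow> (\<Sum>z | length z = l \<and> map fix3 z = b.
                prod_list (map (\<lambda>x. wt1 pV1 x * wt2 pV2 x) z) * D3 z) \<le> 1"
    and m: "0 < (\<Sum>z\<in>Len l. J z * ln (D1 z))" "0 < (\<Sum>z\<in>Len l. J z * ln (D2 z))" "0 < (\<Sum>z\<in>Len l. J z * ln (D3 z))"
  shows "transmissible W Wc"
proof -
  let ?k = "mac_kernel pV1 pV2 pX1 pX2 Wc"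
  \<comment> \<open>Bounds the cost of the left-over symbols for all remainders at once, so it is a
    constant as the number of blocks grows.\<close>
  let ?K = "real CARD(('s1 \<times> 's2) \<times> ('v1 \<times> 'v2 \<times> 'y)) ^ l"
  have kpmf: "is_pmf (?k u u')" for u u' using V1 V2 X1 X2 Wc by (rule is_pmf_mac_kernel)
  have k0: "0 \<le> ?k u u' w" and k1: "(\<Sum>w\<in>UNIV. ?k u u' w) = 1" for u u' w
    using kpmf unfolding is_pmf_def by blast+
  have W0: "0 \<le> W s" and W1: "(\<Sum>s\<in>UNIV. W s) = 1" for s using W unfolding is_pmf_def by blast+
  have p1: "0 \<le> pV1 v \<and> pV1 v \<le> 1" for v using V1 is_pmf_le_1[OF V1] unfolding is_pmf_def by blast
  have p2: "0 \<le> pV2 v \<and> pV2 v \<le> 1" for v using V2 is_pmf_le_1[OF V2] unfolding is_pmf_def by blast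
  have J0: "0 \<le> J z" for z unfolding J_def using k0 W0 by (rule block_law_nonneg)
  have J1: "(\<Sum>z\<in>Len l. J z) = 1" unfolding J_def using k1 W1 C1 C2 by (rule sum_block_law)
  obtain t1 g1 where t1: "0 < t1" "0 < g1" "\<And>g. g \<le> g1 \<Longrightarrow> exp (t1 * g) * (\<Sum>z\<in>Len l. J z * exp (- t1 * ln (D1 z))) < 1"
    using chernoff_exponent[OF finite_Len J1 m(1) J0] by blast
  obtain t2 g2 where t2: "0 < t2" "0 < g2" "\<And>g. g \<le> g2 \<Longrightarrow> exp (t2 * g) * (\<Sum>z\<in>Len l. J z * exp (- t2 * ln (D2 z))) < 1"
    using chernoff_exponent[OF finite_Len J1 m(2) J0] by blast
  obtain t3 g3 where t3: "0 < t3" "0 < g3" "\<And>g. g \<le> g3 \<Longrightarrow> exp (t3 * g) * (\<Sum>z\<in>Len l. J z * exp (- t3 * ln (D3 z))) < 1"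
    using chernoff_exponent[OF finite_Len J1 m(3) J0] by blast
  \<comment> \<open>One rate for all three tests: at most each Chernoff rate, so the true pair
    passes each test with high probability, and positive, so that wrong candidates lose a factor
    \<open>exp (- g)\<close> per block.\<close>
  define g where "g = min g1 (min g2 g3)"
  have g: "0 < g" "g \<le> g1" "g \<le> g2" "g \<le> g3" using t1 t2 t3 by (auto simp: g_def)
  define h1 where "h1 = exp (t1 * g) * (\<Sum>z\<in>Len l. J z * exp (- t1 * ln (D1 z)))"
  define h2 where "h2 = exp (t2 * g) * (\<Sum>z\<in>Len l. J z * exp (- t2 * ln (D2 z)))"
  define h3 where "h3 = exp (t3 * g) * (\<Sum>z\<in>Len l. J z * exp (- t3 * ln (D3 z)))"
  have h: "0 \<le> h1" "h1 < 1" "0 \<le> h2" "h2 < 1" "0 \<le> h3" "h3 < 1"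
    unfolding h1_def h2_def h3_def using t1 t2 t3 g J0 by (auto intro!: mult_nonneg_nonneg sum_nonneg)
  define bound where "bound = (\<lambda>m :: nat. h1 ^ m + h2 ^ m + h3 ^ m + ?K * exp (- g) ^ m + ?K * exp (- g) ^ m + ?K * exp (- g) ^ m)"
  have "bound \<longlonglongrightarrow> 0 + 0 + 0 + ?K * 0 + ?K * 0 + ?K * 0"
    unfolding bound_def using h g by (intro tendsto_intros LIMSEQ_power_zero) auto
  then have lim: "bound \<longlonglongrightarrow> 0" by simp
  have code: "code_exists W Wc n (bound (n div l))" for n
  proof -
    define m where "m = n div l"
    define r where "r = n mod l"
    have n: "n = m * l + r" by (simp add: m_def r_def)
    have "r \<le> l" using \<open>0 < l\<close> by (simp add: r_def less_imp_le)
    \<comment> \<open>Any letter serves for the left-over symbols, as the metric is constant one on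
      them; \<open>U2\<close> uses the same one.\<close>
    define U1 where "U1 = chunk_map C1 undefined l m"
    define U2 where "U2 = chunk_map C2 undefined l m"
    define \<theta> where "\<theta> = exp (g * m)"
    define E1 where "E1 = (\<lambda>z. chunk_prod D1 (\<lambda>_. 1) l m z)"
    define E2 where "E2 = (\<lambda>z. chunk_prod D2 (\<lambda>_. 1) l m z)"
    define E3 where "E3 = (\<lambda>z. chunk_prod D3 (\<lambda>_. 1) l m z)"
    define G where "G = (\<lambda>z. \<theta> < E1 z \<and> \<theta> < E2 z \<and> \<theta> < E3 z)"
    define j where "j = (\<lambda>x :: ('s1 \<times> 's2) \<times> ('v1 \<times> 'v2 \<times> 'y). W (fst x) * ?k undefined undefined (snd x))"
    have j0: "0 \<le> j x" for x unfolding j_def using W0 k0 by simp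
    have "(\<Sum>x\<in>UNIV. j x) = (\<Sum>s\<in>UNIV. \<Sum>w\<in>UNIV. W s * ?k undefined undefined w)"
      unfolding j_def by (simp add: UNIV_Times_UNIV[symmetric] sum.cartesian_product' del: UNIV_Times_UNIV)
    then have j1: "(\<Sum>x\<in>UNIV. j x) = 1" by (simp add: sum_distrib_left[symmetric] k1 W1)
    have law: "block_law W ?k U1 U2 z = chunk_prod J j l m z" if "length z = n" for z
      unfolding U1_def U2_def J_def j_def using that n by (intro block_law_chunk_map C1 C2) auto
    have Kr: "real CARD(('s1 \<times> 's2) \<times> ('v1 \<times> 'v2 \<times> 'y)) ^ r / \<theta> \<le> ?K * exp (- g) ^ m"
    proof -
      have "real CARD(('s1 \<times> 's2) \<times> ('v1 \<times> 'v2 \<times> 'y)) ^ r \<le> ?K"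
        using \<open>r \<le> l\<close> by (intro power_increasing) (simp_all only: One_nat_def Suc_le_eq real_of_nat_ge_one_iff zero_less_card_finite)
      then have "real CARD(('s1 \<times> 's2) \<times> ('v1 \<times> 'v2 \<times> 'y)) ^ r / \<theta> \<le> ?K / \<theta>"
        by (intro divide_right_mono) (auto simp: \<theta>_def)
      also have "\<dots> = ?K * exp (- g) ^ m"
        unfolding \<theta>_def by (simp add: exp_of_nat_mult[symmetric] exp_minus divide_inverse power_inverse mult.commute)
      finally show ?thesis .
    qed
    have tail1: "(\<Sum>z\<in>Len n. chunk_prod J j l m z * of_bool (E1 z \<le> \<theta>)) \<le> h1 ^ m"
      unfolding n E1_def \<theta>_def h1_def using t1 by (intro chunk_prod_tail_bound J0 j0 j1 pos) auto
    have tail2: "(\<Sum>z\<in>Len n. chunk_prod J j l m z * of_bool (E2 z \<le> \<theta>)) \<le> h2 ^ m"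
      unfolding n E2_def \<theta>_def h2_def using t2 by (intro chunk_prod_tail_bound J0 j0 j1 pos) auto
    have tail3: "(\<Sum>z\<in>Len n. chunk_prod J j l m z * of_bool (E3 z \<le> \<theta>)) \<le> h3 ^ m"
      unfolding n E3_def \<theta>_def h3_def using t3 by (intro chunk_prod_tail_bound J0 j0 j1 pos) auto
    have cp0: "0 \<le> chunk_prod J j l m z" for z using J0 j0 by (intro chunk_prod_nonneg) auto
    have finf: "finite {z :: (('s1 \<times> 's2) \<times> ('v1 \<times> 'v2 \<times> 'y)) list. length z = n \<and> Q z}" for Q
      by (rule finite_subset[OF _ finite_Len[of n]]) auto
    have "code_exists W Wc n ((h1 ^ m + h2 ^ m + h3 ^ m) + ?K * exp (- g) ^ m + ?K * exp (- g) ^ m + ?K * exp (- g) ^ m)"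
    proof (rule random_coding_lists[OF W Wc V1 V2 X1 X2, where ?C1.0 = U1 and ?C2.0 = U2 and G = G])
      show "length (U1 s) = n" if "length s = n" for s
        unfolding U1_def using length_chunk_map[of l C1 s m r] C1 that n by simp
      show "length (U2 s) = n" if "length s = n" for s
        unfolding U2_def using length_chunk_map[of l C2 s m r] C2 that n by simp
      have "(\<Sum>z\<in>Len n. block_law W ?k U1 U2 z * of_bool (\<not> G z)) \<le>
         (\<Sum>z\<in>Len n. chunk_prod J j l m z * of_bool (E1 z \<le> \<theta>) + chunk_prod J j l m z * of_bool (E2 z \<le> \<theta>)
            + chunk_prod J j l m z * of_bool (E3 z \<le> \<theta>))"
      proof (rule sum_mono)
        fix z :: "(('s1 \<times> 's2) \<times> ('v1 \<times> 'v2 \<times> 'y)) list"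
        assume "z \<in> Len n"
        then show "block_law W ?k U1 U2 z * of_bool (\<not> G z) \<le> chunk_prod J j l m z * of_bool (E1 z \<le> \<theta>) + chunk_prod J j l m z * of_bool (E2 z \<le> \<theta>)
            + chunk_prod J j l m z * of_bool (E3 z \<le> \<theta>)"
          using cp0[of z] by (auto simp: law G_def of_bool_def)
      qed
      then show "(\<Sum>z\<in>Len n. block_law W ?k U1 U2 z * of_bool (\<not> G z)) \<le> h1 ^ m + h2 ^ m + h3 ^ m"
        using tail1 tail2 tail3 by (simp add: sum.distrib)
      show "(\<Sum>z | length z = n \<and> map fix1 z = b. prod_list (map (wt1 pV1) z) * of_bool (G z)) \<le> ?K * exp (- g) ^ m"
        if "length b = n" for b
      proof -
        have "(\<Sum>z | length z = n \<and> map fix1 z = b. prod_list (map (wt1 pV1) z) * of_bool (G z))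
          \<le> (\<Sum>z | length z = m * l + r \<and> map fix1 z = b. prod_list (map (wt1 pV1) z) * of_bool (\<theta> < chunk_prod D1 (\<lambda>_. 1) l m z))"
          unfolding n[symmetric] using p1 by (intro sum_mono mult_left_mono prod_list_nonneg_map) (auto simp: G_def E1_def)
        also have "\<dots> \<le> real CARD(('s1 \<times> 's2) \<times> ('v1 \<times> 'v2 \<times> 'y)) ^ r / \<theta>"
          using that n p1 by (intro fiber_threshold_bound D0 f1) (auto simp: \<theta>_def)
        finally show ?thesis using Kr by linarith
      qed
      show "(\<Sum>z | length z = n \<and> map fix2 z = b. prod_list (map (wt2 pV2) z) * of_bool (G z)) \<le> ?K * exp (- g) ^ m"
        if "length b = n" for b
      proof -
        have "(\<Sum>z | length z = n \<and> map fix2 z = b. prod_list (map (wt2 pV2) z) * of_bool (G z))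
          \<le> (\<Sum>z | length z = m * l + r \<and> map fix2 z = b. prod_list (map (wt2 pV2) z) * of_bool (\<theta> < chunk_prod D2 (\<lambda>_. 1) l m z))"
          unfolding n[symmetric] using p2 by (intro sum_mono mult_left_mono prod_list_nonneg_map) (auto simp: G_def E2_def)
        also have "\<dots> \<le> real CARD(('s1 \<times> 's2) \<times> ('v1 \<times> 'v2 \<times> 'y)) ^ r / \<theta>"
          using that n p2 by (intro fiber_threshold_bound D0 f2) (auto simp: \<theta>_def)
        finally show ?thesis using Kr by linarith
      qed
      show "(\<Sum>z | length z = n \<and> map fix3 z = b. prod_list (map (wt1 pV1) z) * prod_list (map (wt2 pV2) z) * of_bool (G z)) \<le> ?K * exp (- g) ^ m"
        if "length b = n" for b
      proof -
        have "(\<Sum>z | length z = n \<and> map fix3 z = b. prod_list (map (wt1 pV1) z) * prod_list (map (wt2 pV2) z) * of_bool (G z))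
          \<le> (\<Sum>z | length z = m * l + r \<and> map fix3 z = b. prod_list (map (\<lambda>x. wt1 pV1 x * wt2 pV2 x) z) * of_bool (\<theta> < chunk_prod D3 (\<lambda>_. 1) l m z))"
          unfolding n[symmetric] prod_list_mult_map using p1 p2
          by (intro sum_mono mult_left_mono mult_nonneg_nonneg prod_list_nonneg_map) (auto simp: G_def E3_def)
        also have "\<dots> \<le> real CARD(('s1 \<times> 's2) \<times> ('v1 \<times> 'v2 \<times> 'y)) ^ r / \<theta>"
          using that n p1 p2 by (intro fiber_threshold_bound D0 f3) (auto simp: \<theta>_def intro: mult_le_one)
        finally show ?thesis using Kr by linarith
      qed
    qed
    then show ?thesis by (simp add: bound_def m_def add.assoc)
  qed
  show ?thesis
    unfolding transmissible_def code_exists_def[symmetric]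
  proof (intro allI impI)
    fix \<epsilon> :: real assume "\<epsilon> > 0"
    then obtain M where M: "\<And>m. m \<ge> M \<Longrightarrow> bound m < \<epsilon>"
      using order_tendstoD(2)[OF lim] unfolding eventually_sequentially by blast
    show "\<exists>N. \<forall>n\<ge>N. code_exists W Wc n \<epsilon>"
    proof (intro exI[of _ "M * l"] allI impI)
      fix n assume "M * l \<le> n"
      then have "M \<le> n div l" using \<open>0 < l\<close> by (simp add: less_eq_div_iff_mult_less_eq)
      from M[OF this] code[of n] show "code_exists W Wc n \<epsilon>" by (rule code_exists_mono[rotated, OF less_imp_le])
    qed
  qed
qed

section \<open>Constant composition codes\<close>

text \<open>The lower Stirling-type bound; the induction step is
  \<open>(1 + 1 / n) ^ n \<le> exp 1\<close>.\<close>

lemma power_self_le_fact: "real n ^ n \<le> fact n * exp (real n)"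
proof (induction n)
  case (Suc n)
  have "(real n + 1) ^ n \<le> exp 1 * real n ^ n"
  proof (cases "n = 0")
    case False
    have "(1 + 1 / real n) ^ n \<le> exp (1 / real n) ^ n"
      by (intro power_mono) (auto intro: exp_ge_add_one_self)
    also have "\<dots> = exp 1" using False by (simp add: exp_of_nat_mult[symmetric])
    finally have "(1 + 1 / real n) ^ n * real n ^ n \<le> exp 1 * real n ^ n" by (intro mult_right_mono) auto
    then show ?thesis using False by (simp add: power_mult_distrib[symmetric] distrib_right)
  qed simp
  then have "(real n + 1) * (real n + 1) ^ n \<le> (real n + 1) * (exp 1 * (fact n * exp (real n)))"
    using Suc.IH by (intro mult_left_mono) (auto intro: order_trans mult_left_mono)
  then show ?case by (simp add: exp_add algebra_simps)
qed simp

text \<open>The upper counterpart. The induction proves the sharper factor \<open>exp 1 * n\<close>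
  for positive \<open>n\<close>, which is below \<open>3 * n\<close> and so below the square. The
  square is the source of the exponent \<open>2 * CARD('u)\<close> for type classes.\<close>

lemma fact_exp_le: "fact n * exp (real n) \<le> (real n + 1)\<^sup>2 * real n ^ n"
proof (cases "n = 0")
  case False
  have *: "fact (Suc n) * exp (real (Suc n)) \<le> exp 1 * real (Suc n) * real (Suc n) ^ Suc n" for n
  proof (induction n)
    case (Suc n)
    let ?x = "real (Suc n)"
    have x: "?x > 0" by simp
    \<comment> \<open>With \<open>x = n + 1\<close> this says that
      \<open>(1 - 1 / (x + 1)) ^ (x + 1)\<close> is at most \<open>exp (- 1)\<close>, which compares
      consecutive right-hand sides of the claim.\<close>
    have "(1 + - (1 / (?x + 1))) ^ Suc (Suc n) \<le> exp (- (1 / (?x + 1))) ^ Suc (Suc n)"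
      by (intro power_mono exp_ge_add_one_self) auto
    also have "\<dots> = exp (real (Suc (Suc n)) * - (1 / (?x + 1)))"
      by (rule exp_of_nat_mult[symmetric])
    also have "real (Suc (Suc n)) * - (1 / (?x + 1)) = - 1" by simp
    also have "1 + - (1 / (?x + 1)) = ?x / (?x + 1)" by (simp add: field_simps)
    finally have "(?x / (?x + 1)) ^ Suc (Suc n) * (exp 1 * (?x + 1) ^ Suc (Suc n)) \<le> exp (- 1) * (exp 1 * (?x + 1) ^ Suc (Suc n))"
      by (intro mult_right_mono) auto
    moreover have "(?x / (?x + 1)) ^ Suc (Suc n) * (exp 1 * (?x + 1) ^ Suc (Suc n)) = exp 1 * ?x ^ Suc (Suc n)"
      using x by (simp only: power_divide) simp
    moreover have "exp (- 1) * (exp 1 * (?x + 1) ^ Suc (Suc n)) = (?x + 1) ^ Suc (Suc n)"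
      by (simp only: mult.assoc[symmetric] exp_add[symmetric]) simp
    ultimately have key: "exp 1 * ?x ^ Suc (Suc n) \<le> (?x + 1) ^ Suc (Suc n)" by linarith
    have "fact (Suc (Suc n)) * exp (real (Suc (Suc n))) = (?x + 1) * exp 1 * (fact (Suc n) * exp ?x)"
    proof -
      have "exp (real (Suc (Suc n))) = exp 1 * exp ?x" by (simp only: exp_add[symmetric]) simp
      moreover have "fact (Suc (Suc n)) = (?x + 1) * (fact (Suc n) :: real)"
        by (simp only: fact_Suc[of "Suc n"]) simp
      ultimately show ?thesis by (simp only: mult_ac)
    qed
    also have "\<dots> \<le> (?x + 1) * exp 1 * (exp 1 * ?x * ?x ^ Suc n)"
      by (intro mult_left_mono Suc.IH) auto
    also have "\<dots> = (?x + 1) * exp 1 * (exp 1 * ?x ^ Suc (Suc n))"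
      by simp
    also have "\<dots> \<le> (?x + 1) * exp 1 * (?x + 1) ^ Suc (Suc n)"
      by (intro mult_left_mono key) auto
    also have "\<dots> = exp 1 * real (Suc (Suc n)) * real (Suc (Suc n)) ^ Suc (Suc n)"
      by (simp add: add.commute)
    finally show ?case .
  qed simp
  from False obtain k where k: "n = Suc k" by (cases n) auto
  have "exp 1 * real n \<le> 3 * real n" by (intro mult_right_mono exp_le) auto
  also have "\<dots> \<le> (real n + 1)\<^sup>2"
    using zero_le_power2[of "real n - 1"] by (simp add: power2_eq_square algebra_simps)
  finally have "exp 1 * real n * real n ^ n \<le> (real n + 1)\<^sup>2 * real n ^ n"
    by (intro mult_right_mono) auto
  with *[of k, folded k] show ?thesis by (rule order_trans)
qed simp

lemma prod_list_map_eq_prod_count: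
  "prod_list (map f u) = (\<Prod>a\<in>UNIV. f a ^ count_list u a)" for f :: "'a::finite \<Rightarrow> real"
proof (induction u)
  case (Cons x u)
  have "(\<Prod>a\<in>UNIV. f a ^ count_list (x # u) a) = (\<Prod>a\<in>UNIV. (if a = x then f a else 1) * f a ^ count_list u a)"
    by (intro prod.cong) auto
  then show ?case by (simp add: prod.distrib Cons.IH)
qed simp

lemma sum_list_map_eq_sum_count_real:
  "sum_list (map f u) = (\<Sum>a\<in>UNIV. real (count_list u a) * f a)" for f :: "'a::finite \<Rightarrow> real"
proof (induction u)
  case (Cons x u)
  have "(\<Sum>a\<in>UNIV. real (count_list (x # u) a) * f a) = (\<Sum>a\<in>UNIV. (if a = x then f a else 0) + real (count_list u a) * f a)"
    by (intro sum.cong) (auto simp: algebra_simps)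
  then show ?case by (simp add: sum.distrib Cons.IH)
qed simp

text \<open>The type class of \<open>p\<close>. Counts are compared as reals, so divisibility
  questions are left to \<open>is_type\<close>.\<close>

definition comp_class :: "nat \<Rightarrow> ('u \<Rightarrow> real) \<Rightarrow> 'u list set" where
  "comp_class l p = {u. length u = l \<and> (\<forall>a. real (count_list u a) = real l * p a)}"

text \<open>The class has multinomial size. The factorial bounds replace factorials by powers, at a
  polynomial cost for each symbol, and the exponentials cancel because the counts add up to
  \<open>l\<close>. Codewords drawn uniformly from the class can then be treated as i.i.d.
  ones.\<close>

lemma comp_class_prob:
  fixes p :: "'u::finite \<Rightarrow> real"
  assumes "is_pmf p" "is_type l p" "0 < l"
  shows "finite (comp_class l p)" "comp_class l p \<noteq> {}"
    "\<And>u. u \<in> comp_class l p \<Longrightarrow> 1 / real (card (comp_class l p)) \<le> (real l + 1) ^ (2 * CARD('u)) * prod_list (map p u)"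
proof -
  let ?T = "comp_class l p"
  have p0: "0 \<le> p a" and p1: "(\<Sum>a\<in>UNIV. p a) = 1" for a using assms unfolding is_pmf_def by blast+
  have "\<exists>k :: nat. real k = real l * p a" for a
  proof -
    from assms obtain i :: int where i: "real l * p a = of_int i" unfolding is_type_def by (meson Ints_cases)
    have "0 \<le> i" using p0[of a] i by (metis mult_nonneg_nonneg of_int_0_le_iff of_nat_0_le_iff)
    with i show ?thesis by (intro exI[of _ "nat i"]) simp
  qed
  then obtain n :: "'u \<Rightarrow> nat" where n: "\<And>a. real (n a) = real l * p a" by metis
  define A where "A = (\<Sum>a\<in>UNIV. replicate_mset (n a) a)"
  have cA: "count A a = n a" for a
    by (simp add: A_def count_sum if_distrib sum.delta cong: if_cong)
  have "real (\<Sum>a\<in>UNIV. n a) = real l" by (simp add: n sum_distrib_left[symmetric] p1)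
  then have sn: "(\<Sum>a\<in>UNIV. n a) = l" by linarith
  then have sA: "size A = l" by (simp add: A_def)
  \<comment> \<open>Identifies the class with the orderings of a fixed multiset, whose number is
    known in terms of factorials.\<close>
  have T: "?T = permutations_of_multiset A"
  proof (intro set_eqI iffI)
    fix u assume "u \<in> ?T"
    then have "real (count (mset u) a) = real (count A a)" for a
      using n by (simp add: comp_class_def cA count_mset)
    then have "\<And>a. count (mset u) a = count A a" by simp
    then show "u \<in> permutations_of_multiset A" by (auto simp: permutations_of_multiset_def intro: multiset_eqI)
  next
    fix u assume "u \<in> permutations_of_multiset A"
    then have "mset u = A" by (simp add: permutations_of_multiset_def)
    then show "u \<in> ?T" using sA cA n by (auto simp: comp_class_def count_mset[symmetric] simp flip: size_mset)
  qed
  show fin: "finite ?T" unfolding T by simp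
  show ne: "?T \<noteq> {}" unfolding T by (simp add: permutations_of_multiset_not_empty)
  have "card ?T * (\<Prod>x\<in>set_mset A. fact (count A x)) = fact (size A)"
    unfolding T by (rule card_permutations_of_multiset_aux)
  moreover have "(\<Prod>x\<in>set_mset A. fact (count A x) :: nat) = (\<Prod>x\<in>UNIV. fact (n x))"
    unfolding cA by (rule prod.mono_neutral_left) (auto simp: cA[symmetric] not_in_iff)
  ultimately have card: "card ?T * (\<Prod>x\<in>UNIV. fact (n x)) = fact l" using sA by simp
  then have "real (card ?T * (\<Prod>x\<in>UNIV. fact (n x))) = real (fact l)" by (simp only:)
  then have card: "real (card ?T) * (\<Prod>x\<in>UNIV. fact (n x)) = fact l"
    by (simp only: of_nat_mult of_nat_prod of_nat_fact)
  fix u assume u: "u \<in> ?T"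
  let ?c = "real (card ?T)"
  have cpos: "0 < ?c" using fin ne by (simp add: card_gt_0_iff)
  have Pu: "prod_list (map p u) = (\<Prod>a\<in>UNIV. real (n a) ^ n a) / real l ^ l"
  proof -
    have "real (count_list u a) = real (n a)" for a using u n by (simp add: comp_class_def)
    then have cu: "count_list u a = n a" for a by simp
    have "prod_list (map p u) = (\<Prod>a\<in>UNIV. (real (n a) / real l) ^ n a)"
      unfolding prod_list_map_eq_prod_count cu using \<open>0 < l\<close> by (simp add: n)
    also have "\<dots> = (\<Prod>a\<in>UNIV. real (n a) ^ n a) / (\<Prod>a\<in>UNIV. real l ^ n a)"
      by (simp add: power_divide prod_dividef)
    also have "(\<Prod>a\<in>UNIV. real l ^ n a) = real l ^ l" by (simp add: power_sum[symmetric] sn)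
    finally show ?thesis .
  qed
  have "real l ^ l \<le> fact l * exp (real l)" by (rule power_self_le_fact)
  also have "\<dots> = ?c * (\<Prod>x\<in>UNIV. fact (n x) * exp (real (n x)))"
    using sn by (simp add: card[symmetric] prod.distrib exp_sum[symmetric] of_nat_sum[symmetric] del: of_nat_sum)
  also have "\<dots> \<le> ?c * (\<Prod>x\<in>UNIV. (real l + 1)\<^sup>2 * real (n x) ^ n x)"
  proof (intro mult_left_mono prod_mono conjI)
    fix x
    have "n x \<le> l" using sn member_le_sum[of x UNIV n] by auto
    then have "(real (n x) + 1)\<^sup>2 * real (n x) ^ n x \<le> (real l + 1)\<^sup>2 * real (n x) ^ n x"
      by (intro mult_right_mono power_mono) auto
    with fact_exp_le[of "n x"] show "fact (n x) * exp (real (n x)) \<le> (real l + 1)\<^sup>2 * real (n x) ^ n x" by linarith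
  qed auto
  also have "\<dots> = ?c * ((real l + 1) ^ (2 * CARD('u)) * (\<Prod>x\<in>UNIV. real (n x) ^ n x))"
    by (simp add: prod.distrib power_mult)
  finally have "real l ^ l / real l ^ l \<le> ?c * ((real l + 1) ^ (2 * CARD('u)) * (\<Prod>x\<in>UNIV. real (n x) ^ n x)) / real l ^ l"
    by (rule divide_right_mono) simp
  then have "1 \<le> ?c * ((real l + 1) ^ (2 * CARD('u)) * prod_list (map p u))"
    using \<open>0 < l\<close> by (simp add: Pu)
  then show "1 / ?c \<le> (real l + 1) ^ (2 * CARD('u)) * prod_list (map p u)"
    using cpos by (simp add: pos_divide_le_eq mult.commute)
qed

text \<open>Replaces a sum over type classes: a weight that depends on the type of its argument costs only the
  number of types.\<close>

lemma sum_over_types_le: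
  fixes f :: "('c::finite \<Rightarrow> nat) \<Rightarrow> 'x \<Rightarrow> real" and g :: "'x \<Rightarrow> 'c list"
  assumes "finite S" "\<And>x. x \<in> S \<Longrightarrow> length (g x) = l" "\<And>x y. 0 \<le> f (count_list (g x)) y"
    and "\<And>x0. x0 \<in> S \<Longrightarrow> (\<Sum>x\<in>S. f (count_list (g x0)) x) \<le> 1"
  shows "(\<Sum>x\<in>S. f (count_list (g x)) x) \<le> (real l + 1) ^ CARD('c)"
proof -
  let ?N = "(\<lambda>x. count_list (g x)) ` S"
  have fin: "finite ?N" using assms by simp
  have "(\<Sum>x\<in>S. f (count_list (g x)) x) \<le> (\<Sum>x\<in>S. \<Sum>N\<in>?N. f N x)"
  proof (rule sum_mono)
    fix x assume "x \<in> S"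
    then show "f (count_list (g x)) x \<le> (\<Sum>N\<in>?N. f N x)"
      using fin assms(3) by (intro member_le_sum[where f = "\<lambda>N. f N x"]) auto
  qed
  also have "\<dots> = (\<Sum>N\<in>?N. \<Sum>x\<in>S. f N x)" by (rule sum.swap)
  also have "\<dots> \<le> (\<Sum>N\<in>?N. 1)" using assms(4) by (intro sum_mono) auto
  also have "\<dots> = real (card ?N)" by simp
  also have "card ?N \<le> card (PiE (UNIV :: 'c set) (\<lambda>_. {..l}))"
  proof (rule card_mono)
    show "?N \<subseteq> (PiE (UNIV :: 'c set) (\<lambda>_. {..l}))"
      using assms(2) count_le_length by (fastforce simp: PiE_def)
  qed (auto intro: finite_PiE)
  also have "card (PiE (UNIV :: 'c set) (\<lambda>_. {..l})) = Suc l ^ CARD('c)"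
    by (simp add: card_PiE)
  finally show ?thesis by (simp add: add.commute)
qed

section \<open>Joint types, empirical channels and empirical information\<close>

lemma count_list_zip_marginals:
  fixes u :: "'u::finite list" and y :: "'y::finite list"
  assumes "length u = length y"
  shows "(\<Sum>b\<in>UNIV. count_list (zip u y) (a, b)) = count_list u a"
    "(\<Sum>a\<in>UNIV. count_list (zip u y) (a, b)) = count_list y b"
proof -
  show "(\<Sum>b\<in>UNIV. count_list (zip u y) (a, b)) = count_list u a"
    using assms
  proof (induction u y rule: list_induct2)
    case (Cons x xs z zs)
    have "(\<Sum>b\<in>UNIV. count_list (zip (x # xs) (z # zs)) (a, b))
      = (\<Sum>b\<in>UNIV. (if z = b then (if x = a then 1 else 0) else 0) + count_list (zip xs zs) (a, b))"
      by (intro sum.cong) auto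
    then show ?case by (simp add: sum.distrib Cons.IH)
  qed simp
  show "(\<Sum>a\<in>UNIV. count_list (zip u y) (a, b)) = count_list y b"
    using assms
  proof (induction u y rule: list_induct2)
    case (Cons x xs z zs)
    have "(\<Sum>a\<in>UNIV. count_list (zip (x # xs) (z # zs)) (a, b))
      = (\<Sum>a\<in>UNIV. (if x = a then (if z = b then 1 else 0) else 0) + count_list (zip xs zs) (a, b))"
      by (intro sum.cong) auto
    then show ?case by (simp add: sum.distrib Cons.IH)
  qed simp
qed

text \<open>The conditional type of the output given the codeword. Letters with
  \<open>p a = 0\<close> do not occur; using \<open>W\<close> there makes every row a pmf and adds
  no divergence. It takes the counts as argument, since \<open>sum_over_types_le\<close> freezes
  exactly these.\<close>

definition emp_channel :: "nat \<Rightarrow> ('u \<Rightarrow> real) \<Rightarrow> ('u \<Rightarrow> 'y \<Rightarrow> real) \<Rightarrow> ('u \<times> 'y \<Rightarrow> nat) \<Rightarrow> 'u \<Rightarrow> 'y \<Rightarrow> real" where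
  "emp_channel l p W N a b = (if p a = 0 then W a b else real (N (a, b)) / (real l * p a))"

text \<open>The empirical mutual information, which the inner decoder maximises. Its value does not
  depend on \<open>W\<close>, because the rows taken from \<open>W\<close> have weight zero.\<close>

definition emp_info :: "nat \<Rightarrow> ('u::finite \<Rightarrow> real) \<Rightarrow> ('u \<Rightarrow> 'y::finite \<Rightarrow> real) \<Rightarrow> 'u list \<Rightarrow> 'y list \<Rightarrow> real" where
  "emp_info l p W u y = mi_ch p (emp_channel l p W (count_list (zip u y)))"

context
  fixes p :: "'u::finite \<Rightarrow> real" and W :: "'u \<Rightarrow> 'y::finite \<Rightarrow> real" and l :: nat
  assumes p: "is_pmf p" and W: "\<And>u. is_pmf (W u)" and l: "0 < l"
begin

lemma p_nonneg: "0 \<le> p a" and W_nonneg: "0 \<le> W a b"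
  using p W unfolding is_pmf_def by blast+

lemma emp_channel_nonneg: "0 \<le> emp_channel l p W N a b"
  by (simp add: emp_channel_def p_nonneg W_nonneg)

lemma sum_counts_fst:
  fixes y :: "'y list"
  assumes "u \<in> comp_class l p" "length y = l"
  shows "(\<Sum>b\<in>UNIV. real (count_list (zip u y) (a, b))) = real l * p a"
proof -
  have "(\<Sum>b\<in>UNIV. real (count_list (zip u y) (a, b))) = real (count_list u a)"
    using assms count_list_zip_marginals(1)[of u y a] by (simp add: comp_class_def flip: of_nat_sum)
  then show ?thesis using assms by (simp add: comp_class_def)
qed

lemma emp_channel_pmf:
  assumes "u \<in> comp_class l p" "length y = l"
  shows "is_pmf (emp_channel l p W (count_list (zip u y)) a)"
proof (cases "p a = 0")
  case True
  then have "emp_channel l p W (count_list (zip u y)) a = W a"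
    by (intro ext) (simp add: emp_channel_def)
  then show ?thesis using W by simp
next
  case False
  then show ?thesis
    unfolding is_pmf_def using l sum_counts_fst[OF assms, of a]
    by (simp add: emp_channel_nonneg) (simp add: emp_channel_def sum_divide_distrib[symmetric])
qed

lemma p_times_emp_channel:
  assumes "u \<in> comp_class l p" "length y = l"
  shows "p a * emp_channel l p W (count_list (zip u y)) a b = real (count_list (zip u y) (a, b)) / real l"
proof (cases "p a = 0")
  case True
  then have "(\<Sum>b\<in>UNIV. real (count_list (zip u y) (a, b))) = 0" using sum_counts_fst[OF assms, of a] by simp
  then have "real (count_list (zip u y) (a, b)) = 0" by (simp only: sum_nonneg_eq_0_iff of_nat_0_le_iff finite) auto
  with True show ?thesis by simp
qed (simp add: emp_channel_def)

lemma pos_of_mem: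
  assumes "u \<in> comp_class l p" "length y = l" "(a, b) \<in> set (zip u y)"
  shows "0 < p a" "0 < count_list (zip u y) (a, b)" "0 < count_list y b" "0 < emp_channel l p W (count_list (zip u y)) a b"
proof -
  have "a \<in> set u" "b \<in> set y" using assms(3) by (auto dest: set_zip_leftD set_zip_rightD)
  then have "count_list u a \<noteq> 0" "count_list y b \<noteq> 0" by (simp_all add: count_list_0_iff)
  then show "0 < count_list y b" by simp
  have "real (count_list u a) = real l * p a" using assms(1) by (simp add: comp_class_def)
  then have "p a \<noteq> 0" using \<open>count_list u a \<noteq> 0\<close> by auto
  then show "0 < p a" using p_nonneg[of a] by simp
  have "count_list (zip u y) (a, b) \<noteq> 0" using assms(3) by (simp add: count_list_0_iff)
  then show "0 < count_list (zip u y) (a, b)" by simp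
  then show "0 < emp_channel l p W (count_list (zip u y)) a b"
    using \<open>0 < p a\<close> l by (simp add: emp_channel_def)
qed

lemma emp_info_eq:
  assumes "u \<in> comp_class l p" "length y = l"
  shows "real l * emp_info l p W u y = sum_list (map (\<lambda>(a, b).
      ln (emp_channel l p W (count_list (zip u y)) a b / (real (count_list y b) / real l))) (zip u y))"
proof -
  let ?N = "count_list (zip u y)"
  let ?V = "emp_channel l p W ?N"
  have out: "(\<Sum>a\<in>UNIV. p a * ?V a b) = real (count_list y b) / real l" for b
  proof -
    have "(\<Sum>a\<in>UNIV. p a * ?V a b) = (\<Sum>a\<in>UNIV. real (?N (a, b))) / real l"
      unfolding p_times_emp_channel[OF assms] by (simp add: sum_divide_distrib)
    also have "(\<Sum>a\<in>UNIV. real (?N (a, b))) = real (count_list y b)"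
      using assms count_list_zip_marginals(2)[of u y b] by (simp add: comp_class_def flip: of_nat_sum)
    finally show ?thesis .
  qed
  have "real l * emp_info l p W u y = (\<Sum>a\<in>UNIV. \<Sum>b\<in>UNIV. real (?N (a, b)) * ln (?V a b / (real (count_list y b) / real l)))"
    unfolding emp_info_def mi_ch_def out unfolding p_times_emp_channel[OF assms] sum_distrib_left
    using l by (intro sum.cong refl) (simp add: plog_def)
  also have "\<dots> = (\<Sum>x\<in>UNIV. real (?N x) * ln (?V (fst x) (snd x) / (real (count_list y (snd x)) / real l)))"
    by (simp add: UNIV_Times_UNIV[symmetric] sum.cartesian_product' del: UNIV_Times_UNIV)
  also have "\<dots> = sum_list (map (\<lambda>x. ln (?V (fst x) (snd x) / (real (count_list y (snd x)) / real l))) (zip u y))"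
    by (rule sum_list_map_eq_sum_count_real[symmetric])
  finally show ?thesis by (simp add: split_def)
qed

text \<open>Bayes' rule for the joint type: input law times forward conditional type, divided by
  output type, is the backward conditional type. For frozen counts the right side is a channel from
  \<open>y\<close> to \<open>u\<close>, so it can be summed over \<open>u\<close>.\<close>

lemma prod_exp_emp_info:
  assumes "u \<in> comp_class l p" "length y = l"
  shows "prod_list (map p u) * exp (real l * emp_info l p W u y)
    = prod_list (map2 (\<lambda>a b. real (count_list (zip u y) (a, b)) / real (count_list y b)) u y)"
proof -
  let ?N = "count_list (zip u y)"
  have len: "length u = length y" using assms by (simp add: comp_class_def)
  have "prod_list (map p u) * exp (real l * emp_info l p W u y)
    = prod_list (map (\<lambda>x. p (fst x) * exp (case x of (a, b) \<Rightarrow>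
        ln (emp_channel l p W ?N a b / (real (count_list y b) / real l)))) (zip u y))"
    unfolding emp_info_eq[OF assms] exp_sum_list prod_list_fst_zip[OF len] prod_list_mult_map by simp
  also have "\<dots> = prod_list (map2 (\<lambda>a b. real (?N (a, b)) / real (count_list y b)) u y)"
  proof (rule prod_list_cong_map)
    fix x assume x: "x \<in> set (zip u y)"
    obtain a b where ab: "x = (a, b)" by (cases x)
    note pos = pos_of_mem[OF assms x[unfolded ab]]
    have "exp (ln (emp_channel l p W ?N a b / (real (count_list y b) / real l))) = emp_channel l p W ?N a b / (real (count_list y b) / real l)"
      using pos l by (intro exp_ln) auto
    then show "p (fst x) * exp (case x of (a, b) \<Rightarrow> ln (emp_channel l p W ?N a b / (real (count_list y b) / real l)))
       = (case x of (a, b) \<Rightarrow> real (?N (a, b)) / real (count_list y b))"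
      using pos l by (simp add: ab emp_channel_def)
  qed
  finally show ?thesis .
qed

text \<open>\<open>real_of_ereal\<close> is faithful only for finite values. Finite divergence of
  \<open>V\<close> bounds \<open>Er\<close> from above; non-negative divergence, from
  \<open>v * ln (v / w) \<ge> v - w\<close>, bounds it from below.\<close>

lemma Er_le:
  assumes "\<And>u. is_pmf (V u)" "cdiv V W p = ereal d"
  shows "real_of_ereal (Er R p W) \<le> d + max (mi_ch p V - R) 0"
proof -
  have dterm_ge: "ereal (v - w) \<le> dterm v w" if "0 \<le> v" "0 \<le> w" for v w
  proof (cases "v = 0 \<or> w = 0")
    case True
    then show ?thesis using that by (auto simp: dterm_def)
  next
    case False
    then have "0 < v" "0 < w" using that by auto
    then have "ln (w / v) \<le> w / v - 1" by (intro ln_le_minus_one) simp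
    then have "v * (1 - w / v) \<le> v * ln (v / w)"
      using \<open>0 < v\<close> \<open>0 < w\<close> by (intro mult_left_mono) (auto simp: ln_div)
    then show ?thesis using \<open>0 < v\<close> False by (simp add: dterm_def right_diff_distrib)
  qed
  have cdiv0: "0 \<le> cdiv V' W p" if V': "\<And>u. is_pmf (V' u)" for V'
    unfolding cdiv_def
  proof (intro sum_nonneg)
    fix u
    have "(\<Sum>y\<in>UNIV. V' u y - W u y) = 0" using V'[of u] W[of u] by (simp add: is_pmf_def sum_subtractf)
    then have "0 = (\<Sum>y\<in>UNIV. ereal (V' u y - W u y))" by simp
    also have "\<dots> \<le> (\<Sum>y\<in>UNIV. dterm (V' u y) (W u y))"
      using V'[of u] W[of u] by (intro sum_mono dterm_ge) (auto simp: is_pmf_def)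
    finally show "0 \<le> ereal (p u) * (\<Sum>y\<in>UNIV. dterm (V' u y) (W u y))"
      using p_nonneg by simp
  qed
  let ?S = "{cdiv V W p + ereal (max (mi_ch p V - R) 0) | V. \<forall>u. is_pmf (V u)}"
  have "Inf ?S \<le> cdiv V W p + ereal (max (mi_ch p V - R) 0)"
    using assms(1) by (intro Inf_lower) auto
  then have le: "Er R p W \<le> ereal (d + max (mi_ch p V - R) 0)"
    by (simp only: Er_def assms(2) plus_ereal.simps)
  have "0 \<le> ereal (max x 0)" for x :: real by (simp del: ereal_max)
  then have "0 \<le> Inf ?S" using cdiv0 by (intro Inf_greatest) (auto intro!: add_nonneg_nonneg simp del: ereal_max)
  then have "0 \<le> Er R p W" by (simp add: Er_def)
  then show ?thesis using le by (cases "Er R p W") auto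
qed

text \<open>For the conditional type \<open>V\<close> the likelihood under \<open>W\<close> is the
  one under \<open>V\<close> times \<open>exp (- l * D)\<close>, where \<open>D\<close> is the
  divergence of \<open>V\<close> from \<open>W\<close>. As \<open>V\<close> competes in the infimum
  defining \<open>Er\<close>, \<open>D\<close> plus the positive part of information minus
  \<open>R\<close> is at least \<open>Er\<close>. A positive likelihood makes \<open>D\<close>
  finite.\<close>

lemma likelihood_le:
  assumes "u \<in> comp_class l p" "length y = l"
  shows "prod_list (map2 W u y) * exp (- (real l * max (emp_info l p W u y - R) 0))
    \<le> exp (- (real l * real_of_ereal (Er R p W))) * prod_list (map2 (emp_channel l p W (count_list (zip u y))) u y)"
proof (cases "prod_list (map2 W u y) = 0")
  case True
  then show ?thesis by (auto intro!: mult_nonneg_nonneg prod_list_nonneg_map emp_channel_nonneg)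
next
  case False
  let ?N = "count_list (zip u y)"
  let ?V = "emp_channel l p W ?N"
  have Wpos: "0 < W a b" if "(a, b) \<in> set (zip u y)" for a b
    using False that W_nonneg[of a b] unfolding prod_list_eq_0_map by (auto simp: less_le)
  define d where "d = (\<Sum>a\<in>UNIV. \<Sum>b\<in>UNIV. real (?N (a, b)) / real l * ln (?V a b / W a b))"
  have "cdiv ?V W p = ereal d"
  proof -
    have "ereal (p a) * (\<Sum>b\<in>UNIV. dterm (?V a b) (W a b)) = ereal (\<Sum>b\<in>UNIV. real (?N (a, b)) / real l * ln (?V a b / W a b))" for a
    proof (cases "p a = 0")
      case True
      then have "?N (a, b) = 0" for b using p_times_emp_channel[OF assms, of a b] l by simp
      with True show ?thesis by (simp flip: zero_ereal_def)
    next
      case False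
      have "dterm (?V a b) (W a b) = ereal (?V a b * ln (?V a b / W a b))" for b
      proof (cases "?V a b = 0")
        case False2: False
        then have "?N (a, b) \<noteq> 0" using False by (auto simp: emp_channel_def)
        then have "(a, b) \<in> set (zip u y)" by (simp add: count_list_0_iff)
        then show ?thesis using Wpos False2 by (simp add: dterm_def less_imp_neq[symmetric])
      qed (simp add: dterm_def)
      then have "ereal (p a) * (\<Sum>b\<in>UNIV. dterm (?V a b) (W a b)) = ereal (\<Sum>b\<in>UNIV. (p a * ?V a b) * ln (?V a b / W a b))"
        by (simp add: sum_distrib_left mult.assoc)
      then show ?thesis unfolding p_times_emp_channel[OF assms] .
    qed
    then show ?thesis by (simp add: cdiv_def d_def)
  qed
  from Er_le[OF emp_channel_pmf[OF assms] this, of R]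
  have E: "real_of_ereal (Er R p W) \<le> d + max (emp_info l p W u y - R) 0" by (simp add: emp_info_def)
  have ld: "real l * d = sum_list (map (\<lambda>(a, b). ln (?V a b / W a b)) (zip u y))"
  proof -
    have "real l * d = (\<Sum>x\<in>UNIV. real (?N x) * ln (?V (fst x) (snd x) / W (fst x) (snd x)))"
      unfolding d_def using l by (simp add: sum_distrib_left UNIV_Times_UNIV[symmetric] sum.cartesian_product' del: UNIV_Times_UNIV)
    also have "\<dots> = sum_list (map (\<lambda>x. ln (?V (fst x) (snd x) / W (fst x) (snd x))) (zip u y))"
      by (rule sum_list_map_eq_sum_count_real[symmetric])
    finally show ?thesis by (simp add: split_def)
  qed
  have "prod_list (map2 W u y) * exp (real l * d) = prod_list (map2 ?V u y)"
    unfolding ld exp_sum_list prod_list_mult_map[symmetric]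
  proof (rule prod_list_cong_map)
    fix x assume x: "x \<in> set (zip u y)"
    obtain a b where ab: "x = (a, b)" by (cases x)
    note pos = pos_of_mem[OF assms x[unfolded ab]] Wpos[OF x[unfolded ab]]
    then have "exp (ln (?V a b / W a b)) = ?V a b / W a b" by (intro exp_ln) auto
    then show "(case x of (a, b) \<Rightarrow> W a b) * exp (case x of (a, b) \<Rightarrow> ln (?V a b / W a b)) = (case x of (a, b) \<Rightarrow> ?V a b)"
      using pos by (simp add: ab)
  qed
  then have "prod_list (map2 ?V u y) * exp (- (real l * real_of_ereal (Er R p W)))
    = prod_list (map2 W u y) * (exp (real l * d) * exp (- (real l * real_of_ereal (Er R p W))))"
    by (metis mult.assoc)
  also have "\<dots> \<ge> prod_list (map2 W u y) * exp (- (real l * max (emp_info l p W u y - R) 0))"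
  proof (intro mult_left_mono prod_list_nonneg_map)
    have "real l * real_of_ereal (Er R p W) \<le> real l * (d + max (emp_info l p W u y - R) 0)"
      using E by (intro mult_left_mono) auto
    then have "- (real l * max (emp_info l p W u y - R) 0) \<le> real l * d + - (real l * real_of_ereal (Er R p W))"
      by (simp add: distrib_left)
    then show "exp (- (real l * max (emp_info l p W u y - R) 0)) \<le> exp (real l * d) * exp (- (real l * real_of_ereal (Er R p W)))"
      unfolding exp_add[symmetric] by simp
  qed (auto simp: W_nonneg)
  finally show ?thesis by (simp add: mult.commute)
qed

text \<open>The likelihood under the conditional type of its own argument is not normalised in
  \<open>y\<close>, but for each frozen type it is. Summing over joint types costs the
  polynomial.\<close>

lemma sum_likelihood_le:
  assumes "u \<in> comp_class l p"
  shows "(\<Sum>y\<in>Len l. prod_list (map2 W u y) * exp (- (real l * max (emp_info l p W u y - R) 0)))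
    \<le> (real l + 1) ^ (CARD('u) * CARD('y)) * exp (- (real l * real_of_ereal (Er R p W)))"
proof -
  have len: "length u = l" using assms by (simp add: comp_class_def)
  have "(\<Sum>y\<in>Len l. prod_list (map2 W u y) * exp (- (real l * max (emp_info l p W u y - R) 0)))
     \<le> (\<Sum>y\<in>Len l. exp (- (real l * real_of_ereal (Er R p W))) * prod_list (map2 (emp_channel l p W (count_list (zip u y))) u y))"
    using assms by (intro sum_mono likelihood_le) auto
  also have "\<dots> = exp (- (real l * real_of_ereal (Er R p W))) * (\<Sum>y\<in>Len l. prod_list (map2 (emp_channel l p W (count_list (zip u y))) u y))"
    by (simp add: sum_distrib_left)
  also have "(\<Sum>y\<in>Len l. prod_list (map2 (emp_channel l p W (count_list (zip u y))) u y)) \<le> (real l + 1) ^ CARD('u \<times> 'y)"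
  proof (rule sum_over_types_le[where f = "\<lambda>N y. prod_list (map2 (emp_channel l p W N) u y)" and g = "\<lambda>y. zip u y" and S = "Len l"])
    fix y0 :: "'y list" assume "y0 \<in> Len l"
    then have V: "is_pmf (emp_channel l p W (count_list (zip u y0)) a)" for a
      using assms by (intro emp_channel_pmf) auto
    have "(\<Sum>y\<in>Len l. prod_list (map2 (emp_channel l p W (count_list (zip u y0))) u y)) = prod_list (map (\<lambda>_. 1) u)"
      using V unfolding len[symmetric] sum_Len_kernel is_pmf_def by simp
    then show "(\<Sum>y\<in>Len l. prod_list (map2 (emp_channel l p W (count_list (zip u y0))) u y)) \<le> 1"
      by (simp add: prod_list_const_map)
  qed (auto simp: len intro!: prod_list_nonneg_map emp_channel_nonneg)
  finally show ?thesis by (simp add: mult.commute)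
qed

text \<open>How likely an independent codeword looks at least as good as level \<open>t\<close>. The
  uniform law is replaced by the i.i.d. law, the indicator by \<open>exp (l * (I - t))\<close> with
  \<open>I\<close> the empirical information, and \<open>prod_exp_emp_info\<close> leaves backward
  channels, one for each joint type.\<close>

lemma collision_prob_le:
  assumes "is_type l p" "length y = l"
  shows "(\<Sum>u'\<in>comp_class l p. 1 / real (card (comp_class l p)) * of_bool (t \<le> emp_info l p W u' y))
    \<le> (real l + 1) ^ (2 * CARD('u) + CARD('u) * CARD('y)) * exp (- (real l * t))"
proof -
  let ?T = "comp_class l p"
  note T = comp_class_prob[OF p assms(1) l]
  have "(\<Sum>u'\<in>?T. 1 / real (card ?T) * of_bool (t \<le> emp_info l p W u' y))
    \<le> (\<Sum>u'\<in>?T. (real l + 1) ^ (2 * CARD('u)) * exp (- (real l * t)) *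
        prod_list (map2 (\<lambda>a b. real (count_list (zip u' y) (a, b)) / real (count_list y b)) u' y))"
  proof (rule sum_mono)
    fix u' assume u': "u' \<in> ?T"
    have "of_bool (t \<le> emp_info l p W u' y) \<le> exp (- (real l * t)) * exp (real l * emp_info l p W u' y)"
      unfolding exp_add[symmetric] using l by (auto simp: of_bool_def)
    then have "1 / real (card ?T) * of_bool (t \<le> emp_info l p W u' y)
      \<le> ((real l + 1) ^ (2 * CARD('u)) * prod_list (map p u')) * (exp (- (real l * t)) * exp (real l * emp_info l p W u' y))"
      using T(3)[OF u'] by (intro mult_mono) (auto intro!: mult_nonneg_nonneg prod_list_nonneg_map p_nonneg)
    also have "\<dots> = (real l + 1) ^ (2 * CARD('u)) * exp (- (real l * t)) * (prod_list (map p u') * exp (real l * emp_info l p W u' y))"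
      by (simp only: mult_ac)
    finally show "1 / real (card ?T) * of_bool (t \<le> emp_info l p W u' y) \<le> (real l + 1) ^ (2 * CARD('u)) * exp (- (real l * t)) *
        prod_list (map2 (\<lambda>a b. real (count_list (zip u' y) (a, b)) / real (count_list y b)) u' y)"
      unfolding prod_exp_emp_info[OF u' assms(2)] .
  qed
  also have "\<dots> = (real l + 1) ^ (2 * CARD('u)) * exp (- (real l * t)) *
     (\<Sum>u'\<in>?T. prod_list (map2 (\<lambda>a b. real (count_list (zip u' y) (a, b)) / real (count_list y b)) u' y))"
    by (simp only: sum_distrib_left)
  also have "\<dots> \<le> (real l + 1) ^ (2 * CARD('u)) * exp (- (real l * t)) * (real l + 1) ^ CARD('u \<times> 'y)"
  proof (intro mult_left_mono)
    show "(\<Sum>u'\<in>?T. prod_list (map2 (\<lambda>a b. real (count_list (zip u' y) (a, b)) / real (count_list y b)) u' y)) \<le> (real l + 1) ^ CARD('u \<times> 'y)"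
    proof (rule sum_over_types_le[where f = "\<lambda>N u'. prod_list (map2 (\<lambda>a b. real (N (a, b)) / real (count_list y b)) u' y)" and g = "\<lambda>u'. zip u' y"])
      fix u0 assume u0: "u0 \<in> ?T"
      have swap: "prod_list (map2 f u y') = prod_list (map2 (\<lambda>b a. f a b) y' u)" for f :: "'u \<Rightarrow> 'y \<Rightarrow> real" and u y'
        by (induction u arbitrary: y') (auto, case_tac y', auto)
      have le1: "(\<Sum>a\<in>UNIV. real (count_list (zip u0 y) (a, b)) / real (count_list y b)) \<le> 1" for b
      proof -
        have "(\<Sum>a\<in>UNIV. real (count_list (zip u0 y) (a, b))) = real (count_list y b)"
          using u0 assms count_list_zip_marginals(2)[of u0 y b] by (simp add: comp_class_def flip: of_nat_sum)
        then show ?thesis by (simp add: sum_divide_distrib[symmetric])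
      qed
      have "(\<Sum>u'\<in>?T. prod_list (map2 (\<lambda>a b. real (count_list (zip u0 y) (a, b)) / real (count_list y b)) u' y))
        \<le> (\<Sum>u'\<in>Len (length y). prod_list (map2 (\<lambda>b a. real (count_list (zip u0 y) (a, b)) / real (count_list y b)) y u'))"
        unfolding swap using assms by (intro sum_mono2) (auto simp: comp_class_def intro!: prod_list_nonneg_map)
      also have "\<dots> = prod_list (map (\<lambda>b. \<Sum>a\<in>UNIV. real (count_list (zip u0 y) (a, b)) / real (count_list y b)) y)"
        by (rule sum_Len_kernel)
      also have "\<dots> \<le> 1 ^ length y"
        by (intro prod_list_le_power_map conjI le1 sum_nonneg) auto
      finally show "(\<Sum>u'\<in>?T. prod_list (map2 (\<lambda>a b. real (count_list (zip u0 y) (a, b)) / real (count_list y b)) u' y)) \<le> 1" by simp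
    qed (use T assms in \<open>auto simp: comp_class_def intro!: prod_list_nonneg_map\<close>)
  qed auto
  finally show ?thesis by (simp add: power_add mult_ac)
qed


text \<open>Random coding over the type class with maximum empirical information decoding. Only the
  error averaged over \<open>P\<close> is controlled, and several \<open>s\<close> may share an
  index; the key code needs just this, as binned key blocks carry the law of the source. Assumption
  \<open>M\<close> hides the polynomial of the union bound in the rate \<open>R\<close>.\<close>

lemma constant_composition_code:
  fixes P :: "'s \<Rightarrow> real" and a :: "'s \<Rightarrow> nat"
  assumes "is_type l p" "finite S" "\<And>s. 0 \<le> P s" "(\<Sum>s\<in>S. P s) \<le> 1" "\<And>s. s \<in> S \<Longrightarrow> a s < M"
    and M: "real M * (real l + 1) ^ (2 * CARD('u) + CARD('u) * CARD('y)) \<le> exp (real l * R)"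
  shows "\<exists>C (dec :: 'y list \<Rightarrow> nat). (\<forall>i<M. C i \<in> comp_class l p) \<and>
    (\<Sum>s\<in>S. P s * (\<Sum>y\<in>Len l. prod_list (map2 W (C (a s)) y) * of_bool (dec y \<noteq> a s)))
      \<le> (real l + 1) ^ (CARD('u) * CARD('y)) * exp (- (real l * real_of_ereal (Er R p W)))"
proof -
  let ?T = "comp_class l p"
  let ?c = "1 / real (card ?T)"
  let ?e = "(real l + 1) ^ (CARD('u) * CARD('y)) * exp (- (real l * real_of_ereal (Er R p W)))"
  let ?I = "emp_info l p W"
  note T = comp_class_prob[OF p assms(1) l]
  define CC where "CC = (\<Pi>\<^sub>E i\<in>{..<M}. ?T)"
  define w where "w = (\<lambda>C :: nat \<Rightarrow> 'u list. \<Prod>i<M. ?c)"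
  have R1: "(\<Sum>z\<in>?T. ?c) = 1" using T(1,2) by simp
  have finC: "finite CC" unfolding CC_def using T by (auto intro: finite_PiE)
  have w0: "0 \<le> w C" for C by (simp add: w_def)
  have w1: "(\<Sum>C\<in>CC. w C) = 1"
    unfolding CC_def w_def using codebook_total[OF finite_lessThan T(1) R1, of M] by simp
  have one: "(\<Sum>C\<in>CC. w C * F (C i)) = (\<Sum>z\<in>?T. ?c * F z)" if "i < M" for i and F :: "'u list \<Rightarrow> real"
    unfolding CC_def w_def using codebook_one[OF finite_lessThan T(1) R1, of i M F] that by simp
  have two: "(\<Sum>C\<in>CC. w C * F (C i) (C j)) = (\<Sum>z\<in>?T. \<Sum>z'\<in>?T. ?c * ?c * F z z')"
    if "i < M" "j < M" "i \<noteq> j" for i j and F :: "'u list \<Rightarrow> 'u list \<Rightarrow> real"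
    unfolding CC_def w_def using codebook_two[OF finite_lessThan T(1) R1, of i M j F] that by simp
  \<comment> \<open>A tie counts as bad, so at most one index is not bad and \<open>dec\<close>
    finds it. The collision bound covers the non-strict inequality.\<close>
  define bad where "bad = (\<lambda>C i y. \<exists>j<M. j \<noteq> i \<and> ?I (C i) y \<le> ?I (C j) y)"
  define dec where "dec = (\<lambda>C y. SOME i. i < M \<and> \<not> bad C i y)"
  have dec: "dec C y = i" if "i < M" "\<not> bad C i y" for C i y
    unfolding dec_def
  proof (rule some_equality)
    show "i < M \<and> \<not> bad C i y" using that by simp
    fix k assume k: "k < M \<and> \<not> bad C k y"
    show "k = i"
    proof (rule ccontr)
      assume "k \<noteq> i"
      then have "\<not> ?I (C i) y \<le> ?I (C k) y" "\<not> ?I (C k) y \<le> ?I (C i) y"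
        using that k unfolding bad_def by blast+
      then show False by linarith
    qed
  qed
  have avg: "(\<Sum>C\<in>CC. w C * (\<Sum>y\<in>Len l. prod_list (map2 W (C i) y) * of_bool (dec C y \<noteq> i))) \<le> ?e" if i: "i < M" for i
  proof -
    have Wn: "0 \<le> prod_list (map2 W u y)" for u y by (auto intro!: prod_list_nonneg_map W_nonneg)
    \<comment> \<open>The factor \<open>of_bool (C i = u)\<close> fixes the transmitted codeword
      before the union bound is taken, since the bound depends on \<open>u\<close> and
      \<open>y\<close>. The smaller of the trivial estimate \<open>b1\<close> and the union bound
      \<open>b2\<close> produces the positive part in \<open>Er\<close>.\<close>
    have inner: "(\<Sum>C\<in>CC. w C * (of_bool (C i = u) * of_bool (bad C i y)))
       \<le> ?c * exp (- (real l * max (?I u y - R) 0))" if u: "u \<in> ?T" and y: "length y = l" for u y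
    proof -
      have b1: "(\<Sum>C\<in>CC. w C * (of_bool (C i = u) * of_bool (bad C i y))) \<le> ?c"
      proof -
        have "(\<Sum>C\<in>CC. w C * (of_bool (C i = u) * of_bool (bad C i y))) \<le> (\<Sum>C\<in>CC. w C * of_bool (C i = u))"
          using w0 by (intro sum_mono mult_left_mono) auto
        also have "\<dots> = (\<Sum>z\<in>?T. ?c * of_bool (z = u))" by (rule one[OF i, of "\<lambda>z. of_bool (z = u)"])
        also have "\<dots> = (\<Sum>z\<in>?T. if z = u then ?c else 0)" by (intro sum.cong) auto
        also have "\<dots> = ?c" using u T(1) by (simp add: sum.delta')
        finally show ?thesis .
      qed
      have "(\<Sum>C\<in>CC. w C * (of_bool (C i = u) * of_bool (bad C i y)))
         \<le> (\<Sum>C\<in>CC. w C * (\<Sum>j\<in>{..<M}-{i}. of_bool (C i = u) * of_bool (?I u y \<le> ?I (C j) y)))"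
      proof (intro sum_mono mult_left_mono w0)
        fix C
        show "of_bool (C i = u) * of_bool (bad C i y) \<le> (\<Sum>j\<in>{..<M}-{i}. of_bool (C i = u) * of_bool (?I u y \<le> ?I (C j) y) :: real)"
        proof (cases "C i = u \<and> bad C i y")
          case True
          then obtain j where j: "j < M" "j \<noteq> i" "?I u y \<le> ?I (C j) y" by (auto simp: bad_def)
          have "of_bool (C i = u) * of_bool (bad C i y) = (of_bool (C i = u) * of_bool (?I u y \<le> ?I (C j) y) :: real)"
            using True j by simp
          also have "\<dots> \<le> (\<Sum>j\<in>{..<M}-{i}. of_bool (C i = u) * of_bool (?I u y \<le> ?I (C j) y))"
            using j by (intro member_le_sum[where f = "\<lambda>j. of_bool (C i = u) * of_bool (?I u y \<le> ?I (C j) y)"]) auto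
          finally show ?thesis .
        qed (auto intro!: sum_nonneg)
      qed
      also have "\<dots> = (\<Sum>j\<in>{..<M}-{i}. \<Sum>C\<in>CC. w C * (of_bool (C i = u) * of_bool (?I u y \<le> ?I (C j) y)))"
        unfolding sum_distrib_left by (rule sum.swap)
      also have "\<dots> = (\<Sum>j\<in>{..<M}-{i}. \<Sum>z\<in>?T. \<Sum>z'\<in>?T. ?c * ?c * (of_bool (z = u) * of_bool (?I u y \<le> ?I z' y)))"
        using i by (intro sum.cong refl two[where F = "\<lambda>z z'. of_bool (z = u) * of_bool (?I u y \<le> ?I z' y)"]) auto
      also have "\<dots> = (\<Sum>j\<in>{..<M}-{i}. \<Sum>z\<in>?T. if z = u then ?c * (\<Sum>z'\<in>?T. ?c * of_bool (?I u y \<le> ?I z' y)) else 0)"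
        by (intro sum.cong refl) (auto simp: sum_distrib_left mult.assoc)
      also have "\<dots> = (\<Sum>j\<in>{..<M}-{i}. ?c * (\<Sum>z'\<in>?T. ?c * of_bool (?I u y \<le> ?I z' y)))"
        using u T(1) by (simp add: sum.delta')
      also have "\<dots> = real (card ({..<M}-{i})) * (?c * (\<Sum>z'\<in>?T. ?c * of_bool (?I u y \<le> ?I z' y)))" by simp
      also have "\<dots> \<le> real M * (?c * ((real l + 1) ^ (2 * CARD('u) + CARD('u) * CARD('y)) * exp (- (real l * ?I u y))))"
      proof (intro mult_mono collision_prob_le assms(1) y)
        have "card ({..<M}-{i}) \<le> card {..<M}" by (intro card_mono) auto
        then show "real (card ({..<M}-{i})) \<le> real M" by simp
      qed (auto intro!: sum_nonneg divide_nonneg_nonneg)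
      also have "\<dots> = ?c * ((real M * (real l + 1) ^ (2 * CARD('u) + CARD('u) * CARD('y))) * exp (- (real l * ?I u y)))"
        by (simp only: mult_ac)
      also have "\<dots> \<le> ?c * (exp (real l * R) * exp (- (real l * ?I u y)))"
        by (intro mult_left_mono mult_right_mono M) auto
      also have "\<dots> = ?c * exp (- (real l * (?I u y - R)))"
        unfolding exp_add[symmetric] by (simp add: algebra_simps)
      finally have b2: "(\<Sum>C\<in>CC. w C * (of_bool (C i = u) * of_bool (bad C i y))) \<le> ?c * exp (- (real l * (?I u y - R)))" .
      show ?thesis
      proof (cases "0 \<le> ?I u y - R")
        case True
        then show ?thesis using b2 by simp
      next
        case False
        then show ?thesis using b1 by simp
      qed
    qed
    have "(\<Sum>C\<in>CC. w C * (\<Sum>y\<in>Len l. prod_list (map2 W (C i) y) * of_bool (dec C y \<noteq> i)))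
       \<le> (\<Sum>C\<in>CC. w C * (\<Sum>y\<in>Len l. \<Sum>u\<in>?T. prod_list (map2 W u y) * (of_bool (C i = u) * of_bool (bad C i y))))"
    proof (intro sum_mono mult_left_mono w0)
      fix C y assume "C \<in> CC"
      then have "C i \<in> ?T" using i by (auto simp: CC_def)
      have "(\<Sum>u\<in>?T. prod_list (map2 W u y) * (of_bool (C i = u) * of_bool (bad C i y)))
        = (\<Sum>u\<in>?T. if C i = u then prod_list (map2 W u y) * of_bool (bad C i y) else 0)"
        by (intro sum.cong) auto
      also have "\<dots> = prod_list (map2 W (C i) y) * of_bool (bad C i y)"
        using \<open>C i \<in> ?T\<close> T(1) by (simp add: sum.delta)
      finally show "prod_list (map2 W (C i) y) * of_bool (dec C y \<noteq> i) \<le> (\<Sum>u\<in>?T. prod_list (map2 W u y) * (of_bool (C i = u) * of_bool (bad C i y)))"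
        using dec[OF i, of C y] Wn[of "C i" y] by (auto simp: of_bool_def)
    qed
    also have "\<dots> = (\<Sum>u\<in>?T. \<Sum>y\<in>Len l. prod_list (map2 W u y) * (\<Sum>C\<in>CC. w C * (of_bool (C i = u) * of_bool (bad C i y))))"
      unfolding sum_distrib_left
      apply (subst sum.swap[of _ "Len l" CC])
      apply (subst sum.swap[of _ ?T CC])
      apply (subst sum.swap[of _ ?T "Len l"])
      apply (simp only: mult_ac)
      done
    also have "\<dots> \<le> (\<Sum>u\<in>?T. \<Sum>y\<in>Len l. prod_list (map2 W u y) * (?c * exp (- (real l * max (?I u y - R) 0))))"
      using Wn by (intro sum_mono mult_left_mono inner) auto
    also have "\<dots> = (\<Sum>u\<in>?T. ?c * (\<Sum>y\<in>Len l. prod_list (map2 W u y) * exp (- (real l * max (?I u y - R) 0))))"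
      unfolding sum_distrib_left by (simp only: mult_ac)
    also have "\<dots> \<le> (\<Sum>u\<in>?T. ?c * ?e)"
      by (intro sum_mono mult_left_mono sum_likelihood_le) auto
    also have "\<dots> = ?e" using R1 by (simp only: sum_distrib_right[symmetric] mult_1_left)
    finally show ?thesis .
  qed
  have "(\<Sum>C\<in>CC. w C * (\<Sum>s\<in>S. P s * (\<Sum>y\<in>Len l. prod_list (map2 W (C (a s)) y) * of_bool (dec C y \<noteq> a s))))
    = (\<Sum>s\<in>S. P s * (\<Sum>C\<in>CC. w C * (\<Sum>y\<in>Len l. prod_list (map2 W (C (a s)) y) * of_bool (dec C y \<noteq> a s))))"
    unfolding sum_distrib_left[of _ _ S] sum_distrib_left[of _ _ CC]
    by (subst sum.swap) (simp only: mult.left_commute)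
  also have "\<dots> \<le> (\<Sum>s\<in>S. P s * ?e)"
    using assms by (intro sum_mono mult_left_mono avg) auto
  also have "\<dots> \<le> 1 * ?e"
    unfolding sum_distrib_right[symmetric] using assms(4) by (intro mult_right_mono) auto
  finally have "\<exists>C\<in>CC. (\<Sum>s\<in>S. P s * (\<Sum>y\<in>Len l. prod_list (map2 W (C (a s)) y) * of_bool (dec C y \<noteq> a s))) \<le> ?e"
    using exists_le_average[OF finC w0 w1] by simp
  then obtain C where "C \<in> CC" "(\<Sum>s\<in>S. P s * (\<Sum>y\<in>Len l. prod_list (map2 W (C (a s)) y) * of_bool (dec C y \<noteq> a s))) \<le> ?e" by blast
  then show ?thesis by (intro exI[of _ C] exI[of _ "dec C"]) (auto simp: CC_def PiE_def Pi_def)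
qed

end

section \<open>Typical sequences\<close>

lemma sum_push:
  fixes P :: "'a::finite \<Rightarrow> real" and X :: "'a \<Rightarrow> 'b::finite"
  shows "(\<Sum>b\<in>UNIV. push P X b * g b) = (\<Sum>a\<in>UNIV. P a * g (X a))"
proof -
  have "(\<Sum>b\<in>UNIV. push P X b * g b) = (\<Sum>b\<in>UNIV. \<Sum>a\<in>UNIV. if X a = b then P a * g b else 0)"
    by (simp add: push_def sum_distrib_right sum.inter_filter[symmetric])
  also have "\<dots> = (\<Sum>a\<in>UNIV. P a * g (X a))"
    by (subst sum.swap) simp
  finally show ?thesis .
qed

text \<open>Hoeffding's lemma for a centred Bernoulli variable. Negative \<open>t\<close> reduces to
  positive \<open>t\<close> by exchanging \<open>p\<close> and \<open>1 - p\<close>.\<close>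

lemma bernoulli_mgf_le:
  fixes p t :: real
  assumes "0 \<le> p" "p \<le> 1"
  shows "p * exp (t * (1 - p)) + (1 - p) * exp (- t * p) \<le> exp (t\<^sup>2 / 8)"
proof -
  have *: "p * exp (t * (1 - p)) + (1 - p) * exp (- t * p) \<le> exp (t\<^sup>2 / 8)" if "0 \<le> p" "p \<le> 1" "0 \<le> t" for p t :: real
  proof -
    have "0 < 1 + p * (exp t - 1)"
      using that by (intro add_pos_nonneg mult_nonneg_nonneg) auto
    then have "p * exp (t * (1 - p)) + (1 - p) * exp (- t * p) = exp (- t * p + ln (1 + p * (exp t - 1)))"
      by (simp add: exp_add exp_diff algebra_simps exp_minus field_simps)
    also have "\<dots> \<le> exp (t\<^sup>2 / 8)"
      using Hoeffdings_lemma_aux[of t p] that by simp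
    finally show ?thesis .
  qed
  show ?thesis
  proof (cases "0 \<le> t")
    case False
    then show ?thesis using *[of "1 - p" "- t"] assms by (simp add: algebra_simps)
  qed (use * assms in auto)
qed

lemma count_tail_bound:
  fixes W :: "'a::finite \<Rightarrow> real" and B :: "'a \<Rightarrow> bool"
  assumes "is_pmf W" and q: "q = (\<Sum>x | B x. W x)" and "0 \<le> e"
  shows "(\<Sum>z\<in>Len l. prod_list (map W z) * of_bool (real l * e < \<bar>real (length (filter B z)) - real l * q\<bar>))
    \<le> 2 * exp (- 2 * real l * e\<^sup>2)"
proof -
  have W0: "0 \<le> W x" and W1: "(\<Sum>x\<in>UNIV. W x) = 1" for x using assms unfolding is_pmf_def by blast+
  have q01: "0 \<le> q" "q \<le> 1" unfolding q W1[symmetric] using W0 by (auto intro!: sum_nonneg sum_mono2)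
  have step: "(\<Sum>x\<in>UNIV. W x * exp (t * (of_bool (B x) - q))) \<le> exp (t\<^sup>2 / 8)" for t :: real
  proof -
    have "(\<Sum>x\<in>UNIV. W x * exp (t * (of_bool (B x) - q)))
       = (\<Sum>x\<in>UNIV. (if B x then W x * exp (t * (1 - q)) else 0) + (W x * exp (- t * q) - (if B x then W x * exp (- t * q) else 0)))"
      by (intro sum.cong) auto
    also have "\<dots> = (\<Sum>x | B x. W x * exp (t * (1 - q))) + ((\<Sum>x\<in>UNIV. W x * exp (- t * q)) - (\<Sum>x | B x. W x * exp (- t * q)))"
      by (simp add: sum.distrib sum_subtractf sum.inter_filter[symmetric])
    also have "\<dots> = q * exp (t * (1 - q)) + (1 - q) * exp (- t * q)"
      by (simp only: sum_distrib_right[symmetric] W1 q[symmetric]) (simp add: algebra_simps)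
    also have "\<dots> \<le> exp (t\<^sup>2 / 8)" using q01 by (rule bernoulli_mgf_le)
    finally show ?thesis .
  qed
  have expcount: "exp (t * (real (length (filter B z)) - real (length z) * q)) = prod_list (map (\<lambda>x. exp (t * (of_bool (B x) - q))) z)" for t z
  proof (induction z)
    case (Cons x z)
    have "t * (real (length (filter B (x # z))) - real (length (x # z)) * q)
      = t * (of_bool (B x) - q) + t * (real (length (filter B z)) - real (length z) * q)"
      by (simp add: algebra_simps)
    then show ?case by (simp only: exp_add Cons.IH list.map prod_list.Cons)
  qed simp
  have side: "(\<Sum>z\<in>Len l. prod_list (map W z) * of_bool (real l * e < s * (real (length (filter B z)) - real l * q)))
    \<le> exp (- 2 * real l * e\<^sup>2)" if "s = 1 \<or> s = - 1" for s :: real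
  proof -
    \<comment> \<open>The parameter \<open>4 * e\<close> minimises
      \<open>t\<^sup>2 / 8 - t * e\<close>, with value \<open>- 2 * e\<^sup>2\<close>; the sign
      \<open>s\<close> selects the tail.\<close>
    have "(\<Sum>z\<in>Len l. prod_list (map W z) * of_bool (real l * e < s * (real (length (filter B z)) - real l * q)))
      \<le> (\<Sum>z\<in>Len l. exp (- (4 * e) * (real l * e)) * prod_list (map (\<lambda>x. W x * exp (4 * e * s * (of_bool (B x) - q))) z))"
    proof (rule sum_mono)
      fix z :: "'a list" assume z: "z \<in> Len l"
      let ?X = "s * (real (length (filter B z)) - real l * q)"
      have "of_bool (real l * e < ?X) \<le> exp (4 * e * (?X - real l * e))"
        using \<open>0 \<le> e\<close> by (auto simp: of_bool_def)
      also have "\<dots> = exp (- (4 * e) * (real l * e)) * exp (4 * e * s * (real (length (filter B z)) - real (length z) * q))"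
        unfolding exp_add[symmetric] using z by (simp add: algebra_simps)
      finally have "of_bool (real l * e < ?X) \<le> exp (- (4 * e) * (real l * e)) * prod_list (map (\<lambda>x. exp (4 * e * s * (of_bool (B x) - q))) z)"
        unfolding expcount .
      then have "prod_list (map W z) * of_bool (real l * e < ?X) \<le> prod_list (map W z) * (exp (- (4 * e) * (real l * e)) * prod_list (map (\<lambda>x. exp (4 * e * s * (of_bool (B x) - q))) z))"
        by (intro mult_left_mono prod_list_nonneg_map W0)
      then show "prod_list (map W z) * of_bool (real l * e < ?X) \<le> exp (- (4 * e) * (real l * e)) * prod_list (map (\<lambda>x. W x * exp (4 * e * s * (of_bool (B x) - q))) z)"
        unfolding prod_list_mult_map by (simp only: mult_ac)
    qed
    also have "\<dots> = exp (- (4 * e) * (real l * e)) * (\<Sum>x\<in>UNIV. W x * exp (4 * e * s * (of_bool (B x) - q))) ^ l"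
      by (simp add: sum_distrib_left[symmetric] sum_Len_prod_list)
    also have "\<dots> \<le> exp (- (4 * e) * (real l * e)) * exp ((4 * e * s)\<^sup>2 / 8) ^ l"
      by (intro mult_left_mono power_mono step sum_nonneg) (auto simp: W0)
    also have "\<dots> = exp (- 2 * real l * e\<^sup>2)"
      using that by (auto simp: exp_of_nat_mult[symmetric] exp_add[symmetric] power2_eq_square)
    finally show ?thesis .
  qed
  have "(\<Sum>z\<in>Len l. prod_list (map W z) * of_bool (real l * e < \<bar>real (length (filter B z)) - real l * q\<bar>))
    \<le> (\<Sum>z\<in>Len l. prod_list (map W z) * of_bool (real l * e < 1 * (real (length (filter B z)) - real l * q))
       + prod_list (map W z) * of_bool (real l * e < - 1 * (real (length (filter B z)) - real l * q)))"
    by (intro sum_mono) (auto simp: of_bool_def abs_if prod_list_nonneg_map W0)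
  also have "\<dots> \<le> 2 * exp (- 2 * real l * e\<^sup>2)"
    using side[of 1] side[of "- 1"] by (simp add: sum.distrib)
  finally show ?thesis .
qed

text \<open>Robust typicality: the deviation is relative to \<open>p b\<close>. Symbols of
  probability zero are thereby excluded, and probabilities of typical sequences are controlled by
  the factor \<open>1 + \<delta>\<close> in front of the entropy.\<close>

definition typical_set :: "nat \<Rightarrow> real \<Rightarrow> ('k \<Rightarrow> real) \<Rightarrow> 'k list set" where
  "typical_set l \<delta> p = {k. length k = l \<and> (\<forall>b. \<bar>real (count_list k b) - real l * p b\<bar> \<le> real l * (\<delta> * p b))}"

lemma count_list_map: "count_list (map f z) b = length (filter (\<lambda>x. f x = b) z)"
  by (induction z) auto

text \<open>A union bound over symbols. For each symbol of positive probability the relative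
  deviation is at least \<delta> times the least positive probability; the other symbols occur with
  probability zero. The result is the shape of \<open>tau\<close>.\<close>

lemma atypical_prob_le:
  fixes W :: "'a::finite \<Rightarrow> real" and f :: "'a \<Rightarrow> 'k::finite"
  assumes "is_pmf W" "0 < \<delta>"
  shows "(\<Sum>z\<in>Len l. prod_list (map W z) * of_bool (map f z \<notin> typical_set l \<delta> (push W f)))
    \<le> 2 * real CARD('k) * exp (- 2 * \<delta>\<^sup>2 * (Min {push W f b | b. push W f b > 0})\<^sup>2 * real l)"
proof -
  let ?p = "push W f"
  let ?m = "Min {?p b | b. ?p b > 0}"
  have W0: "0 \<le> W x" and W1: "(\<Sum>x\<in>UNIV. W x) = 1" for x using assms unfolding is_pmf_def by blast+
  have P0: "0 \<le> prod_list (map W z)" for z by (intro prod_list_nonneg_map W0)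
  have fin: "finite {?p b | b. ?p b > 0}" by simp
  have p0: "0 \<le> ?p b" for b unfolding push_def by (intro sum_nonneg W0)
  have ne: "{?p b | b. ?p b > 0} \<noteq> {}"
  proof
    assume "{?p b | b. ?p b > 0} = {}"
    then have "?p b = 0" for b using p0[of b] by (auto simp: less_le)
    then show False using sum_push[of W f "\<lambda>_. 1"] W1 by simp
  qed
  have m0: "0 \<le> ?m" using Min_in[OF fin ne] by auto
  let ?A = "\<lambda>z b. of_bool (real l * (\<delta> * ?p b) < \<bar>real (length (filter (\<lambda>x. f x = b) z)) - real l * ?p b\<bar>) :: real"
  have "(\<Sum>z\<in>Len l. prod_list (map W z) * of_bool (map f z \<notin> typical_set l \<delta> ?p))
    \<le> (\<Sum>z\<in>Len l. prod_list (map W z) * (\<Sum>b\<in>UNIV. ?A z b))"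
  proof (intro sum_mono mult_left_mono P0)
    fix z :: "'a list" assume z: "z \<in> Len l"
    show "of_bool (map f z \<notin> typical_set l \<delta> ?p) \<le> (\<Sum>b\<in>UNIV. ?A z b)"
    proof (cases "map f z \<in> typical_set l \<delta> ?p")
      case False
      then obtain b where "\<not> \<bar>real (count_list (map f z) b) - real l * ?p b\<bar> \<le> real l * (\<delta> * ?p b)"
        using z by (auto simp: typical_set_def)
      then have "1 = ?A z b" by (simp add: count_list_map)
      also have "\<dots> \<le> (\<Sum>b\<in>UNIV. ?A z b)" by (intro member_le_sum[where f = "?A z"]) auto
      finally show ?thesis by simp
    qed (auto intro!: sum_nonneg)
  qed
  also have "\<dots> = (\<Sum>b\<in>UNIV. \<Sum>z\<in>Len l. prod_list (map W z) * ?A z b)"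
    unfolding sum_distrib_left by (rule sum.swap)
  also have "\<dots> \<le> (\<Sum>b\<in>(UNIV :: 'k set). 2 * exp (- 2 * \<delta>\<^sup>2 * ?m\<^sup>2 * real l))"
  proof (rule sum_mono)
    fix b :: 'k
    show "(\<Sum>z\<in>Len l. prod_list (map W z) * ?A z b) \<le> 2 * exp (- 2 * \<delta>\<^sup>2 * ?m\<^sup>2 * real l)"
    proof (cases "?p b > 0")
      case True
      have "(\<Sum>z\<in>Len l. prod_list (map W z) * ?A z b) \<le> 2 * exp (- 2 * real l * (\<delta> * ?p b)\<^sup>2)"
        using assms True by (intro count_tail_bound) (auto simp: push_def)
      also have "?m \<le> ?p b" using True fin by (intro Min_le) auto
      then have "real l * (\<delta> * ?m)\<^sup>2 \<le> real l * (\<delta> * ?p b)\<^sup>2"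
        using m0 assms by (intro mult_left_mono power_mono) auto
      then have "2 * exp (- 2 * real l * (\<delta> * ?p b)\<^sup>2) \<le> 2 * exp (- 2 * \<delta>\<^sup>2 * ?m\<^sup>2 * real l)"
        by (simp add: power_mult_distrib mult_ac)
      finally show ?thesis .
    next
      case False
      then have pb: "?p b = 0" using p0[of b] by simp
      then have W0': "W x = 0" if "f x = b" for x
        using that W0 unfolding push_def by (subst (asm) sum_nonneg_eq_0_iff) auto
      have zero: "prod_list (map W z) * ?A z b = 0" for z
      proof (cases "\<exists>x\<in>set z. f x = b")
        case True
        then have "prod_list (map W z) = 0" using W0' by (auto simp: prod_list_eq_0_map)
        then show ?thesis by simp
      next
        case False
        then have "filter (\<lambda>x. f x = b) z = []" by (simp add: filter_empty_conv)
        then show ?thesis using pb by simp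
      qed
      show ?thesis unfolding zero by simp
    qed
  qed
  also have "\<dots> = 2 * real CARD('k) * exp (- 2 * \<delta>\<^sup>2 * ?m\<^sup>2 * real l)" by simp
  finally show ?thesis .
qed

text \<open>In a typical sequence each count is at most \<open>(1 + \<delta>) * l * p b\<close>, and
  \<open>ln (p b)\<close> is non-positive, so its probability is at least
  \<open>exp (- l * (1 + \<delta>) * H)\<close> with \<open>H\<close> the entropy. Probabilities add
  up to at most one.\<close>

lemma card_typical_set_le:
  fixes W :: "'a::finite \<Rightarrow> real" and f :: "'a \<Rightarrow> 'k::finite"
  assumes "is_pmf W"
  shows "finite (typical_set l \<delta> (push W f))"
    "real (card (typical_set l \<delta> (push W f))) \<le> exp (real l * ((1 + \<delta>) * ent W f))"
proof -
  let ?p = "push W f"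
  let ?T = "typical_set l \<delta> ?p"
  have W0: "0 \<le> W x" and W1: "(\<Sum>x\<in>UNIV. W x) = 1" for x using assms unfolding is_pmf_def by blast+
  have p0: "0 \<le> ?p b" for b unfolding push_def by (intro sum_nonneg W0)
  have p1: "(\<Sum>b\<in>UNIV. ?p b) = 1" using sum_push[of W f "\<lambda>_. 1"] W1 by simp
  have ple: "?p b \<le> 1" for b using p0 p1 member_le_sum[of b UNIV ?p] by auto
  have sub: "?T \<subseteq> Len l" by (auto simp: typical_set_def)
  then show fin: "finite ?T" by (rule finite_subset) simp
  have H: "ent W f = - (\<Sum>b\<in>UNIV. ?p b * ln (?p b))"
  proof -
    have "(\<Sum>b\<in>f ` UNIV. plog (?p b) (?p b)) = (\<Sum>b\<in>UNIV. ?p b * ln (?p b))"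
    proof (rule sum.mono_neutral_cong_left)
      show "\<forall>i\<in>UNIV - f ` UNIV. ?p i * ln (?p i) = 0"
      proof
        fix b assume "b \<in> UNIV - f ` UNIV"
        then have "{a. f a = b} = {}" by auto
        then show "?p b * ln (?p b) = 0" by (simp add: push_def)
      qed
    qed (auto simp: plog_def)
    then show ?thesis by (simp add: ent_def)
  qed
  have lower: "exp (- (real l * ((1 + \<delta>) * ent W f))) \<le> prod_list (map ?p k)" if k: "k \<in> ?T" for k
  proof -
    have cnt: "\<bar>real (count_list k b) - real l * ?p b\<bar> \<le> real l * (\<delta> * ?p b)" for b
      using k by (simp add: typical_set_def)
    have pos: "0 < ?p b" if "b \<in> set k" for b
    proof (rule ccontr)
      assume "\<not> ?thesis"
      then have "?p b = 0" using p0[of b] by simp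
      then have "count_list k b = 0" using cnt[of b] by simp
      with that show False by (simp add: count_list_0_iff)
    qed
    have "- (real l * ((1 + \<delta>) * ent W f)) = (\<Sum>b\<in>UNIV. (real l * (1 + \<delta>) * ?p b) * ln (?p b))"
      by (simp add: H sum_distrib_left mult.assoc)
    also have "\<dots> \<le> (\<Sum>b\<in>UNIV. real (count_list k b) * ln (?p b))"
    proof (rule sum_mono)
      fix b
      show "(real l * (1 + \<delta>) * ?p b) * ln (?p b) \<le> real (count_list k b) * ln (?p b)"
      proof (rule mult_right_mono_neg)
        show "real (count_list k b) \<le> real l * (1 + \<delta>) * ?p b" using cnt[of b] by (simp add: algebra_simps)
        show "ln (?p b) \<le> 0" using p0[of b] ple[of b] by (cases "?p b = 0") auto
      qed
    qed
    also have "\<dots> = ln (prod_list (map ?p k))"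
      by (simp add: ln_prod_list_map pos sum_list_map_eq_sum_count_real)
    finally have "exp (- (real l * ((1 + \<delta>) * ent W f))) \<le> exp (ln (prod_list (map ?p k)))" by simp
    also have "\<dots> = prod_list (map ?p k)" using pos by (intro exp_ln prod_list_pos_map) auto
    finally show ?thesis .
  qed
  have "real (card ?T) * exp (- (real l * ((1 + \<delta>) * ent W f))) = (\<Sum>k\<in>?T. exp (- (real l * ((1 + \<delta>) * ent W f))))"
    by simp
  also have "\<dots> \<le> (\<Sum>k\<in>?T. prod_list (map ?p k))" by (intro sum_mono lower)
  also have "\<dots> \<le> (\<Sum>k\<in>Len l. prod_list (map ?p k))"
    using sub by (intro sum_mono2) (auto intro!: prod_list_nonneg_map p0)
  also have "\<dots> = 1" by (simp add: sum_Len_prod_list p1)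
  finally show "real (card ?T) \<le> exp (real l * ((1 + \<delta>) * ent W f))"
    by (simp only: exp_minus divide_inverse[symmetric] pos_divide_le_eq exp_gt_zero mult_1_left)
qed

section \<open>Block decoding metrics\<close>

text \<open>The conditional probability of a point given the value of \<open>X\<close> there.
  Entropies and informations become means of \<open>ln (cnd P X a)\<close>, the same shape as the
  mean log metric.\<close>

definition cnd :: "('a::finite \<Rightarrow> real) \<Rightarrow> ('a \<Rightarrow> 'b) \<Rightarrow> 'a \<Rightarrow> real" where
  "cnd P X a = P a / push P X (X a)"

lemma push_nonneg: "(\<And>a. 0 \<le> P a) \<Longrightarrow> 0 \<le> push P X b"
  unfolding push_def by (intro sum_nonneg)

lemma le_push: "(\<And>a. 0 \<le> P a) \<Longrightarrow> P a \<le> push P X (X a)"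
  unfolding push_def by (rule member_le_sum) auto

lemma cnd_nonneg: "(\<And>a. 0 \<le> P a) \<Longrightarrow> 0 \<le> cnd P X a"
  unfolding cnd_def by (intro divide_nonneg_nonneg push_nonneg)

lemma cnd_le_1: "(\<And>a. 0 \<le> P a) \<Longrightarrow> cnd P X a \<le> 1"
  using le_push[of P a X] push_nonneg[of P X "X a"] unfolding cnd_def
  by (cases "push P X (X a) = 0") (auto simp: divide_le_eq_1)

lemma cnd_pos: "(\<And>a. 0 \<le> P a) \<Longrightarrow> P a \<noteq> 0 \<Longrightarrow> 0 < cnd P X a"
  using le_push[of P a X] unfolding cnd_def by (intro divide_pos_pos) (metis less_le less_le_trans)+

lemma sum_cnd_le_1: "(\<And>a. 0 \<le> P a) \<Longrightarrow> (\<Sum>a | X a = b. cnd P X a) \<le> 1"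
proof -
  have "(\<Sum>a | X a = b. cnd P X a) = push P X b / push P X b"
    unfolding cnd_def by (simp add: push_def sum_divide_distrib[symmetric])
  then show ?thesis by (simp add: divide_self_if)
qed

lemma cent_eq_sum_cnd:
  assumes "inj (\<lambda>a. (X a, Z a))"
  shows "cent P X Z = - (\<Sum>a\<in>UNIV. P a * ln (cnd P Z a))"
proof -
  have "push P (\<lambda>a. (X a, Z a)) (X a, Z a) = P a" for a
  proof -
    have "{a'. (X a', Z a') = (X a, Z a)} = {a}" using assms by (auto simp: inj_def)
    then show ?thesis unfolding push_def by simp
  qed
  then show ?thesis
    unfolding cent_def by (subst sum.reindex[OF assms]) (auto simp: plog_def cnd_def intro!: sum.cong)
qed

text \<open>A Fano inequality for metrics. In the bad case \<open>T\<close> falls back from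
  \<open>(1 - \<phi>) * c\<close> to at least \<phi> \<open>/ N\<close>, at a log cost of at most
  \<open>- ?d\<close>, as \<open>ln c\<close> is non-positive. Charging this with probability \<phi>
  yields exactly \<open>hb \<phi> + \<phi> * ln N\<close>. The bound \<phi> \<open>< 1 / 2\<close>
  gives \<open>?d\<close> its sign, so the bad probability may be replaced by \<phi>.\<close>

lemma mean_ln_ge:
  fixes J T c :: "'z \<Rightarrow> real"
  assumes "finite A" and J0: "\<And>z. 0 \<le> J z" and J1: "(\<Sum>z\<in>A. J z) = 1"
    and phi: "0 < \<phi>" "\<phi> < 1 / 2" and N: "1 \<le> N"
    and bad: "(\<Sum>z\<in>A. J z * of_bool (\<not> Good z)) \<le> \<phi>"
    and good: "\<And>z. z \<in> A \<Longrightarrow> J z \<noteq> 0 \<Longrightarrow> Good z \<Longrightarrow> (1 - \<phi>) * c z \<le> T z"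
    and any: "\<And>z. z \<in> A \<Longrightarrow> J z \<noteq> 0 \<Longrightarrow> \<phi> / N \<le> T z"
    and c: "\<And>z. z \<in> A \<Longrightarrow> J z \<noteq> 0 \<Longrightarrow> 0 < c z \<and> c z \<le> 1"
  shows "- hb \<phi> - \<phi> * ln N + (\<Sum>z\<in>A. J z * ln (c z)) \<le> (\<Sum>z\<in>A. J z * ln (T z))"
proof -
  let ?d = "ln \<phi> - ln N - ln (1 - \<phi>)"
  have "ln \<phi> \<le> ln (1 - \<phi>)" using phi by simp
  then have d: "?d \<le> 0" using N ln_ge_zero[of N] by linarith
  have "(\<Sum>z\<in>A. J z * ln (c z)) + (ln (1 - \<phi>) + \<phi> * ?d)
     \<le> (\<Sum>z\<in>A. J z * ln (c z)) + (ln (1 - \<phi>) * (\<Sum>z\<in>A. J z) + (\<Sum>z\<in>A. J z * of_bool (\<not> Good z)) * ?d)"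
    using mult_right_mono_neg[OF bad d] by (simp add: J1)
  also have "\<dots> = (\<Sum>z\<in>A. J z * (ln (c z) + ln (1 - \<phi>) + of_bool (\<not> Good z) * ?d))"
    by (simp add: sum.distrib[symmetric] sum_distrib_left sum_distrib_right algebra_simps)
  also have "\<dots> \<le> (\<Sum>z\<in>A. J z * ln (T z))"
  proof (rule sum_mono)
    fix z assume z: "z \<in> A"
    show "J z * (ln (c z) + ln (1 - \<phi>) + of_bool (\<not> Good z) * ?d) \<le> J z * ln (T z)"
    proof (cases "J z = 0")
      case False
      note c' = c[OF z False]
      have "ln (c z) + ln (1 - \<phi>) + of_bool (\<not> Good z) * ?d \<le> ln (T z)"
      proof (cases "Good z")
        case True
        have "ln (c z) + ln (1 - \<phi>) = ln ((1 - \<phi>) * c z)" using c' phi by (simp add: ln_mult_pos)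
        also have "\<dots> \<le> ln (T z)" using good[OF z False True] c' phi by (intro ln_mono) auto
        finally show ?thesis using True by simp
      next
        case bad: False
        have "ln (\<phi> / N) \<le> ln (T z)" using any[OF z False] phi N by (intro ln_mono) auto
        moreover have "ln (\<phi> / N) = ln \<phi> - ln N" using phi N by (simp add: ln_div)
        moreover have "ln (c z) \<le> 0" using c' by simp
        ultimately show ?thesis using bad by simp
      qed
      then show ?thesis using J0 by (rule mult_left_mono)
    qed simp
  qed
  also have "ln (1 - \<phi>) + \<phi> * ?d = - hb \<phi> - \<phi> * ln N"
    using phi by (simp add: hb_def plog_def algebra_simps)
  finally show ?thesis by linarith
qed

lemma sum_block_law_split:
  "(\<Sum>z\<in>Len l. block_law W k C1 C2 z * F (map fst z) (map snd z))
    = (\<Sum>s\<in>Len l. prod_list (map W s) * (\<Sum>w\<in>Len l. kernel_prod k (C1 (map fst s)) (C2 (map snd s)) w * F s w))"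
proof -
  have "(\<Sum>z\<in>Len l. block_law W k C1 C2 z * F (map fst z) (map snd z)) = (\<Sum>z\<in>Len l. prod_list (map W (map fst z)) *
     kernel_prod k (C1 (map fst (map fst z))) (C2 (map snd (map fst z))) (map snd z) * F (map fst z) (map snd z))"
    by (simp add: block_law_def o_def)
  also have "\<dots> = (\<Sum>s\<in>Len l. \<Sum>w\<in>Len l. prod_list (map W s) * kernel_prod k (C1 (map fst s)) (C2 (map snd s)) w * F s w)"
    by (rule sum_Len_zip[where f = "\<lambda>s w. prod_list (map W s) * kernel_prod k (C1 (map fst s)) (C2 (map snd s)) w * F s w"])
  finally show ?thesis by (simp add: sum_distrib_left mult.assoc)
qed

lemma sum_kernel_prod_additive:
  fixes k :: "'u \<Rightarrow> 'u \<Rightarrow> 'w::finite \<Rightarrow> real"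
  assumes "\<And>u u'. (\<Sum>w\<in>UNIV. k u u' w) = 1" "length us = n" "length us' = n"
  shows "(\<Sum>w\<in>Len n. kernel_prod k us us' w * sum_list (map g w))
    = sum_list (map (\<lambda>x. \<Sum>w\<in>UNIV. k (fst x) (snd x) w * g w) (zip us us'))"
  using sum_Len_kernel_additive[where f = "\<lambda>x w. k (fst x) (snd x) w" and g = g and xs = "zip us us'"] assms
  by (simp add: kernel_prod_def split_def)

lemma sum_list_ge_map: "(\<And>x. x \<in> set xs \<Longrightarrow> c \<le> f x) \<Longrightarrow> real (length xs) * c \<le> sum_list (map f xs)"
  for f :: "'q \<Rightarrow> real"
  by (induction xs) (auto simp: algebra_simps intro: add_mono)

text \<open>The letterwise counterpart of \<open>mean_ln_ge\<close>. If the encoders use the same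
  codeword, its composition makes the sum over positions an exact mean under \<open>q\<close>; if
  not, each letter is bounded by its worst value \<open>ln (\<phi> / N)\<close>. Since the fallback
  sits in every letter, the penalty is multiplied by \<open>l\<close>.\<close>

lemma mean_codeword_ln_ge:
  fixes W :: "'s1::finite \<times> 's2::finite \<Rightarrow> real" and k :: "'u::finite \<Rightarrow> 'u \<Rightarrow> 'w::finite \<Rightarrow> real"
    and pU :: "'u \<Rightarrow> real"
  defines "q \<equiv> (\<lambda>w. \<Sum>u\<in>UNIV. pU u * k u u w)"
  defines "P \<equiv> (\<lambda>s. prod_list (map W s))"
  assumes W: "is_pmf W" and k: "\<And>u u'. is_pmf (k u u')" and pU: "is_pmf pU"
    and C1: "\<And>s. length s = l \<Longrightarrow> C1 s \<in> comp_class l pU" and C2: "\<And>s. length s = l \<Longrightarrow> C2 s \<in> comp_class l pU"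
    and phi: "0 < \<phi>" "\<phi> < 1 / 2" and N: "1 \<le> N"
    and bad: "(\<Sum>s\<in>Len l. P s * of_bool (C1 (map fst s) \<noteq> C2 (map snd s))) \<le> \<phi>"
  shows "real l * (- hb \<phi> - \<phi> * ln N + (\<Sum>w\<in>UNIV. q w * ln (cnd q pw w)))
    \<le> (\<Sum>z\<in>Len l. block_law W k C1 C2 z * sum_list (map (\<lambda>w. ln ((1 - \<phi>) * cnd q pw w + \<phi> / N)) (map snd z)))"
proof -
  let ?t = "\<lambda>w. (1 - \<phi>) * cnd q pw w + \<phi> / N"
  let ?g = "\<lambda>w. ln (?t w)"
  let ?G = "\<lambda>s. C1 (map fst s) = C2 (map snd s)"
  let ?H = "\<Sum>w\<in>UNIV. q w * ln (cnd q pw w)"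
  define \<psi> where "\<psi> = (\<lambda>u u'. \<Sum>w\<in>UNIV. k u u' w * ?g w)"
  have k0: "0 \<le> k u u' w" and k1: "(\<Sum>w\<in>UNIV. k u u' w) = 1" for u u' w using k unfolding is_pmf_def by blast+
  have W0: "0 \<le> W s" and W1: "(\<Sum>s\<in>UNIV. W s) = 1" for s using W unfolding is_pmf_def by blast+
  have U0: "0 \<le> pU u" and U1: "(\<Sum>u\<in>UNIV. pU u) = 1" for u using pU unfolding is_pmf_def by blast+
  have q0: "0 \<le> q w" for w unfolding q_def by (intro sum_nonneg mult_nonneg_nonneg U0 k0)
  have q1: "(\<Sum>w\<in>UNIV. q w) = 1"
    unfolding q_def by (subst sum.swap) (simp add: sum_distrib_left[symmetric] k1 U1)
  have P0: "0 \<le> P s" for s unfolding P_def by (intro prod_list_nonneg_map W0)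
  have P1: "(\<Sum>s\<in>Len l. P s) = 1" unfolding P_def by (simp add: sum_Len_prod_list W1)
  have t_ge: "\<phi> / N \<le> ?t w" for w using phi cnd_nonneg[of q pw w, OF q0] by simp
  have phiN: "0 < \<phi> / N" using phi N by simp
  let ?lo = "ln (\<phi> / N)"
  have g_ge: "?lo \<le> ?g w" for w using phiN t_ge[of w] by (intro ln_mono) auto
  have psi_ge: "?lo \<le> \<psi> u u'" for u u'
  proof -
    have "?lo = (\<Sum>w\<in>UNIV. k u u' w * ?lo)" by (simp only: sum_distrib_right[symmetric] k1 mult_1_left)
    also have "\<dots> \<le> \<psi> u u'" unfolding \<psi>_def by (intro sum_mono mult_left_mono g_ge k0)
    finally show ?thesis .
  qed
  have lngood: "ln (1 - \<phi>) + ?H \<le> (\<Sum>w\<in>UNIV. q w * ?g w)"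
  proof -
    have "ln (1 - \<phi>) + ?H = (\<Sum>w\<in>UNIV. q w * (ln (1 - \<phi>) + ln (cnd q pw w)))"
      by (simp only: distrib_left sum.distrib sum_distrib_right[symmetric] q1 mult_1_left)
    also have "\<dots> \<le> (\<Sum>w\<in>UNIV. q w * ?g w)"
    proof (rule sum_mono)
      fix w
      show "q w * (ln (1 - \<phi>) + ln (cnd q pw w)) \<le> q w * ?g w"
      proof (cases "q w = 0")
        case False
        then have c: "0 < cnd q pw w" using q0 by (intro cnd_pos)
        then have "ln (1 - \<phi>) + ln (cnd q pw w) = ln ((1 - \<phi>) * cnd q pw w)" using phi by (simp add: ln_mult_pos)
        also have "\<dots> \<le> ?g w" using phi c phiN by (intro ln_mono) auto
        finally show ?thesis using q0 by (intro mult_left_mono)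
      qed simp
    qed
    finally show ?thesis .
  qed
  have H0: "?H \<le> 0"
  proof (intro sum_nonpos mult_nonneg_nonpos q0)
    fix w show "ln (cnd q pw w) \<le> 0" using cnd_nonneg[of q pw w, OF q0] cnd_le_1[of q pw w, OF q0] by (cases "cnd q pw w = 0") auto
  qed
  have inner: "(\<Sum>w\<in>Len l. kernel_prod k (C1 (map fst s)) (C2 (map snd s)) w * sum_list (map ?g w))
      \<ge> real l * (if ?G s then ln (1 - \<phi>) + ?H else ?lo)" if s: "s \<in> Len l" for s
  proof -
    let ?u = "C1 (map fst s)" and ?u' = "C2 (map snd s)"
    have cc: "?u \<in> comp_class l pU" "?u' \<in> comp_class l pU" using s C1[of "map fst s"] C2[of "map snd s"] by simp_all
    then have len: "length ?u = l" "length ?u' = l" by (auto simp: comp_class_def)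
    have eq: "(\<Sum>w\<in>Len l. kernel_prod k ?u ?u' w * sum_list (map ?g w)) = sum_list (map (\<lambda>x. \<psi> (fst x) (snd x)) (zip ?u ?u'))"
      unfolding \<psi>_def by (rule sum_kernel_prod_additive[OF k1 len])
    show ?thesis
    proof (cases "?G s")
      case True
      have "zip ?u ?u = map (\<lambda>x. (x, x)) ?u" by (simp add: zip_same_conv_map)
      then have "sum_list (map (\<lambda>x. \<psi> (fst x) (snd x)) (zip ?u ?u')) = sum_list (map (\<lambda>x. \<psi> x x) ?u)"
        unfolding True[symmetric] by (simp add: o_def)
      also have "\<dots> = (\<Sum>x\<in>UNIV. real (count_list ?u x) * \<psi> x x)" by (rule sum_list_map_eq_sum_count_real)
      \<comment> \<open>Here constant composition enters: \<open>x\<close> occurs exactly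
        \<open>l * pU x\<close> times, so the value is the same for all codewords, although the
        source block selects the codeword.\<close>
      also have "\<dots> = real l * (\<Sum>x\<in>UNIV. pU x * \<psi> x x)"
        using cc(1) by (simp add: comp_class_def sum_distrib_left mult.assoc)
      also have "(\<Sum>x\<in>UNIV. pU x * \<psi> x x) = (\<Sum>w\<in>UNIV. q w * ?g w)"
        unfolding \<psi>_def q_def sum_distrib_left sum_distrib_right by (subst sum.swap) (simp only: mult.assoc)
      finally show ?thesis using eq True lngood by (simp add: mult_left_mono)
    next
      case False
      have "real (length (zip ?u ?u')) * ?lo \<le> sum_list (map (\<lambda>x. \<psi> (fst x) (snd x)) (zip ?u ?u'))"
        by (intro sum_list_ge_map psi_ge)
      then show ?thesis using eq False len by simp
    qed
  qed
  define e where "e = (\<Sum>s\<in>Len l. P s * of_bool (\<not> ?G s))"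
  have e: "0 \<le> e" "e \<le> \<phi>" unfolding e_def using bad P0 by (auto intro!: sum_nonneg)
  have "(\<Sum>s\<in>Len l. P s * (if ?G s then ln (1 - \<phi>) + ?H else ?lo))
    = (\<Sum>s\<in>Len l. P s * (ln (1 - \<phi>) + ?H) + P s * of_bool (\<not> ?G s) * (?lo - (ln (1 - \<phi>) + ?H)))"
    by (intro sum.cong) (auto simp: algebra_simps)
  also have "\<dots> = (ln (1 - \<phi>) + ?H) + e * (?lo - (ln (1 - \<phi>) + ?H))"
    by (simp only: sum.distrib sum_distrib_right[symmetric] P1 e_def[symmetric] mult_1_left)
  also have "\<dots> = (1 - e) * ?H + (ln (1 - \<phi>) + e * (?lo - ln (1 - \<phi>)))" by (simp add: algebra_simps)
  finally have avg: "(\<Sum>s\<in>Len l. P s * (if ?G s then ln (1 - \<phi>) + ?H else ?lo)) = \<dots>" .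
  have lo: "?lo = ln \<phi> - ln N" using phi N by (simp add: ln_div)
  have "ln \<phi> \<le> ln (1 - \<phi>)" using phi by simp
  then have d: "?lo - ln (1 - \<phi>) \<le> 0" using N ln_ge_zero[of N] lo by linarith
  have "- hb \<phi> - \<phi> * ln N = ln (1 - \<phi>) + \<phi> * (?lo - ln (1 - \<phi>))"
    using phi unfolding lo by (simp add: hb_def plog_def algebra_simps)
  moreover have "\<phi> * (?lo - ln (1 - \<phi>)) \<le> e * (?lo - ln (1 - \<phi>))" using e d by (intro mult_right_mono_neg)
  moreover have "?H \<le> (1 - e) * ?H"
    using mult_nonneg_nonpos[OF e(1) H0] by (simp add: left_diff_distrib)
  ultimately have "- hb \<phi> - \<phi> * ln N + ?H \<le> (\<Sum>s\<in>Len l. P s * (if ?G s then ln (1 - \<phi>) + ?H else ?lo))"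
    unfolding avg by linarith
  then have "real l * (- hb \<phi> - \<phi> * ln N + ?H) \<le> real l * (\<Sum>s\<in>Len l. P s * (if ?G s then ln (1 - \<phi>) + ?H else ?lo))"
    by (intro mult_left_mono) auto
  also have "\<dots> = (\<Sum>s\<in>Len l. P s * (real l * (if ?G s then ln (1 - \<phi>) + ?H else ?lo)))"
    by (simp only: sum_distrib_left mult_ac)
  also have "\<dots> \<le> (\<Sum>s\<in>Len l. P s * (\<Sum>w\<in>Len l. kernel_prod k (C1 (map fst s)) (C2 (map snd s)) w * sum_list (map ?g w)))"
    by (intro sum_mono mult_left_mono inner P0)
  also have "\<dots> = (\<Sum>z\<in>Len l. block_law W k C1 C2 z * sum_list (map ?g (map snd z)))"
    unfolding P_def by (rule sum_block_law_split[symmetric])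
  finally show ?thesis .
qed

text \<open>The decoder uses explicit sub-conditional pmfs in place of the true posteriors: the posterior of
  the reliable case mixed with the uniform law at weight \<open>\<phi>\<close>. The mixture pays exactly the Fano
  penalty \<open>hb \<phi> + \<phi> * ln N\<close> when the reliable case fails with probability at most \<open>\<phi>\<close>.\<close>

definition source_metric :: "real \<Rightarrow> nat \<Rightarrow> ('s::finite \<Rightarrow> real) \<Rightarrow> ('s \<Rightarrow> 'b) \<Rightarrow> ('s \<Rightarrow> 'k) \<Rightarrow> ('b list \<Rightarrow> 'c list \<Rightarrow> 'k list set) \<Rightarrow>
    real \<Rightarrow> real \<Rightarrow> 's list \<Rightarrow> 'c list \<Rightarrow> real" where
  "source_metric \<phi> l W ps kk L m NS s y =
     (1 - \<phi>) * (of_bool (map kk s \<in> L (map ps s) y) * (prod_list (map (cnd W (\<lambda>s. (ps s, kk s))) s) / m)) + \<phi> / NS ^ l"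

definition codeword_metric :: "real \<Rightarrow> ('w::finite \<Rightarrow> real) \<Rightarrow> ('w \<Rightarrow> 'c) \<Rightarrow> real \<Rightarrow> 'w \<Rightarrow> real" where
  "codeword_metric \<phi> q pw NW w = (1 - \<phi>) * cnd q pw w + \<phi> / NW"

text \<open>For each key block on the list the conditional law has total mass at most one, and
  \<open>m\<close> bounds the list. The uniform part is normalised by the at most
  \<open>NS ^ l\<close> sequences of a fibre.\<close>

lemma sum_source_metric_le:
  fixes W :: "'s::finite \<Rightarrow> real"
  assumes W0: "\<And>s. 0 \<le> W s" and phi: "0 \<le> \<phi>" "\<phi> \<le> 1" and m: "0 < m" and NS: "0 < NS"
    and b: "length b = l" and L: "finite (L b y)" "real (card (L b y)) \<le> m" "\<And>\<kappa>. \<kappa> \<in> L b y \<Longrightarrow> length \<kappa> = l"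
    and card: "\<And>x. real (card {s. ps s = x}) \<le> NS"
  shows "(\<Sum>s | length s = l \<and> map ps s = b. source_metric \<phi> l W ps kk L m NS s y) \<le> 1"
proof -
  let ?S = "{s :: 's list. length s = l \<and> map ps s = b}"
  let ?c = "cnd W (\<lambda>s. (ps s, kk s))"
  have fin: "finite {s :: 's list. length s = l \<and> Q s}" for Q
    by (rule finite_subset[OF _ finite_Len[of l]]) auto
  have "(\<Sum>s\<in>?S. of_bool (map kk s \<in> L b y) * prod_list (map ?c s)) \<le> m"
  proof -
    have "(\<Sum>s\<in>?S. of_bool (map kk s \<in> L b y) * prod_list (map ?c s))
      = (\<Sum>s\<in>?S. \<Sum>\<kappa>\<in>L b y. if map kk s = \<kappa> then prod_list (map ?c s) else 0)"
      using L(1) by (intro sum.cong refl) (simp add: sum.delta')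
    also have "\<dots> = (\<Sum>\<kappa>\<in>L b y. \<Sum>s\<in>?S. if map kk s = \<kappa> then prod_list (map ?c s) else 0)" by (rule sum.swap)
    also have "\<dots> \<le> (\<Sum>\<kappa>\<in>L b y. 1)"
    proof (rule sum_mono)
      fix \<kappa> assume "\<kappa> \<in> L b y"
      then have lk: "length \<kappa> = l" by (rule L(3))
      have "(\<Sum>s\<in>?S. if map kk s = \<kappa> then prod_list (map ?c s) else 0)
        = (\<Sum>s | length s = l \<and> map (\<lambda>s. (ps s, kk s)) s = zip b \<kappa>. prod_list (map ?c s))"
      proof (rule sum.mono_neutral_cong_right)
        have iff: "map (\<lambda>s. (ps s, kk s)) s = zip b \<kappa> \<longleftrightarrow> map ps s = b \<and> map kk s = \<kappa>" if "length s = l" for s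
        proof -
          have "map (\<lambda>s. (ps s, kk s)) s = zip (map ps s) (map kk s)" by (simp add: zip_map_map zip_same_conv_map)
          then show ?thesis using that b lk by (auto simp: zip_eq_conv)
        qed
        show "{s. length s = l \<and> map (\<lambda>s. (ps s, kk s)) s = zip b \<kappa>} \<subseteq> ?S" using iff by auto
        show "\<forall>i\<in>?S - {s. length s = l \<and> map (\<lambda>s. (ps s, kk s)) s = zip b \<kappa>}. (if map kk i = \<kappa> then prod_list (map ?c i) else 0) = 0"
          using iff by auto
        show "\<And>x. x \<in> {s. length s = l \<and> map (\<lambda>s. (ps s, kk s)) s = zip b \<kappa>} \<Longrightarrow>
           (if map kk x = \<kappa> then prod_list (map ?c x) else 0) = prod_list (map ?c x)" using iff by auto
      qed (rule fin)
      also have "\<dots> = prod_list (map (\<lambda>x. \<Sum>s | (ps s, kk s) = x. ?c s) (zip b \<kappa>))"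
        using b lk by (intro sum_Len_fiber) simp
      also have "\<dots> \<le> 1 ^ length (zip b \<kappa>)"
        by (intro prod_list_le_power_map conjI sum_nonneg cnd_nonneg sum_cnd_le_1 W0)
      finally show "(\<Sum>s\<in>?S. if map kk s = \<kappa> then prod_list (map ?c s) else 0) \<le> 1" by simp
    qed
    also have "\<dots> \<le> m" using L(2) by simp
    finally show ?thesis .
  qed
  then have 1: "(\<Sum>s\<in>?S. of_bool (map kk s \<in> L b y) * (prod_list (map ?c s) / m)) \<le> 1"
    using m by (simp add: sum_divide_distrib[symmetric] divide_le_eq_1)
  have "real (card ?S) = (\<Sum>s\<in>?S. prod_list (map (\<lambda>_. 1) s))" by (simp add: prod_list_const_map)
  also have "\<dots> = prod_list (map (\<lambda>x. \<Sum>s | ps s = x. 1) b)" by (rule sum_Len_fiber[OF b])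
  also have "\<dots> \<le> NS ^ length b" by (intro prod_list_le_power_map) (auto intro: card)
  finally have 2: "real (card ?S) * (\<phi> / NS ^ l) \<le> \<phi>"
    using NS phi b by (simp add: pos_divide_le_eq mult_left_mono mult.commute)
  have "(\<Sum>s\<in>?S. source_metric \<phi> l W ps kk L m NS s y)
    = (1 - \<phi>) * (\<Sum>s\<in>?S. of_bool (map kk s \<in> L b y) * (prod_list (map ?c s) / m)) + real (card ?S) * (\<phi> / NS ^ l)"
    by (simp add: source_metric_def sum.distrib sum_distrib_left)
  also have "\<dots> \<le> (1 - \<phi>) * 1 + \<phi>"
    using 1 2 phi by (intro add_mono mult_left_mono) auto
  finally show ?thesis by simp
qed

lemma sum_codeword_metric_le:
  assumes q0: "\<And>w. 0 \<le> q w" and phi: "0 \<le> \<phi>" "\<phi> \<le> 1" and NW: "0 < NW" and b: "length b = l"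
    and card: "\<And>x. real (card {w. pw w = x}) \<le> NW"
  shows "(\<Sum>w | length w = l \<and> map pw w = b. prod_list (map (codeword_metric \<phi> q pw NW) w)) \<le> 1"
proof -
  have "(\<Sum>w | pw w = x. codeword_metric \<phi> q pw NW w) \<le> 1" for x
  proof -
    have "(\<Sum>w | pw w = x. codeword_metric \<phi> q pw NW w) = (1 - \<phi>) * (\<Sum>w | pw w = x. cnd q pw w) + real (card {w. pw w = x}) * (\<phi> / NW)"
      by (simp add: codeword_metric_def sum.distrib sum_distrib_left)
    also have "\<dots> \<le> (1 - \<phi>) * 1 + NW * (\<phi> / NW)"
      using phi NW by (intro add_mono mult_left_mono mult_right_mono sum_cnd_le_1 q0 card) auto
    finally show ?thesis using NW by simp
  qed
  moreover have "0 \<le> codeword_metric \<phi> q pw NW w" for w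
    using phi NW cnd_nonneg[of q pw w, OF q0] by (simp add: codeword_metric_def)
  ultimately have "prod_list (map (\<lambda>x. \<Sum>w | pw w = x. codeword_metric \<phi> q pw NW w) b) \<le> 1 ^ length b"
    by (intro prod_list_le_power_map conjI sum_nonneg) auto
  then show ?thesis using sum_Len_fiber[OF b, where p = pw and c = "codeword_metric \<phi> q pw NW"] by simp
qed

text \<open>One parametric metric serves the three error events: \<open>ps\<close> and
  \<open>pw\<close> keep what a wrong candidate shares with the truth, \<open>kk\<close> is the key,
  \<open>L\<close> lists the key blocks considered plausible, \<open>m\<close> bounds this list, and
  \<open>qw\<close> is the codebook weight of the wrong codewords.\<close>

context
  fixes W :: "'s1::finite \<times> 's2::finite \<Rightarrow> real" and k :: "'u::finite \<Rightarrow> 'u \<Rightarrow> 'w::finite \<Rightarrow> real"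
    and pU :: "'u \<Rightarrow> real" and C1 :: "'s1 list \<Rightarrow> 'u list" and C2 :: "'s2 list \<Rightarrow> 'u list"
    and l :: nat and \<phi> m NS NW :: real
    and ps :: "'s1 \<times> 's2 \<Rightarrow> 'b" and pw :: "'w \<Rightarrow> 'c" and kk :: "'s1 \<times> 's2 \<Rightarrow> 'k"
    and L :: "'b list \<Rightarrow> 'c list \<Rightarrow> 'k list set" and qw q :: "'w \<Rightarrow> real" and D :: "(('s1 \<times> 's2) \<times> 'w) list \<Rightarrow> real"
  assumes W: "is_pmf W" and k: "\<And>u u'. is_pmf (k u u')" and pU: "is_pmf pU"
    and C1: "\<And>s. length s = l \<Longrightarrow> C1 s \<in> comp_class l pU" and C2: "\<And>s. length s = l \<Longrightarrow> C2 s \<in> comp_class l pU"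
    and phi: "0 < \<phi>" "\<phi> < 1 / 2" and m: "1 \<le> m" and NS: "1 \<le> NS" and NW: "1 \<le> NW"
    and q: "q = (\<lambda>w. \<Sum>u\<in>UNIV. pU u * k u u w)"
    and D: "D = (\<lambda>z. source_metric \<phi> l W ps kk L m NS (map fst z) (map pw (map snd z)) *
          prod_list (map (codeword_metric \<phi> q pw NW) (map snd z)) / prod_list (map qw (map snd z)))"
    and qw0: "\<And>w. 0 \<le> qw w" and qwpos: "\<forall>u u' w. k u u' w \<noteq> 0 \<longrightarrow> 0 < qw w"
begin

lemma W_nn: "0 \<le> W s" and W_one: "(\<Sum>s\<in>UNIV. W s) = 1" and k_nn: "0 \<le> k u u' w" and k_one: "(\<Sum>w\<in>UNIV. k u u' w) = 1"
  and pU_nn: "0 \<le> pU u" and pU_one: "(\<Sum>u\<in>UNIV. pU u) = 1"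
  using W k pU unfolding is_pmf_def by blast+

lemma q_nn: "0 \<le> q w"
  unfolding q by (intro sum_nonneg mult_nonneg_nonneg pU_nn k_nn)

lemma len_C: "length s = l \<Longrightarrow> length (C1 s) = l" "length s' = l \<Longrightarrow> length (C2 s') = l"
  using C1[of s] C2[of s'] by (auto simp: comp_class_def)

lemma source_metric_ge: "\<phi> / NS ^ l \<le> source_metric \<phi> l W ps kk L m NS s y"
  unfolding source_metric_def using phi m
  by (auto intro!: mult_nonneg_nonneg divide_nonneg_nonneg prod_list_nonneg_map cnd_nonneg W_nn)

lemma source_metric_pos: "0 < source_metric \<phi> l W ps kk L m NS s y"
proof -
  have "0 < \<phi> / NS ^ l" using phi NS by simp
  then show ?thesis using source_metric_ge by (rule less_le_trans)
qed

lemma codeword_metric_pos: "0 < codeword_metric \<phi> q pw NW w"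
proof -
  have "0 < \<phi> / NW" using phi NW by simp
  then show ?thesis using cnd_nonneg[of q pw w, OF q_nn] phi
    by (simp add: codeword_metric_def add_nonneg_pos)
qed

lemma metrics_nonneg: "0 \<le> source_metric \<phi> l W ps kk L m NS s y" "0 \<le> codeword_metric \<phi> q pw NW w"
  using source_metric_pos codeword_metric_pos less_imp_le by blast+

lemma block_law_nz:
  assumes "length z = l" "block_law W k C1 C2 z \<noteq> 0" "x \<in> set z"
  shows "0 < W (fst x)" "0 < qw (snd x)"
proof -
  have "prod_list (map (\<lambda>x. W (fst x)) z) \<noteq> 0" using assms(2) by (auto simp: block_law_def)
  then have "W (fst x) \<noteq> 0" using assms(3) unfolding prod_list_eq_0_map by blast
  then show "0 < W (fst x)" using W_nn[of "fst x"] by simp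
  let ?u = "C1 (map (\<lambda>x. fst (fst x)) z)" and ?u' = "C2 (map (\<lambda>x. snd (fst x)) z)"
  have len: "length ?u = l" "length ?u' = l" using assms(1) by (simp_all add: len_C)
  have "kernel_prod k ?u ?u' (map snd z) \<noteq> 0" using assms(2) by (auto simp: block_law_def)
  then have nz: "(\<Prod>i<l. k (?u ! i) (?u' ! i) (map snd z ! i)) \<noteq> 0"
    using len assms(1) by (subst (asm) kernel_prod_nth[where n = l]) auto
  obtain i where i: "i < l" "x = z ! i" using assms(1,3) by (auto simp: in_set_conv_nth)
  then have "k (?u ! i) (?u' ! i) (map snd z ! i) \<noteq> 0" using nz by auto
  then show "0 < qw (snd x)" using i assms(1) qwpos by simp
qed

lemma metric_nonneg: "0 \<le> D z"
  unfolding D by (intro divide_nonneg_nonneg mult_nonneg_nonneg prod_list_nonneg_map metrics_nonneg qw0)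

lemma metric_pos: "length z = l \<Longrightarrow> block_law W k C1 C2 z \<noteq> 0 \<Longrightarrow> 0 < D z"
  unfolding D using source_metric_pos codeword_metric_pos block_law_nz[of z]
  by (intro divide_pos_pos mult_pos_pos prod_list_pos_map) auto

lemma metric_fiber_le:
  assumes b: "length b = l"
    and L: "\<And>b y. length b = l \<Longrightarrow> length y = l \<Longrightarrow> finite (L b y) \<and> real (card (L b y)) \<le> m \<and> (\<forall>\<kappa>\<in>L b y. length \<kappa> = l)"
    and cS: "\<And>x. real (card {s. ps s = x}) \<le> NS" and cW: "\<And>x. real (card {w. pw w = x}) \<le> NW"
  shows "(\<Sum>z | length z = l \<and> map (\<lambda>x. (ps (fst x), pw (snd x))) z = b. prod_list (map (\<lambda>x. qw (snd x)) z) * D z) \<le> 1"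
proof -
  let ?t = "codeword_metric \<phi> q pw NW"
  let ?S = "\<lambda>s. source_metric \<phi> l W ps kk L m NS s (map snd b)"
  have "(\<Sum>z | length z = l \<and> map (\<lambda>x. (ps (fst x), pw (snd x))) z = b. prod_list (map (\<lambda>x. qw (snd x)) z) * D z)
    \<le> (\<Sum>z | length z = l \<and> map (\<lambda>x. (ps (fst x), pw (snd x))) z = b. ?S (map fst z) * prod_list (map ?t (map snd z)))"
  proof (rule sum_mono)
    fix z assume z: "z \<in> {z. length z = l \<and> map (\<lambda>x. (ps (fst x), pw (snd x))) z = b}"
    then have y: "map pw (map snd z) = map snd b" by auto
    have nn: "0 \<le> ?S (map fst z) * prod_list (map ?t (map snd z))"
      by (intro mult_nonneg_nonneg prod_list_nonneg_map metrics_nonneg)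
    \<comment> \<open>The weight cancels the denominator of \<open>D\<close> unless it vanishes, in
      which case division by zero makes the product zero.\<close>
    have "prod_list (map (\<lambda>x. qw (snd x)) z) * D z = (if prod_list (map (\<lambda>x. qw (snd x)) z) = 0 then 0 else ?S (map fst z) * prod_list (map ?t (map snd z)))"
      unfolding D y by (simp add: o_def)
    then show "prod_list (map (\<lambda>x. qw (snd x)) z) * D z \<le> ?S (map fst z) * prod_list (map ?t (map snd z))"
      using nn by (simp split: if_splits)
  qed
  also have "\<dots> = (\<Sum>p\<in>{s. length s = l \<and> map ps s = map fst b} \<times> {w. length w = l \<and> map pw w = map snd b}. ?S (fst p) * prod_list (map ?t (snd p)))"
  proof (rule sum.reindex_bij_witness[of _ "\<lambda>p. zip (fst p) (snd p)" "\<lambda>z. (map fst z, map snd z)"])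
    fix p assume p: "p \<in> {s. length s = l \<and> map ps s = map fst b} \<times> {w. length w = l \<and> map pw w = map snd b}"
    then have "map (\<lambda>x. (ps (fst x), pw (snd x))) (zip (fst p) (snd p)) = zip (map ps (fst p)) (map pw (snd p))"
      by (simp add: zip_map_map split_def)
    then show "zip (fst p) (snd p) \<in> {z. length z = l \<and> map (\<lambda>x. (ps (fst x), pw (snd x))) z = b}"
      using p by (auto simp: zip_map_fst_snd)
  qed (auto simp: zip_map_fst_snd)
  also have "\<dots> = (\<Sum>s | length s = l \<and> map ps s = map fst b. ?S s) * (\<Sum>w | length w = l \<and> map pw w = map snd b. prod_list (map ?t w))"
    by (simp add: sum.cartesian_product' sum_product)
  also have "\<dots> \<le> 1 * 1"
  proof (intro mult_mono)
    show "(\<Sum>s | length s = l \<and> map ps s = map fst b. ?S s) \<le> 1"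
      using L[of "map fst b" "map snd b"] b phi m NS by (intro sum_source_metric_le W_nn cS) auto
    show "(\<Sum>w | length w = l \<and> map pw w = map snd b. prod_list (map ?t w)) \<le> 1"
      using b phi NW by (intro sum_codeword_metric_le q_nn cW) auto
    show "0 \<le> (\<Sum>w | length w = l \<and> map pw w = map snd b. prod_list (map ?t w))"
      by (intro sum_nonneg prod_list_nonneg_map metrics_nonneg)
  qed auto
  finally show ?thesis by simp
qed

text \<open>\<open>ln D\<close> splits into source part, codeword part and codebook weight, treated
  by \<open>mean_ln_ge\<close>, \<open>mean_codeword_ln_ge\<close> and \<open>Hq\<close>. Because
  \<open>Hq\<close> holds for all pairs of letters, disagreement of the encoders does not disturb
  the last part.\<close>

lemma metric_mean_ge:
  assumes bad1: "(\<Sum>s\<in>Len l. prod_list (map W s) * of_bool (C1 (map fst s) \<noteq> C2 (map snd s))) \<le> \<phi>"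
    and bad2: "(\<Sum>z\<in>Len l. block_law W k C1 C2 z * of_bool (map kk (map fst z) \<notin> L (map ps (map fst z)) (map pw (map snd z)))) \<le> \<phi>"
    and Hq: "\<And>u u'. (\<Sum>w\<in>UNIV. k u u' w * ln (qw w)) = H"
  shows "(- hb \<phi> - \<phi> * (real l * ln NS)) + (real l * (\<Sum>s\<in>UNIV. W s * ln (cnd W (\<lambda>s. (ps s, kk s)) s)) - ln m)
      + real l * (- hb \<phi> - \<phi> * ln NW + (\<Sum>w\<in>UNIV. q w * (ln (cnd q pw w) - ln (qw w))))
    \<le> (\<Sum>z\<in>Len l. block_law W k C1 C2 z * ln (D z))"
proof -
  let ?J = "block_law W k C1 C2"
  let ?T = "\<lambda>z. source_metric \<phi> l W ps kk L m NS (map fst z) (map pw (map snd z))"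
  let ?c = "cnd W (\<lambda>s. (ps s, kk s))"
  let ?t = "codeword_metric \<phi> q pw NW"
  have J0: "0 \<le> ?J z" for z by (rule block_law_nonneg) (rule k_nn W_nn)+
  have J1: "(\<Sum>z\<in>Len l. ?J z) = 1" by (rule sum_block_law[OF k_one W_one]) (simp_all add: len_C)
  have c0: "0 < ?c (fst x)" if "length z = l" "?J z \<noteq> 0" "x \<in> set z" for z x
    using block_law_nz(1)[OF that] W_nn by (intro cnd_pos) (auto simp: less_imp_neq[symmetric])
  have S: "- hb \<phi> - \<phi> * ln (NS ^ l) + (\<Sum>z\<in>Len l. ?J z * ln (prod_list (map ?c (map fst z)) / m)) \<le> (\<Sum>z\<in>Len l. ?J z * ln (?T z))"
  proof (rule mean_ln_ge[OF finite_Len J0 J1 phi _ bad2])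
    show "1 \<le> NS ^ l" using NS by (rule one_le_power)
    fix z assume z: "z \<in> Len l" and Jz: "?J z \<noteq> 0"
    show "\<phi> / NS ^ l \<le> ?T z" by (rule source_metric_ge)
    have "prod_list (map ?c (map fst z)) \<le> 1 ^ length (map fst z)"
      by (intro prod_list_le_power_map conjI cnd_nonneg cnd_le_1 W_nn)
    moreover have "0 < prod_list (map ?c (map fst z))"
      using c0 z Jz by (intro prod_list_pos_map) auto
    ultimately show "0 < prod_list (map ?c (map fst z)) / m \<and> prod_list (map ?c (map fst z)) / m \<le> 1"
      using m by (simp add: divide_le_eq_1)
    assume "map kk (map fst z) \<in> L (map ps (map fst z)) (map pw (map snd z))"
    then show "(1 - \<phi>) * (prod_list (map ?c (map fst z)) / m) \<le> ?T z"
      using phi NS by (simp add: source_metric_def)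
  qed
  have mS: "(\<Sum>z\<in>Len l. ?J z * ln (prod_list (map ?c (map fst z)) / m)) = real l * (\<Sum>s\<in>UNIV. W s * ln (?c s)) - ln m"
  proof -
    have "(\<Sum>z\<in>Len l. ?J z * ln (prod_list (map ?c (map fst z)) / m)) = (\<Sum>z\<in>Len l. ?J z * (sum_list (map (\<lambda>s. ln (?c s)) (map fst z)) - ln m))"
    proof (rule sum.cong[OF refl])
      fix z :: "(('s1 \<times> 's2) \<times> 'w) list" assume z: "z \<in> Len l"
      show "?J z * ln (prod_list (map ?c (map fst z)) / m) = ?J z * (sum_list (map (\<lambda>s. ln (?c s)) (map fst z)) - ln m)"
      proof (cases "?J z = 0")
        case False
        have p: "0 < prod_list (map ?c (map fst z))" using c0 z False by (intro prod_list_pos_map) auto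
        have "ln (prod_list (map ?c (map fst z))) = sum_list (map (\<lambda>s. ln (?c s)) (map fst z))"
          using c0 z False by (intro ln_prod_list_map) auto
        then show ?thesis using p m by (simp add: ln_div)
      qed simp
    qed
    also have "\<dots> = (\<Sum>s\<in>Len l. prod_list (map W s) * (\<Sum>w\<in>Len l. kernel_prod k (C1 (map fst s)) (C2 (map snd s)) w * (sum_list (map (\<lambda>s. ln (?c s)) s) - ln m)))"
      by (rule sum_block_law_split[where F = "\<lambda>s w. sum_list (map (\<lambda>s. ln (?c s)) s) - ln m"])
    also have "\<dots> = (\<Sum>s\<in>Len l. prod_list (map W s) * (sum_list (map (\<lambda>s. ln (?c s)) s) - ln m))"
      by (intro sum.cong refl) (simp add: sum_distrib_right[symmetric] sum_kernel_prod k_one len_C)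
    also have "\<dots> = real l * (\<Sum>s\<in>UNIV. W s * ln (?c s)) - ln m"
      by (simp add: right_diff_distrib sum_subtractf sum_Len_additive[OF W_one] sum_distrib_right[symmetric] sum_Len_prod_list W_one)
    finally show ?thesis .
  qed
  have V: "real l * (- hb \<phi> - \<phi> * ln NW + (\<Sum>w\<in>UNIV. q w * ln (cnd q pw w)))
    \<le> (\<Sum>z\<in>Len l. ?J z * sum_list (map (\<lambda>w. ln (?t w)) (map snd z)))"
    using mean_codeword_ln_ge[where W = W and k = k and pU = pU and l = l and pw = pw, OF W k pU C1 C2 phi NW bad1]
    unfolding codeword_metric_def q .
  have Q: "(\<Sum>z\<in>Len l. ?J z * sum_list (map (\<lambda>w. ln (qw w)) (map snd z))) = real l * H"
  proof -
    have "(\<Sum>z\<in>Len l. ?J z * sum_list (map (\<lambda>w. ln (qw w)) (map snd z)))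
      = (\<Sum>s\<in>Len l. prod_list (map W s) * (\<Sum>w\<in>Len l. kernel_prod k (C1 (map fst s)) (C2 (map snd s)) w * sum_list (map (\<lambda>w. ln (qw w)) w)))"
      by (rule sum_block_law_split[where F = "\<lambda>s w. sum_list (map (\<lambda>w. ln (qw w)) w)"])
    also have "\<dots> = (\<Sum>s\<in>Len l. prod_list (map W s) * (real l * H))"
    proof (rule sum.cong[OF refl])
      fix s :: "('s1 \<times> 's2) list" assume s: "s \<in> Len l"
      have "(\<Sum>w\<in>Len l. kernel_prod k (C1 (map fst s)) (C2 (map snd s)) w * sum_list (map (\<lambda>w. ln (qw w)) w))
        = sum_list (map (\<lambda>x. H) (zip (C1 (map fst s)) (C2 (map snd s))))"
        using sum_kernel_prod_additive[of k "C1 (map fst s)" l "C2 (map snd s)" "\<lambda>w. ln (qw w)"] k_one s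
        by (simp add: len_C Hq)
      also have "\<dots> = real l * H" using s by (simp add: sum_list_triv len_C)
      finally show "prod_list (map W s) * (\<Sum>w\<in>Len l. kernel_prod k (C1 (map fst s)) (C2 (map snd s)) w * sum_list (map (\<lambda>w. ln (qw w)) w))
         = prod_list (map W s) * (real l * H)" by simp
    qed
    also have "\<dots> = real l * H" by (simp add: sum_distrib_right[symmetric] sum_Len_prod_list W_one)
    finally show ?thesis .
  qed
  have qH: "(\<Sum>w\<in>UNIV. q w * ln (qw w)) = H"
  proof -
    have "(\<Sum>w\<in>UNIV. q w * ln (qw w)) = (\<Sum>u\<in>UNIV. pU u * (\<Sum>w\<in>UNIV. k u u w * ln (qw w)))"
      unfolding q sum_distrib_left sum_distrib_right by (subst sum.swap) (simp only: mult.assoc)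
    then show ?thesis by (simp add: Hq sum_distrib_right[symmetric] pU_one)
  qed
  have "(\<Sum>z\<in>Len l. ?J z * ln (D z)) = (\<Sum>z\<in>Len l. ?J z * ln (?T z) + ?J z * sum_list (map (\<lambda>w. ln (?t w)) (map snd z))
      - ?J z * sum_list (map (\<lambda>w. ln (qw w)) (map snd z)))"
  proof (rule sum.cong[OF refl])
    fix z :: "(('s1 \<times> 's2) \<times> 'w) list" assume z: "z \<in> Len l"
    show "?J z * ln (D z) = ?J z * ln (?T z) + ?J z * sum_list (map (\<lambda>w. ln (?t w)) (map snd z)) - ?J z * sum_list (map (\<lambda>w. ln (qw w)) (map snd z))"
    proof (cases "?J z = 0")
      case False
      have 1: "0 < ?T z" by (rule source_metric_pos)
      have 2: "0 < prod_list (map ?t (map snd z))" by (intro prod_list_pos_map codeword_metric_pos)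
      have 3: "0 < prod_list (map qw (map snd z))" using block_law_nz(2)[of z] z False by (intro prod_list_pos_map) auto
      have "ln (D z) = ln (?T z) + ln (prod_list (map ?t (map snd z))) - ln (prod_list (map qw (map snd z)))"
        unfolding D using 1 2 3 by (simp add: ln_div ln_mult_pos)
      also have "ln (prod_list (map ?t (map snd z))) = sum_list (map (\<lambda>w. ln (?t w)) (map snd z))"
        by (intro ln_prod_list_map codeword_metric_pos)
      also have "ln (prod_list (map qw (map snd z))) = sum_list (map (\<lambda>w. ln (qw w)) (map snd z))"
        using block_law_nz(2)[of z] z False by (intro ln_prod_list_map) auto
      finally show ?thesis by (simp only: distrib_left right_diff_distrib)
    qed simp
  qed
  also have "\<dots> = (\<Sum>z\<in>Len l. ?J z * ln (?T z)) + (\<Sum>z\<in>Len l. ?J z * sum_list (map (\<lambda>w. ln (?t w)) (map snd z))) - real l * H"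
    by (simp only: sum.distrib sum_subtractf Q)
  finally have tot: "(\<Sum>z\<in>Len l. ?J z * ln (D z)) = \<dots>" .
  have "ln (NS ^ l) = real l * ln NS" using NS by (simp add: ln_realpow)
  then show ?thesis
    using S V unfolding tot mS right_diff_distrib[of "q _"] sum_subtractf qH by (simp add: algebra_simps)
qed

end

section \<open>The binned key code\<close>

text \<open>The least element only gives the inequality at one length. It persists for larger
  \<open>l\<close> because the logarithm of the polynomial side is concave in \<open>l\<close> and
  positive at zero, while the other side is linear. It fails at zero, hence
  \<open>0 < l\<close>.\<close>

lemma lstar_bound:
  assumes "0 < \<rho>" "lstar a b \<rho> \<le> l"
  shows "0 < l" "2 * (real l + 1) ^ (2 * a + 2 * a * b) \<le> exp (real l * \<rho> / 2)"
proof -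
  define k where "k = 2 * a + 2 * a * b"
  let ?Q = "\<lambda>l :: nat. exp (real l * \<rho> / 2) \<ge> 2 * (real l + 1) ^ k"
  \<comment> \<open>\<open>LEAST\<close> is meaningful only if some length qualifies: the
    exponential outgrows the power.\<close>
  have "\<exists>l. ?Q l"
  proof -
    have "filterlim (\<lambda>l :: nat. real (Suc l) * (\<rho> / 2)) at_top sequentially"
      using \<open>0 < \<rho>\<close>
      by (intro filterlim_at_top_mult_tendsto_pos[OF tendsto_const] filterlim_compose[OF filterlim_real_sequentially filterlim_Suc]) simp
    moreover have "(\<lambda>l :: nat. real (Suc l) * (\<rho> / 2)) = (\<lambda>l. (real l + 1) * (\<rho> / 2))"
      by (simp add: fun_eq_iff)
    ultimately have "filterlim (\<lambda>l :: nat. (real l + 1) * (\<rho> / 2)) at_top sequentially" by simp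
    then have "(\<lambda>l :: nat. ((real l + 1) * (\<rho> / 2)) ^ k / exp ((real l + 1) * (\<rho> / 2))) \<longlonglongrightarrow> 0"
      by (rule filterlim_compose[OF tendsto_power_div_exp_0])
    moreover have "0 < (\<rho> / 2) ^ k / (2 * exp (\<rho> / 2))" using \<open>0 < \<rho>\<close> by simp
    ultimately have "eventually (\<lambda>l :: nat. ((real l + 1) * (\<rho> / 2)) ^ k / exp ((real l + 1) * (\<rho> / 2)) < (\<rho> / 2) ^ k / (2 * exp (\<rho> / 2))) sequentially"
      by (rule order_tendstoD(2))
    then obtain l :: nat where l: "((real l + 1) * (\<rho> / 2)) ^ k / exp ((real l + 1) * (\<rho> / 2)) < (\<rho> / 2) ^ k / (2 * exp (\<rho> / 2))"
      unfolding eventually_sequentially by blast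
    have "(real l + 1) * (\<rho> / 2) = real l * \<rho> / 2 + \<rho> / 2" by (simp add: algebra_simps)
    then have e: "exp ((real l + 1) * (\<rho> / 2)) = exp (real l * \<rho> / 2) * exp (\<rho> / 2)" by (simp only: exp_add)
    have "((real l + 1) * (\<rho> / 2)) ^ k * (2 * exp (\<rho> / 2)) < (\<rho> / 2) ^ k * exp ((real l + 1) * (\<rho> / 2))"
      using l by (simp add: divide_less_eq less_divide_eq mult_ac)
    then have "(\<rho> / 2) ^ k * exp (\<rho> / 2) * (2 * (real l + 1) ^ k) < (\<rho> / 2) ^ k * exp (\<rho> / 2) * exp (real l * \<rho> / 2)"
      unfolding e power_mult_distrib by (simp only: mult_ac)
    then have "2 * (real l + 1) ^ k < exp (real l * \<rho> / 2)"
      using \<open>0 < \<rho>\<close> by (subst (asm) mult_less_cancel_left_pos) auto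
    then show ?thesis by (intro exI[of _ l]) simp
  qed
  then have Q0: "?Q (lstar a b \<rho>)"
    unfolding lstar_def k_def[symmetric] by (rule LeastI_ex)
  define m where "m = lstar a b \<rho>"
  have m0: "0 < m" using Q0 unfolding m_def[symmetric] by (cases "m = 0") auto
  have ml: "m \<le> l" using assms by (simp add: m_def)
  show "0 < l" using m0 ml by simp
  let ?t = "real m / real l"
  have t: "0 < ?t" "?t \<le> 1" using m0 ml by auto
  \<comment> \<open>Concavity of \<open>ln\<close> between 1 and \<open>l + 1\<close>, at the point
    \<open>m + 1\<close>.\<close>
  have "ln ((1 - ?t) * 1 + ?t * (real l + 1)) \<ge> (1 - ?t) * ln 1 + ?t * ln (real l + 1)"
    using conjunct2[OF ln_concave[unfolded concave_on_iff], rule_format, of 1 "real l + 1" "1 - ?t" ?t] t by simp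
  moreover have "(1 - ?t) * 1 + ?t * (real l + 1) = real m + 1"
    using m0 ml by (simp add: field_simps)
  ultimately have "(1 - ?t) * ln 1 + ?t * ln (real l + 1) \<le> ln (real m + 1)" by (simp only:)
  then have c: "?t * ln (real l + 1) \<le> ln (real m + 1)" by simp
  have lnQ: "?Q j \<longleftrightarrow> ln 2 + real k * ln (real j + 1) \<le> real j * \<rho> / 2" for j :: nat
  proof -
    have "?Q j \<longleftrightarrow> ln (2 * (real j + 1) ^ k) \<le> real j * \<rho> / 2"
      by (subst ln_le_cancel_iff[symmetric]) auto
    then show ?thesis by (simp add: ln_mult_pos ln_realpow)
  qed
  have "?t * (ln 2 + real k * ln (real l + 1)) \<le> ln 2 + real k * ln (real m + 1)"
  proof -
    have "?t * ln 2 \<le> 1 * ln 2" using t by (intro mult_right_mono) auto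
    moreover have "real k * (?t * ln (real l + 1)) \<le> real k * ln (real m + 1)" by (intro mult_left_mono c) auto
    ultimately show ?thesis by (simp add: algebra_simps)
  qed
  also have "\<dots> \<le> real m * \<rho> / 2" using Q0 lnQ unfolding m_def by blast
  also have "\<dots> = ?t * (real l * \<rho> / 2)" using m0 ml by (simp add: field_simps)
  finally have "ln 2 + real k * ln (real l + 1) \<le> real l * \<rho> / 2"
    using t(1) by (subst (asm) mult_le_cancel_left_pos) auto
  then show "2 * (real l + 1) ^ (2 * a + 2 * a * b) \<le> exp (real l * \<rho> / 2)"
    using lnQ unfolding k_def by blast
qed

section \<open>Information quantities as mean log ratios\<close>

lemma push_comp:
  fixes P :: "'a::finite \<Rightarrow> real" and h :: "'a \<Rightarrow> 'c::finite"
  shows "push P (\<lambda>a. g (h a)) b = push (push P h) g b"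
proof -
  have "push (push P h) g b = (\<Sum>c\<in>UNIV. push P h c * (if g c = b then 1 else 0))"
    by (simp add: push_def[of "push P h"] sum.inter_filter[symmetric] if_distrib cong: if_cong)
  also have "\<dots> = (\<Sum>a\<in>UNIV. P a * (if g (h a) = b then 1 else 0))" by (rule sum_push)
  also have "\<dots> = push P (\<lambda>a. g (h a)) b"
    by (simp add: push_def sum.inter_filter[symmetric] if_distrib cong: if_cong)
  finally show ?thesis ..
qed

text \<open>Allows the information quantities of the full law \<open>Q\<close> to be computed under
  its marginal on \<open>(V1, V2, Y)\<close>. Surjectivity makes the two summation ranges
  equal.\<close>

lemma cmi_comp:
  fixes P :: "'a::finite \<Rightarrow> real" and h :: "'a \<Rightarrow> 'c::finite"
  assumes "surj h"
  shows "cmi P (\<lambda>a. X (h a)) (\<lambda>a. Y (h a)) (\<lambda>a. Z (h a)) = cmi (push P h) X Y Z"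
proof -
  have "(\<lambda>a. (X (h a), Y (h a), Z (h a))) ` UNIV = (\<lambda>c. (X c, Y c, Z c)) ` (h ` UNIV)" by (simp add: image_image)
  then show ?thesis
    unfolding cmi_def assms
    using push_comp[of P "\<lambda>c. (X c, Y c, Z c)" h] push_comp[of P "\<lambda>c. (X c, Z c)" h]
      push_comp[of P "\<lambda>c. (Y c, Z c)" h] push_comp[of P Z h] by simp
qed

lemma mi_comp:
  fixes P :: "'a::finite \<Rightarrow> real" and h :: "'a \<Rightarrow> 'c::finite"
  assumes "surj h"
  shows "mi P (\<lambda>a. X (h a)) (\<lambda>a. Y (h a)) = mi (push P h) X Y"
proof -
  have "(\<lambda>a. (X (h a), Y (h a))) ` UNIV = (\<lambda>c. (X c, Y c)) ` (h ` UNIV)" by (simp add: image_image)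
  then show ?thesis
    unfolding mi_def assms
    using push_comp[of P "\<lambda>c. (X c, Y c)" h] push_comp[of P X h] push_comp[of P Y h] by simp
qed

lemma push_inj: "inj X \<Longrightarrow> push P X (X a) = P a"
proof -
  assume "inj X"
  then have "{a'. X a' = X a} = {a}" by (auto simp: inj_def)
  then show ?thesis by (simp add: push_def)
qed

text \<open>By \<open>ind\<close>, \<open>X\<close> has law \<open>r\<close> independently of
  \<open>Z\<close>, so the ratio inside the logarithm becomes conditional probability over codebook
  weight, which is the expression in \<open>metric_mean_ge\<close>.\<close>

lemma cmi_eq_sum_cnd:
  fixes P :: "'c::finite \<Rightarrow> real"
  assumes P0: "\<And>a. 0 \<le> P a" and inj: "inj (\<lambda>a. (X a, Y a, Z a))"
    and ind: "\<And>a. push P (\<lambda>a. (X a, Z a)) (X a, Z a) = r a * push P Z (Z a)"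
    and r: "\<And>a. P a \<noteq> 0 \<Longrightarrow> 0 < r a"
  shows "cmi P X Y Z = (\<Sum>a\<in>UNIV. P a * (ln (cnd P (\<lambda>a. (Z a, Y a)) a) - ln (r a)))"
proof -
  have sw: "push P (\<lambda>a. (Y a, Z a)) (Y a, Z a) = push P (\<lambda>a. (Z a, Y a)) (Z a, Y a)" for a
    unfolding push_def by (intro sum.cong) auto
  have "cmi P X Y Z = (\<Sum>a\<in>UNIV. plog (P a) (P a * push P Z (Z a) / (push P (\<lambda>a. (X a, Z a)) (X a, Z a) * push P (\<lambda>a. (Y a, Z a)) (Y a, Z a))))"
    unfolding cmi_def by (subst sum.reindex[OF inj]) (simp add: push_inj[OF inj])
  also have "\<dots> = (\<Sum>a\<in>UNIV. P a * (ln (cnd P (\<lambda>a. (Z a, Y a)) a) - ln (r a)))"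
  proof (rule sum.cong[OF refl])
    fix a
    show "plog (P a) (P a * push P Z (Z a) / (push P (\<lambda>a. (X a, Z a)) (X a, Z a) * push P (\<lambda>a. (Y a, Z a)) (Y a, Z a)))
      = P a * (ln (cnd P (\<lambda>a. (Z a, Y a)) a) - ln (r a))"
    proof (cases "P a = 0")
      case False
      then have "0 < P a" using P0[of a] by simp
      then have z: "0 < push P Z (Z a)" using le_push[of P a Z, OF P0] by linarith
      have c: "0 < cnd P (\<lambda>a. (Z a, Y a)) a" using False by (intro cnd_pos P0)
      have "P a * push P Z (Z a) / (push P (\<lambda>a. (X a, Z a)) (X a, Z a) * push P (\<lambda>a. (Y a, Z a)) (Y a, Z a)) = cnd P (\<lambda>a. (Z a, Y a)) a / r a"
        unfolding ind sw cnd_def using z by simp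
      then show ?thesis using c r[OF False] False by (simp add: plog_def ln_div)
    qed (simp add: plog_def)
  qed
  finally show ?thesis .
qed

lemma mi_eq_sum_cnd:
  fixes P :: "'c::finite \<Rightarrow> real"
  assumes P0: "\<And>a. 0 \<le> P a" and inj: "inj (\<lambda>a. (X a, Y a))"
    and ind: "\<And>a. push P X (X a) = r a" and r: "\<And>a. P a \<noteq> 0 \<Longrightarrow> 0 < r a"
  shows "mi P X Y = (\<Sum>a\<in>UNIV. P a * (ln (cnd P Y a) - ln (r a)))"
proof -
  have "mi P X Y = (\<Sum>a\<in>UNIV. plog (P a) (P a / (push P X (X a) * push P Y (Y a))))"
    unfolding mi_def by (subst sum.reindex[OF inj]) (simp add: push_inj[OF inj])
  also have "\<dots> = (\<Sum>a\<in>UNIV. P a * (ln (cnd P Y a) - ln (r a)))"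
  proof (rule sum.cong[OF refl])
    fix a
    show "plog (P a) (P a / (push P X (X a) * push P Y (Y a))) = P a * (ln (cnd P Y a) - ln (r a))"
    proof (cases "P a = 0")
      case False
      have c: "0 < cnd P Y a" using False by (intro cnd_pos P0)
      have "P a / (push P X (X a) * push P Y (Y a)) = cnd P Y a / r a"
        unfolding ind cnd_def by simp
      then show ?thesis using c r[OF False] False by (simp add: plog_def ln_div)
    qed (simp add: plog_def)
  qed
  finally show ?thesis .
qed

section \<open>Key agreement, binning and list decoding of the key block\<close>

lemma sum_kernel_prod_output:
  fixes k :: "'u \<Rightarrow> 'u \<Rightarrow> ('v1::finite \<times> 'v2::finite \<times> 'y::finite) \<Rightarrow> real"
  assumes "length us = l"
  shows "(\<Sum>w\<in>Len l. kernel_prod k us us w * F (map (\<lambda>w. snd (snd w)) w))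
    = (\<Sum>y\<in>Len l. prod_list (map2 (\<lambda>u y. \<Sum>v1\<in>UNIV. \<Sum>v2\<in>UNIV. k u u (v1, v2, y)) us y) * F y)"
proof -
  define G where "G = (\<lambda>(v1 :: 'v1 list) (v2 :: 'v2 list) y. (\<Prod>i<l. k (us ! i) (us ! i) (v1 ! i, v2 ! i, y ! i)) * F y)"
  have "(\<Sum>w\<in>Len l. kernel_prod k us us w * F (map (\<lambda>w. snd (snd w)) w))
     = (\<Sum>w\<in>Len l. G (map fst w) (map fst (map snd w)) (map snd (map snd w)))"
    using assms by (intro sum.cong refl) (auto simp: G_def kernel_prod_nth[where n = l] o_def intro!: prod.cong)
  also have "\<dots> = (\<Sum>v1\<in>Len l. \<Sum>r\<in>Len l. G v1 (map fst r) (map snd r))"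
    by (rule sum_Len_zip[where f = "\<lambda>v1 r. G v1 (map fst r) (map snd r)"])
  also have "\<dots> = (\<Sum>v1\<in>Len l. \<Sum>v2\<in>Len l. \<Sum>y\<in>Len l. G v1 v2 y)"
    by (intro sum.cong refl) (rule sum_Len_zip)
  also have "\<dots> = (\<Sum>y\<in>Len l. (\<Sum>v1\<in>Len l. \<Sum>v2\<in>Len l. \<Prod>i<l. k (us ! i) (us ! i) (v1 ! i, v2 ! i, y ! i)) * F y)"
    unfolding G_def sum_distrib_right
    by (subst sum.swap[of _ "Len l :: 'y list set" "Len l :: 'v2 list set"], subst sum.swap[of _ "Len l :: 'y list set" "Len l :: 'v1 list set"]) (rule refl)
  also have "\<dots> = (\<Sum>y\<in>Len l. prod_list (map2 (\<lambda>u y. \<Sum>v1\<in>UNIV. \<Sum>v2\<in>UNIV. k u u (v1, v2, y)) us y) * F y)"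
    using assms by (intro sum.cong refl) (simp add: prod_list_map2_nth[where n = l] sum_Len_nth2[where f = "\<lambda>i v1 v2. k (us ! i) (us ! i) (v1, v2, _ ! i)"])
  finally show ?thesis .
qed

lemma sum_disagreement:
  fixes W :: "'s1::finite \<times> 's2::finite \<Rightarrow> real"
  assumes "is_pmf W"
  shows "(\<Sum>s\<in>Len l. prod_list (map W s) * of_bool (map (\<lambda>x. f1 (fst x)) s \<noteq> map (\<lambda>x. f2 (snd x)) s)) = xi l W f1 f2"
proof -
  have W1: "(\<Sum>s\<in>UNIV. W s) = 1" using assms unfolding is_pmf_def by blast
  have e: "prod_list (map W s) * of_bool (map (\<lambda>x. f1 (fst x)) s = map (\<lambda>x. f2 (snd x)) s)
    = prod_list (map (\<lambda>x. if f1 (fst x) = f2 (snd x) then W x else 0) s)" for s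
    by (induction s) (auto simp: of_bool_def)
  have "(\<Sum>x\<in>UNIV. if f1 (fst x) = f2 (snd x) then W x else 0) = (\<Sum>x\<in>UNIV. W x - (if f1 (fst x) \<noteq> f2 (snd x) then W x else 0))"
    by (intro sum.cong) auto
  also have "\<dots> = 1 - (\<Sum>s\<in>{(s1, s2). f1 s1 \<noteq> f2 s2}. W s)"
  proof -
    have "(\<Sum>x\<in>UNIV. if f1 (fst x) \<noteq> f2 (snd x) then W x else 0) = (\<Sum>s | f1 (fst s) \<noteq> f2 (snd s). W s)"
      using sum.inter_filter[where A = UNIV and g = W and P = "\<lambda>x. f1 (fst x) \<noteq> f2 (snd x)"] by simp
    moreover have "{s. f1 (fst s) \<noteq> f2 (snd s)} = {(s1, s2). f1 s1 \<noteq> f2 s2}" by auto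
    ultimately show ?thesis by (simp add: sum_subtractf W1)
  qed
  finally have 1: "(\<Sum>x\<in>UNIV. if f1 (fst x) = f2 (snd x) then W x else 0) = 1 - (\<Sum>s\<in>{(s1, s2). f1 s1 \<noteq> f2 s2}. W s)" .
  have "(\<Sum>s\<in>Len l. prod_list (map W s) * of_bool (map (\<lambda>x. f1 (fst x)) s \<noteq> map (\<lambda>x. f2 (snd x)) s))
    = (\<Sum>s\<in>Len l. prod_list (map W s) - prod_list (map W s) * of_bool (map (\<lambda>x. f1 (fst x)) s = map (\<lambda>x. f2 (snd x)) s))"
    by (intro sum.cong) (auto simp: of_bool_def)
  also have "\<dots> = 1 - (1 - (\<Sum>s\<in>{(s1, s2). f1 s1 \<noteq> f2 s2}. W s)) ^ l"
    unfolding e by (simp add: sum_subtractf sum_Len_prod_list W1 1)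
  finally show ?thesis by (simp add: xi_def)
qed

text \<open>\<open>T\<close> is numbered and the numbers are divided by \<open>B\<close>, so a bin
  is an interval of at most \<open>B\<close> numbers. Elements outside \<open>T\<close> share bin 0
  and are not counted there.\<close>

lemma exists_bins:
  assumes "finite T" "0 < (B :: nat)"
  shows "\<exists>A :: 'k \<Rightarrow> nat. (\<forall>x. A x < card T div B + 1) \<and> (\<forall>a. card {x \<in> T. A x = a} \<le> B)"
proof -
  obtain h where h: "bij_betw h T {0..<card T}" using ex_bij_betw_finite_nat[OF assms(1)] by blast
  define A where "A = (\<lambda>x. if x \<in> T then h x div B else 0)"
  have "A x < card T div B + 1" for x
  proof (cases "x \<in> T")
    case True
    then have "h x < card T" using h by (auto simp: bij_betw_def)
    then have "h x div B \<le> card T div B" by (intro div_le_mono) simp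
    then show ?thesis using True by (simp add: A_def)
  qed (simp add: A_def)
  moreover have "card {x \<in> T. A x = a} \<le> B" for a
  proof -
    have "card {x \<in> T. A x = a} = card (h ` {x \<in> T. A x = a})"
      using h by (intro card_image[symmetric]) (auto simp: bij_betw_def inj_on_def)
    also have "\<dots> \<le> card {a * B..<a * B + B}"
    proof (rule card_mono)
      have "a * B \<le> h x \<and> h x < a * B + B" if "h x div B = a" for x
      proof -
        have "h x = B * (h x div B) + h x mod B" by simp
        moreover have "h x mod B < B" using assms(2) by simp
        ultimately show ?thesis using that by (simp add: mult.commute)
      qed
      then show "h ` {x \<in> T. A x = a} \<subseteq> {a * B..<a * B + B}" by (auto simp: A_def)
    qed simp
    finally show ?thesis by simp
  qed
  ultimately show ?thesis by blast
qed

lemma card_fiber_le: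
  fixes g :: "'a::finite \<Rightarrow> 'b" and h :: "'c::finite \<Rightarrow> 'a"
  assumes "\<And>a. g a = x \<Longrightarrow> a \<in> range h"
  shows "real (card {a. g a = x}) \<le> real CARD('c)"
proof -
  have "card {a. g a = x} \<le> card (range h)" using assms by (intro card_mono) auto
  also have "\<dots> \<le> CARD('c)" by (rule card_image_le) simp
  finally show ?thesis by simp
qed

text \<open>The three summands of \<phi> are the three ways in which the list can miss the key
  block: the inner code errs, the keys differ, or the key block is atypical.\<close>

lemma binned_key_code:
  fixes W :: "'s1::finite \<times> 's2::finite \<Rightarrow> real" and f1 :: "'s1 \<Rightarrow> 'k::finite" and f2 :: "'s2 \<Rightarrow> 'k"
    and pU :: "'u::finite \<Rightarrow> real" and k :: "'u \<Rightarrow> 'u \<Rightarrow> ('v1::finite \<times> 'v2::finite \<times> 'y::finite) \<Rightarrow> real"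
  defines "Wy \<equiv> (\<lambda>u y. \<Sum>v1\<in>UNIV. \<Sum>v2\<in>UNIV. k u u (v1, v2, y))"
  defines "k1 \<equiv> (\<lambda>s :: ('s1 \<times> 's2) list. map (\<lambda>x. f1 (fst x)) s)" and "k2 \<equiv> (\<lambda>s :: ('s1 \<times> 's2) list. map (\<lambda>x. f2 (snd x)) s)"
  assumes W: "is_pmf W" and k: "\<And>u u'. is_pmf (k u u')" and pU: "is_pmf pU" "is_type l pU"
    and par: "0 \<le> \<alpha>" "0 \<le> \<beta>" "0 < \<rho>" "0 < \<delta>" and l: "lstar CARD('u) CARD('y) \<rho> \<le> l"
    and H: "(1 + \<delta>) * ent W (\<lambda>x. f1 (fst x)) \<le> \<alpha> + \<beta>"
  shows "\<exists>(C :: 'k list \<Rightarrow> 'u list) (L :: 'y list \<Rightarrow> 'k list set) (B :: nat). (\<forall>\<kappa>. C \<kappa> \<in> comp_class l pU) \<and>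
    1 \<le> B \<and> ln (real B) \<le> real l * \<beta> \<and> (\<forall>y. finite (L y) \<and> card (L y) \<le> B \<and> (\<forall>\<kappa>\<in>L y. length \<kappa> = l)) \<and>
    (\<Sum>z\<in>Len l. block_law W k (\<lambda>s. C (map f1 s)) (\<lambda>s. C (map f2 s)) z * of_bool (k1 (map fst z) \<notin> L (map (\<lambda>w. snd (snd w)) (map snd z))))
      \<le> gfun (\<alpha> + \<rho>) l pU Wy + xi l W f1 f2 +
        2 * real CARD('k) * exp (- 2 * \<delta>\<^sup>2 * (Min {push W (\<lambda>x. f1 (fst x)) b | b. push W (\<lambda>x. f1 (fst x)) b > 0})\<^sup>2 * real l)"
proof -
  let ?p = "push W (\<lambda>x. f1 (fst x))"
  let ?T = "typical_set l \<delta> ?p"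
  have lpos: "0 < l" and lb: "2 * (real l + 1) ^ (2 * CARD('u) + 2 * CARD('u) * CARD('y)) \<le> exp (real l * \<rho> / 2)"
    using lstar_bound[OF par(3) l] by auto
  have W0: "0 \<le> W s" and W1: "(\<Sum>s\<in>UNIV. W s) = 1" for s using W unfolding is_pmf_def by blast+
  have k0: "0 \<le> k u u' w" and k1': "(\<Sum>w\<in>UNIV. k u u' w) = 1" for u u' w using k unfolding is_pmf_def by blast+
  have P0: "0 \<le> prod_list (map W s)" for s by (intro prod_list_nonneg_map W0)
  have P1: "(\<Sum>s\<in>Len l. prod_list (map W s)) = 1" by (simp add: sum_Len_prod_list W1)
  have Wy: "is_pmf (Wy u)" for u
  proof -
    have "(\<Sum>y\<in>UNIV. Wy u y) = (\<Sum>v1\<in>UNIV. \<Sum>v2\<in>UNIV. \<Sum>y\<in>UNIV. k u u (v1, v2, y))"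
      unfolding Wy_def by (subst sum.swap[of _ "UNIV :: 'v1 set" "UNIV :: 'y set"], subst sum.swap[of _ "UNIV :: 'v2 set" "UNIV :: 'y set"]) (rule refl)
    also have "\<dots> = (\<Sum>w\<in>UNIV. k u u w)"
      by (simp add: UNIV_Times_UNIV[symmetric] sum.cartesian_product' del: UNIV_Times_UNIV)
    finally show ?thesis unfolding is_pmf_def Wy_def using k0 k1' by (auto intro!: sum_nonneg)
  qed
  have finT: "finite ?T" and cardT: "real (card ?T) \<le> exp (real l * ((1 + \<delta>) * ent W (\<lambda>x. f1 (fst x))))"
    using card_typical_set_le[OF W, of l \<delta> "\<lambda>x. f1 (fst x)"] by auto
  have "real l * ((1 + \<delta>) * ent W (\<lambda>x. f1 (fst x))) \<le> real l * (\<alpha> + \<beta>)" using H by (intro mult_left_mono) auto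
  then have cardT': "real (card ?T) \<le> exp (real l * \<alpha>) * exp (real l * \<beta>)"
    using cardT unfolding exp_add[symmetric] distrib_left[symmetric] by (meson exp_le_cancel_iff order_trans)
  define B where "B = nat \<lfloor>exp (real l * \<beta>)\<rfloor>"
  have e1: "1 \<le> exp (real l * \<beta>)" using par by simp
  then have B1: "1 \<le> B" unfolding B_def by (simp add: le_nat_iff le_floor_iff)
  have Bre: "real B = of_int \<lfloor>exp (real l * \<beta>)\<rfloor>" unfolding B_def by simp
  have Ble: "real B \<le> exp (real l * \<beta>)" unfolding Bre by simp
  have Bge: "exp (real l * \<beta>) \<le> 2 * real B"
    using B1 real_of_int_floor_add_one_gt[of "exp (real l * \<beta>)"] unfolding Bre[symmetric] by linarith
  obtain A :: "'k list \<Rightarrow> nat" where A: "\<And>x. A x < card ?T div B + 1" "\<And>a. card {x \<in> ?T. A x = a} \<le> B"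
    using exists_bins[OF finT, of B] B1 by auto
  define M where "M = card ?T div B + 1"
  have M: "real M \<le> 3 * exp (real l * \<alpha>)"
  proof -
    have "real (card ?T div B) \<le> real (card ?T) / real B" by (rule of_nat_div_le_of_nat)
    also have "\<dots> \<le> (exp (real l * \<alpha>) * (2 * real B)) / real B"
      by (intro divide_right_mono order_trans[OF cardT' mult_left_mono[OF Bge]]) auto
    also have "\<dots> = 2 * exp (real l * \<alpha>)" using B1 by simp
    finally have "real M \<le> 2 * exp (real l * \<alpha>) + 1" by (simp add: M_def)
    moreover have "1 \<le> exp (real l * \<alpha>)" using par by simp
    ultimately show ?thesis by linarith
  qed
  \<comment> \<open>Where \<rho> is spent: with \<open>X\<close> the power from
    \<open>lstar\<close>, \<open>2 * X \<le> exp (l * \<rho> / 2)\<close> is used twice, and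
    \<open>3 * X\<close> is at most the square of \<open>2 * X\<close>.\<close>
  have Mb: "real M * (real l + 1) ^ (2 * CARD('u) + CARD('u) * CARD('y)) \<le> exp (real l * (\<alpha> + \<rho>))"
  proof -
    let ?X = "(real l + 1) ^ (2 * CARD('u) + 2 * CARD('u) * CARD('y))"
    have X1: "1 \<le> ?X" by (intro one_le_power) simp
    have "(real l + 1) ^ (2 * CARD('u) + CARD('u) * CARD('y)) \<le> ?X" by (intro power_increasing) auto
    then have "real M * (real l + 1) ^ (2 * CARD('u) + CARD('u) * CARD('y)) \<le> (3 * exp (real l * \<alpha>)) * ?X"
      using M by (intro mult_mono) auto
    also have "\<dots> \<le> exp (real l * \<alpha>) * ((2 * ?X) * (2 * ?X))"
    proof -
      have "3 * x \<le> (2 * x) * (2 * x)" if "1 \<le> x" for x :: real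
        using that mult_left_mono[OF that, of x] by linarith
      then have "3 * ?X \<le> (2 * ?X) * (2 * ?X)" using X1 by blast
      then have "exp (real l * \<alpha>) * (3 * ?X) \<le> exp (real l * \<alpha>) * ((2 * ?X) * (2 * ?X))" by (intro mult_left_mono) auto
      then show ?thesis by (simp only: mult_ac)
    qed
    also have "\<dots> \<le> exp (real l * \<alpha>) * (exp (real l * \<rho> / 2) * exp (real l * \<rho> / 2))"
      using lb by (intro mult_left_mono mult_mono) auto
    also have "\<dots> = exp (real l * (\<alpha> + \<rho>))" unfolding exp_add[symmetric] by (simp add: algebra_simps)
    finally show ?thesis .
  qed
  \<comment> \<open>On these blocks both encoders send the same codeword, so the output comes from
    the channel \<open>Wy\<close> of the inner code. All other blocks are charged to
    \<open>xi\<close>.\<close>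
  define S where "S = {s \<in> Len l. k1 s = k2 s}"
  have finS: "finite S" unfolding S_def by (rule finite_subset[OF _ finite_Len[of l]]) auto
  have PS: "(\<Sum>s\<in>S. prod_list (map W s)) \<le> 1"
    unfolding P1[symmetric] S_def using P0 by (intro sum_mono2) auto
  have AM: "A (k1 s) < M" for s using A(1) by (simp add: M_def)
  let ?err = "\<lambda>C dec. \<Sum>s\<in>S. prod_list (map W s) * (\<Sum>y\<in>Len l. prod_list (map2 Wy (C (A (k1 s))) y) * of_bool (dec y \<noteq> A (k1 s)))"
  have "\<exists>C dec. (\<forall>i<M. C i \<in> comp_class l pU) \<and>
     ?err C dec \<le> (real l + 1) ^ (CARD('u) * CARD('y)) * exp (- (real l * real_of_ereal (Er (\<alpha> + \<rho>) pU Wy)))"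
    by (rule constant_composition_code[OF pU(1) Wy lpos pU(2) finS P0 PS AM Mb])
  then obtain C dec where Cdec: "(\<forall>i<M. C i \<in> comp_class l pU) \<and>
     ?err C dec \<le> (real l + 1) ^ (CARD('u) * CARD('y)) * exp (- (real l * real_of_ereal (Er (\<alpha> + \<rho>) pU Wy)))"
    by (elim exE)
  then have C: "\<And>i. i < M \<Longrightarrow> C i \<in> comp_class l pU"
    and err: "?err C dec \<le> (real l + 1) ^ (CARD('u) * CARD('y)) * exp (- (real l * real_of_ereal (Er (\<alpha> + \<rho>) pU Wy)))"
    by simp_all
  have gle: "(real l + 1) ^ (CARD('u) * CARD('y)) * exp (- (real l * real_of_ereal (Er (\<alpha> + \<rho>) pU Wy))) \<le> gfun (\<alpha> + \<rho>) l pU Wy"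
    unfolding gfun_def by (intro mult_mono power_increasing) auto
  \<comment> \<open>The decoded index reveals a bin, and the list consists of its typical
    members.\<close>
  define L where "L = (\<lambda>y. {\<kappa> \<in> ?T. A \<kappa> = dec y})"
  define C' where "C' = (\<lambda>\<kappa>. C (A \<kappa>))"
  have C': "C' \<kappa> \<in> comp_class l pU" for \<kappa> unfolding C'_def using A(1) by (intro C) (simp add: M_def)
  let ?J = "block_law W k (\<lambda>s. C' (map f1 s)) (\<lambda>s. C' (map f2 s))"
  let ?K = "\<lambda>s. kernel_prod k (C' (k1 s)) (C' (k2 s))"
  have len: "length (C' \<kappa>) = l" for \<kappa> using C'[of \<kappa>] by (simp add: comp_class_def)
  have K0: "0 \<le> ?K s w" for s w by (intro kernel_prod_nonneg k0)
  have K1: "(\<Sum>w\<in>Len l. ?K s w) = 1" for s by (rule sum_kernel_prod) (auto simp: k1' len)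
  have split: "(\<Sum>z\<in>Len l. ?J z * F (map fst z) (map snd z)) = (\<Sum>s\<in>Len l. prod_list (map W s) * (\<Sum>w\<in>Len l. ?K s w * F s w))" for F
    using sum_block_law_split[where l = l and W = W and k = k and ?C1.0 = "\<lambda>s. C' (map f1 s)" and ?C2.0 = "\<lambda>s. C' (map f2 s)" and F = F] by (simp add: k1_def k2_def o_def)
  have "(\<Sum>z\<in>Len l. ?J z * of_bool (k1 (map fst z) \<notin> L (map (\<lambda>w. snd (snd w)) (map snd z))))
    = (\<Sum>s\<in>Len l. prod_list (map W s) * (\<Sum>w\<in>Len l. ?K s w * of_bool (k1 s \<notin> L (map (\<lambda>w. snd (snd w)) w))))"
    by (rule split)
  also have "\<dots> \<le> (\<Sum>s\<in>Len l. prod_list (map W s) * of_bool (k1 s \<notin> ?T) + prod_list (map W s) * of_bool (k1 s \<noteq> k2 s)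
     + (if k1 s = k2 s then prod_list (map W s) * (\<Sum>y\<in>Len l. prod_list (map2 Wy (C (A (k1 s))) y) * of_bool (dec y \<noteq> A (k1 s))) else 0))"
  proof (rule sum_mono)
    fix s :: "('s1 \<times> 's2) list" assume s: "s \<in> Len l"
    let ?R = "\<Sum>y\<in>Len l. prod_list (map2 Wy (C (A (k1 s))) y) * of_bool (dec y \<noteq> A (k1 s))"
    have R: "(\<Sum>w\<in>Len l. ?K s w * of_bool (dec (map (\<lambda>w. snd (snd w)) w) \<noteq> A (k1 s))) = ?R" if "k1 s = k2 s"
      using sum_kernel_prod_output[where us = "C' (k1 s)" and l = l and k = k and F = "\<lambda>y. of_bool (dec y \<noteq> A (k1 s))"] len that
      by (simp add: C'_def Wy_def)
    have R0: "0 \<le> ?R" by (intro sum_nonneg mult_nonneg_nonneg prod_list_nonneg_map) (auto simp: Wy_def k0 intro!: sum_nonneg)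
    have le1: "(\<Sum>w\<in>Len l. ?K s w * of_bool (k1 s \<notin> L (map (\<lambda>w. snd (snd w)) w))) \<le> 1"
      unfolding K1[of s, symmetric] using K0 by (intro sum_mono) (auto simp: of_bool_def)
    have "(\<Sum>w\<in>Len l. ?K s w * of_bool (k1 s \<notin> L (map (\<lambda>w. snd (snd w)) w)))
      \<le> of_bool (k1 s \<notin> ?T) + of_bool (k1 s \<noteq> k2 s) + (if k1 s = k2 s then ?R else 0)"
    proof (cases "k1 s \<in> ?T \<and> k1 s = k2 s")
      case True
      then have "(\<Sum>w\<in>Len l. ?K s w * of_bool (k1 s \<notin> L (map (\<lambda>w. snd (snd w)) w)))
         = (\<Sum>w\<in>Len l. ?K s w * of_bool (dec (map (\<lambda>w. snd (snd w)) w) \<noteq> A (k1 s)))"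
        by (intro sum.cong refl) (auto simp: L_def)
      then show ?thesis using True R by simp
    next
      case False
      then have "1 \<le> of_bool (k1 s \<notin> ?T) + of_bool (k1 s \<noteq> k2 s) + (if k1 s = k2 s then ?R else 0)" using R0 by auto
      then show ?thesis using le1 by linarith
    qed
    from mult_left_mono[OF this P0[of s]]
    show "prod_list (map W s) * (\<Sum>w\<in>Len l. ?K s w * of_bool (k1 s \<notin> L (map (\<lambda>w. snd (snd w)) w)))
      \<le> prod_list (map W s) * of_bool (k1 s \<notin> ?T) + prod_list (map W s) * of_bool (k1 s \<noteq> k2 s)
        + (if k1 s = k2 s then prod_list (map W s) * ?R else 0)"
      by (simp only: distrib_left if_distrib[of "\<lambda>x. prod_list (map W s) * x"] mult_zero_right)
  qed
  also have "\<dots> = (\<Sum>s\<in>Len l. prod_list (map W s) * of_bool (k1 s \<notin> ?T)) + (\<Sum>s\<in>Len l. prod_list (map W s) * of_bool (k1 s \<noteq> k2 s))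
    + (\<Sum>s\<in>S. prod_list (map W s) * (\<Sum>y\<in>Len l. prod_list (map2 Wy (C (A (k1 s))) y) * of_bool (dec y \<noteq> A (k1 s))))"
    unfolding sum.distrib S_def by (subst sum.inter_filter[OF finite_Len]) (rule refl)
  also have "\<dots> \<le> 2 * real CARD('k) * exp (- 2 * \<delta>\<^sup>2 * (Min {?p b | b. ?p b > 0})\<^sup>2 * real l) + xi l W f1 f2 + gfun (\<alpha> + \<rho>) l pU Wy"
  proof (intro add_mono)
    show "(\<Sum>s\<in>Len l. prod_list (map W s) * of_bool (k1 s \<notin> ?T)) \<le> 2 * real CARD('k) * exp (- 2 * \<delta>\<^sup>2 * (Min {?p b | b. ?p b > 0})\<^sup>2 * real l)"
      unfolding k1_def by (rule atypical_prob_le[OF W par(4)])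
    show "(\<Sum>s\<in>Len l. prod_list (map W s) * of_bool (k1 s \<noteq> k2 s)) \<le> xi l W f1 f2"
      unfolding k1_def k2_def using sum_disagreement[OF W, where l = l and ?f1.0 = f1 and ?f2.0 = f2] by simp
    show "(\<Sum>s\<in>S. prod_list (map W s) * (\<Sum>y\<in>Len l. prod_list (map2 Wy (C (A (k1 s))) y) * of_bool (dec y \<noteq> A (k1 s)))) \<le> gfun (\<alpha> + \<rho>) l pU Wy"
      using err gle by linarith
  qed
  finally have "(\<Sum>z\<in>Len l. ?J z * of_bool (k1 (map fst z) \<notin> L (map (\<lambda>w. snd (snd w)) (map snd z))))
     \<le> gfun (\<alpha> + \<rho>) l pU Wy + xi l W f1 f2 + 2 * real CARD('k) * exp (- 2 * \<delta>\<^sup>2 * (Min {?p b | b. ?p b > 0})\<^sup>2 * real l)" by linarith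
  moreover have "ln (real B) \<le> ln (exp (real l * \<beta>))"
    using Ble B1 by (intro ln_mono) auto
  then have "ln (real B) \<le> real l * \<beta>" by simp
  moreover have "finite (L y) \<and> card (L y) \<le> B \<and> (\<forall>\<kappa>\<in>L y. length \<kappa> = l)" for y
  proof (intro conjI)
    show "finite (L y)" unfolding L_def using finT by (rule rev_finite_subset) blast
    show "card (L y) \<le> B" unfolding L_def by (rule A(2))
    show "\<forall>\<kappa>\<in>L y. length \<kappa> = l" unfolding L_def typical_set_def by blast
  qed
  ultimately show ?thesis using C' B1 by (intro exI[of _ C'] exI[of _ L] exI[of _ B] conjI allI) simp_all
qed

section \<open>The three metrics matched with the three information inequalities\<close>

theorem theorem7:
  fixes W :: "'s1::finite \<times> 's2::finite \<Rightarrow> real"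
    and Wc :: "'x1::finite \<Rightarrow> 'x2::finite \<Rightarrow> 'y::finite \<Rightarrow> real"
    and f1 :: "'s1 \<Rightarrow> 'k::finite" and f2 :: "'s2 \<Rightarrow> 'k"
    and \<alpha> \<beta> \<rho> \<delta> :: real and l :: nat
    and pU :: "'u::finite \<Rightarrow> real" and pV1 :: "'v1::finite \<Rightarrow> real" and pV2 :: "'v2::finite \<Rightarrow> real"
    and pX1 :: "'u \<Rightarrow> 'v1 \<Rightarrow> 'x1 \<Rightarrow> real" and pX2 :: "'u \<Rightarrow> 'v2 \<Rightarrow> 'x2 \<Rightarrow> real"
  defines "Q \<equiv> (\<lambda>(u, v1, v2, x1, x2, y). pU u * pV1 v1 * pV2 v2 * pX1 u v1 x1 * pX2 u v2 x2 * Wc x1 x2 y)"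
    and "\<phi> \<equiv> gfun (\<alpha> + \<rho>) l pU
            (\<lambda>u y. \<Sum>(v1, v2, x1, x2)\<in>UNIV. pV1 v1 * pV2 v2 * pX1 u v1 x1 * pX2 u v2 x2 * Wc x1 x2 y)
          + xi l W f1 f2 + tau l \<delta> W f1"
  assumes W_pmf: "is_pmf W"
    and Wc_pmf: "\<forall>x1 x2. is_pmf (Wc x1 x2)"
    and params: "\<alpha> \<ge> 0" "\<beta> \<ge> 0" "\<rho> > 0" "\<delta> > 0"
    and l_ge: "l \<ge> lstar CARD('u) CARD('y) \<rho>"
    and pmfs: "is_pmf pU" "is_pmf pV1" "is_pmf pV2" "\<forall>u v. is_pmf (pX1 u v)" "\<forall>u v. is_pmf (pX2 u v)"
    and pU_type: "is_type l pU"
    and c0: "(1 + \<delta>) * ent W (\<lambda>(s1, s2). f1 s1) < \<alpha> + \<beta>"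
    and c1: "cent W fst (\<lambda>(s1, s2). (s2, f1 s1)) + Ll l \<phi> CARD('s1)
             < cmi Q (\<lambda>(u, v1, v2, x1, x2, y). v1) (\<lambda>(u, v1, v2, x1, x2, y). y) (\<lambda>(u, v1, v2, x1, x2, y). v2)
               - LL \<phi> CARD('v1)"
    and c2: "cent W snd (\<lambda>(s1, s2). (s1, f1 s1)) + Ll l \<phi> CARD('s2)
             < cmi Q (\<lambda>(u, v1, v2, x1, x2, y). v2) (\<lambda>(u, v1, v2, x1, x2, y). y) (\<lambda>(u, v1, v2, x1, x2, y). v1)
               - LL \<phi> CARD('v2)"
    and c3: "\<beta> + cent W (\<lambda>s. s) (\<lambda>(s1, s2). f1 s1) + Ll l \<phi> (CARD('s1) * CARD('s2))
             < mi Q (\<lambda>(u, v1, v2, x1, x2, y). (v1, v2)) (\<lambda>(u, v1, v2, x1, x2, y). y)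
               - LL \<phi> (CARD('v1) * CARD('v2))"
    and phi_range: "0 \<le> \<phi>" "\<phi> < 1/2"
  shows "transmissible W Wc"
proof -
  let ?V1 = "\<lambda>(u, v1, v2, x1, x2, y). v1" and ?V2 = "\<lambda>(u, v1, v2, x1, x2, y). v2"
    and ?Y = "\<lambda>(u, v1, v2, x1, x2, y). y" and ?V12 = "\<lambda>(u, v1, v2, x1, x2, y). (v1, v2)"
  define k where "k = mac_kernel pV1 pV2 pX1 pX2 Wc"
  have X: "is_pmf (pX1 u v)" "is_pmf (pX2 u v')" "is_pmf (Wc x1 x2)" for u v v' x1 x2 using pmfs Wc_pmf by auto
  have kpmf: "is_pmf (k u u')" for u u' unfolding k_def by (rule is_pmf_mac_kernel[OF pmfs(2,3) X])
  have k0: "0 \<le> k u u' w" for u u' w using kpmf unfolding is_pmf_def by blast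
  have V0: "0 \<le> pV1 v1" "0 \<le> pV2 v2" for v1 v2 using pmfs unfolding is_pmf_def by blast+
  have V1: "(\<Sum>v\<in>UNIV. pV1 v) = 1" "(\<Sum>v\<in>UNIV. pV2 v) = 1" using pmfs unfolding is_pmf_def by blast+
  have U: "0 \<le> pU u" "(\<Sum>u\<in>UNIV. pU u) = 1" for u using pmfs unfolding is_pmf_def by blast+
  have W0: "0 \<le> W s" for s using W_pmf unfolding is_pmf_def by blast
  define q where "q = (\<lambda>w. \<Sum>u\<in>UNIV. pU u * k u u w)"
  have q0: "0 \<le> q w" for w unfolding q_def by (intro sum_nonneg mult_nonneg_nonneg U(1) k0)
  have kpos: "0 < pV1 (fst w)" "0 < pV2 (fst (snd w))" if "k u u' w \<noteq> 0" for u u' w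
  proof -
    obtain v1 v2 y where w: "w = (v1, v2, y)" by (cases w)
    have "pV1 v1 \<noteq> 0" "pV2 v2 \<noteq> 0" using that by (auto simp: w k_def mac_kernel_def)
    then show "0 < pV1 (fst w)" "0 < pV2 (fst (snd w))" using V0(1)[of v1] V0(2)[of v2] by (auto simp: w)
  qed
  have qpos: "0 < pV1 (fst w)" "0 < pV2 (fst (snd w))" if "q w \<noteq> 0" for w
  proof -
    have "\<exists>u. k u u w \<noteq> 0"
    proof (rule ccontr)
      assume "\<nexists>u. k u u w \<noteq> 0"
      then have "q w = 0" by (simp add: q_def)
      with that show False by simp
    qed
    then obtain u where "k u u w \<noteq> 0" by blast
    then show "0 < pV1 (fst w)" "0 < pV2 (fst (snd w))" by (rule kpos)+
  qed

  \<comment> \<open>The decoding metrics use the law averaged over \<open>U\<close>, hence the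
    marginal of \<open>Q\<close> under this projection.\<close>
  define h where "h = (\<lambda>(u :: 'u, v1 :: 'v1, v2 :: 'v2, x1 :: 'x1, x2 :: 'x2, y :: 'y). (v1, v2, y))"
  have surj: "surj h" unfolding h_def by (rule surjI[where f = "\<lambda>w. (undefined, fst w, fst (snd w), undefined, undefined, snd (snd w))"]) (auto split: prod.splits)
  have push_Q: "push Q h = q"
  proof
    fix w :: "'v1 \<times> 'v2 \<times> 'y"
    obtain v1 v2 y where w: "w = (v1, v2, y)" by (cases w)
    have "push Q h w = (\<Sum>p\<in>UNIV \<times> UNIV \<times> UNIV. Q (fst p, v1, v2, fst (snd p), snd (snd p), y))"
      unfolding push_def w h_def
      by (rule sum.reindex_bij_witness[where i = "\<lambda>p. (fst p, v1, v2, fst (snd p), snd (snd p), y)" and j = "\<lambda>(u, v1, v2, x1, x2, y). (u, x1, x2)"]) auto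
    also have "\<dots> = q w"
      by (simp add: sum.cartesian_product' Q_def q_def k_def w mac_kernel_def sum_distrib_left mult.assoc del: UNIV_Times_UNIV)
    finally show "push Q h w = q w" .
  qed
  have marg: "(\<Sum>w\<in>UNIV. q w * g (fst w) (fst (snd w))) = (\<Sum>v1\<in>UNIV. \<Sum>v2\<in>UNIV. pV1 v1 * pV2 v2 * g v1 v2)" for g
  proof -
    have "(\<Sum>w\<in>UNIV. q w * g (fst w) (fst (snd w))) = (\<Sum>u\<in>UNIV. pU u * (\<Sum>w\<in>UNIV. k u u w * g (fst w) (fst (snd w))))"
      unfolding q_def sum_distrib_left sum_distrib_right by (subst sum.swap) (simp only: mult.assoc)
    moreover have "(\<Sum>w\<in>UNIV. k u u w * g (fst w) (fst (snd w))) = (\<Sum>v1\<in>UNIV. \<Sum>v2\<in>UNIV. pV1 v1 * pV2 v2 * g v1 v2)" for u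
      unfolding k_def by (rule mac_kernel_marginal(2)[OF X])
    ultimately show ?thesis by (simp add: sum_distrib_right[symmetric] U(2))
  qed
  have pushq: "push q g x = (\<Sum>w\<in>UNIV. q w * (if g w = x then 1 else 0))" for g :: "'v1 \<times> 'v2 \<times> 'y \<Rightarrow> 'z" and x
    by (simp add: push_def sum.inter_filter[symmetric] if_distrib cong: if_cong)
  have marg2: "(\<Sum>w\<in>UNIV. q w * (g1 (fst w) * g2 (fst (snd w)))) = (\<Sum>a\<in>UNIV. pV1 a * g1 a) * (\<Sum>b\<in>UNIV. pV2 b * g2 b)" for g1 g2
    using marg[of "\<lambda>a b. g1 a * g2 b"] by (simp add: sum_product mult_ac)
  have ind: "(\<Sum>a\<in>UNIV. f a * (if a = v then 1 else 0)) = f v" for f :: "'z::finite \<Rightarrow> real" and v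
    by (simp add: if_distrib cong: if_cong)
  have p12: "push q (\<lambda>w. (fst w, fst (snd w))) (v1, v2) = pV1 v1 * pV2 v2" for v1 v2
  proof -
    have "push q (\<lambda>w. (fst w, fst (snd w))) (v1, v2)
      = (\<Sum>w\<in>UNIV. q w * ((if fst w = v1 then 1 else 0) * (if fst (snd w) = v2 then 1 else 0)))"
      unfolding pushq by (intro sum.cong) auto
    also have "\<dots> = pV1 v1 * pV2 v2"
      using marg2[of "\<lambda>a. if a = v1 then 1 else 0" "\<lambda>b. if b = v2 then 1 else 0"] unfolding ind .
    finally show ?thesis .
  qed
  have p21: "push q (\<lambda>w. (fst (snd w), fst w)) (v2, v1) = pV2 v2 * pV1 v1" for v1 v2
  proof -
    have "push q (\<lambda>w. (fst (snd w), fst w)) (v2, v1) = push q (\<lambda>w. (fst w, fst (snd w))) (v1, v2)"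
      unfolding push_def by (intro sum.cong) auto
    then show ?thesis by (simp add: p12)
  qed
  have p1: "push q fst v1 = pV1 v1" for v1
    unfolding pushq using marg2[of "\<lambda>a. if a = v1 then 1 else 0" "\<lambda>b. 1"] unfolding ind by (simp add: V1)
  have p2: "push q (\<lambda>w. fst (snd w)) v2 = pV2 v2" for v2
    unfolding pushq using marg2[of "\<lambda>a. 1" "\<lambda>b. if b = v2 then 1 else 0"] unfolding ind by (simp add: V1)

  let ?w1 = "\<lambda>w :: 'v1 \<times> 'v2 \<times> 'y. (fst (snd w), snd (snd w))"
  let ?w2 = "\<lambda>w :: 'v1 \<times> 'v2 \<times> 'y. (fst w, snd (snd w))"
  let ?w3 = "\<lambda>w :: 'v1 \<times> 'v2 \<times> 'y. snd (snd w)"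
  have I1: "cmi Q ?V1 ?Y ?V2
      = (\<Sum>w\<in>UNIV. q w * (ln (cnd q ?w1 w) - ln (pV1 (fst w))))"
  proof -
    have "cmi Q ?V1 ?Y ?V2
      = cmi Q (\<lambda>a. fst (h a)) (\<lambda>a. snd (snd (h a))) (\<lambda>a. fst (snd (h a)))"
      unfolding h_def by (intro arg_cong3[where f = "cmi Q"] ext) auto
    also have "\<dots> = cmi q fst (\<lambda>w. snd (snd w)) (\<lambda>w. fst (snd w))"
      using cmi_comp[OF surj, where P = Q and X = fst and Y = "\<lambda>w. snd (snd w)" and Z = "\<lambda>w. fst (snd w)"] unfolding push_Q .
    also have "\<dots> = (\<Sum>w\<in>UNIV. q w * (ln (cnd q ?w1 w) - ln (pV1 (fst w))))"
      by (rule cmi_eq_sum_cnd) (auto simp: q0 p12 p2 qpos inj_def)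
    finally show ?thesis .
  qed
  have I2: "cmi Q ?V2 ?Y ?V1
      = (\<Sum>w\<in>UNIV. q w * (ln (cnd q ?w2 w) - ln (pV2 (fst (snd w)))))"
  proof -
    have "cmi Q ?V2 ?Y ?V1
      = cmi Q (\<lambda>a. fst (snd (h a))) (\<lambda>a. snd (snd (h a))) (\<lambda>a. fst (h a))"
      unfolding h_def by (intro arg_cong3[where f = "cmi Q"] ext) auto
    also have "\<dots> = cmi q (\<lambda>w. fst (snd w)) (\<lambda>w. snd (snd w)) fst"
      using cmi_comp[OF surj, where P = Q and X = "\<lambda>w. fst (snd w)" and Y = "\<lambda>w. snd (snd w)" and Z = fst] unfolding push_Q .
    also have "\<dots> = (\<Sum>w\<in>UNIV. q w * (ln (cnd q ?w2 w) - ln (pV2 (fst (snd w)))))"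
      by (rule cmi_eq_sum_cnd) (auto simp: q0 p21 p1 qpos inj_def)
    finally show ?thesis .
  qed
  have I3: "mi Q ?V12 ?Y
      = (\<Sum>w\<in>UNIV. q w * (ln (cnd q ?w3 w) - ln (pV1 (fst w) * pV2 (fst (snd w)))))"
  proof -
    have "mi Q ?V12 ?Y
      = mi Q (\<lambda>a. (fst (h a), fst (snd (h a)))) (\<lambda>a. snd (snd (h a)))"
      unfolding h_def by (intro arg_cong2[where f = "mi Q"] ext) auto
    also have "\<dots> = mi q (\<lambda>w. (fst w, fst (snd w))) (\<lambda>w. snd (snd w))"
      using mi_comp[OF surj, where P = Q and X = "\<lambda>w. (fst w, fst (snd w))" and Y = "\<lambda>w. snd (snd w)"] unfolding push_Q .
    also have "\<dots> = (\<Sum>w\<in>UNIV. q w * (ln (cnd q ?w3 w) - ln (pV1 (fst w) * pV2 (fst (snd w)))))"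
      by (rule mi_eq_sum_cnd) (auto simp: q0 p12 qpos inj_def)
    finally show ?thesis .
  qed

  let ?g = "gfun (\<alpha> + \<rho>) l pU (\<lambda>u y. \<Sum>v1\<in>UNIV. \<Sum>v2\<in>UNIV. k u u (v1, v2, y))"
  have f1eq: "(\<lambda>(s1, s2). f1 s1) = (\<lambda>x :: 's1 \<times> 's2. f1 (fst x))" by auto
  have out: "(\<Sum>(v1, v2, x1, x2)\<in>UNIV. pV1 v1 * pV2 v2 * pX1 u v1 x1 * pX2 u v2 x2 * Wc x1 x2 y)
     = (\<Sum>v1\<in>UNIV. \<Sum>v2\<in>UNIV. k u u (v1, v2, y))" for u y
    by (simp add: UNIV_Times_UNIV[symmetric] sum.cartesian_product' k_def mac_kernel_def sum_distrib_left mult.assoc del: UNIV_Times_UNIV)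
  have phi: "\<phi> = ?g + xi l W f1 f2 + 2 * real CARD('k) *
      exp (- 2 * \<delta>\<^sup>2 * (Min {push W (\<lambda>x. f1 (fst x)) b | b. push W (\<lambda>x. f1 (fst x)) b > 0})\<^sup>2 * real l)" (is "_ = _ + _ + ?tau")
    unfolding \<phi>_def out tau_def f1eq ..
  have g0: "0 \<le> ?g" by (simp add: gfun_def)
  have tau0: "0 < ?tau" by (simp add: zero_less_card_finite)
  have xi0: "0 \<le> xi l W f1 f2"
    unfolding sum_disagreement[OF W_pmf, symmetric] by (intro sum_nonneg mult_nonneg_nonneg prod_list_nonneg_map W0) auto
  \<comment> \<open>Strict positivity comes from the exponential in \<open>tau\<close>. It keeps the
    uniform part of the mixtures, hence the metrics, strictly positive.\<close>
  have phi_pos: "0 < \<phi>" and xi_le: "xi l W f1 f2 \<le> \<phi>" using phi g0 tau0 xi0 by linarith+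
  have lpos: "0 < l" using lstar_bound(1)[OF params(3) l_ge] .

  have "(1 + \<delta>) * ent W (\<lambda>x. f1 (fst x)) \<le> \<alpha> + \<beta>" using c0 unfolding f1eq by simp
  from binned_key_code[where k = k and ?f2.0 = f2, OF W_pmf kpmf pmfs(1) pU_type params l_ge this, folded phi]
  obtain C L B where C: "\<forall>\<kappa>. C \<kappa> \<in> comp_class l pU" and B: "1 \<le> B" "ln (real B) \<le> real l * \<beta>"
    and L: "\<forall>y. finite (L y) \<and> card (L y) \<le> B \<and> (\<forall>\<kappa>\<in>L y. length \<kappa> = l)"
    and bad: "(\<Sum>z\<in>Len l. block_law W k (\<lambda>s. C (map f1 s)) (\<lambda>s. C (map f2 s)) z *
        of_bool (map (\<lambda>x. f1 (fst x)) (map fst z) \<notin> L (map (\<lambda>w. snd (snd w)) (map snd z)))) \<le> \<phi>"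
    by (elim exE conjE) (rule that)
  note C = C[rule_format] and L = L[rule_format]
  let ?C1 = "\<lambda>s. C (map f1 s)" and ?C2 = "\<lambda>s. C (map f2 s)"
  let ?kk = "\<lambda>x :: 's1 \<times> 's2. f1 (fst x)"
  let ?J = "block_law W k ?C1 ?C2"
  have lenC: "length (C \<kappa>) = l" for \<kappa> using C[of \<kappa>] by (simp add: comp_class_def)
  \<comment> \<open>Both encoders apply the same \<open>C\<close>, so different codewords force
    different key blocks.\<close>
  have bad1: "(\<Sum>s\<in>Len l. prod_list (map W s) * of_bool (C (map f1 (map fst s)) \<noteq> C (map f2 (map snd s)))) \<le> \<phi>"
  proof -
    have "(\<Sum>s\<in>Len l. prod_list (map W s) * of_bool (C (map f1 (map fst s)) \<noteq> C (map f2 (map snd s)))) \<le> xi l W f1 f2"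
      unfolding sum_disagreement[OF W_pmf, symmetric]
    proof (intro sum_mono mult_left_mono prod_list_nonneg_map W0)
      fix s :: "('s1 \<times> 's2) list"
      have "map f1 (map fst s) = map (\<lambda>x. f1 (fst x)) s" "map f2 (map snd s) = map (\<lambda>x. f2 (snd x)) s" by simp_all
      then show "of_bool (C (map f1 (map fst s)) \<noteq> C (map f2 (map snd s))) \<le> (of_bool (map (\<lambda>x. f1 (fst x)) s \<noteq> map (\<lambda>x. f2 (snd x)) s) :: real)"
        by (cases "map (\<lambda>x. f1 (fst x)) s = map (\<lambda>x. f2 (snd x)) s") (simp_all only: of_bool_eq, simp_all)
    qed
    then show ?thesis using xi_le by linarith
  qed
  \<comment> \<open>When only the first message is wrong, \<open>s2\<close> is shared and
    \<open>f2\<close> of it is the guess for the key block; it misses exactly when the keys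
    differ.\<close>
  have bad2: "(\<Sum>z\<in>Len l. ?J z * of_bool (map ?kk (map fst z) \<notin> {map f2 (map snd (map fst z))})) \<le> \<phi>"
  proof -
    have "(\<Sum>z\<in>Len l. ?J z * of_bool (map ?kk (map fst z) \<notin> {map f2 (map snd (map fst z))}))
      = (\<Sum>s\<in>Len l. prod_list (map W s) * (\<Sum>w\<in>Len l. kernel_prod k (C (map f1 (map fst s))) (C (map f2 (map snd s))) w * of_bool (map ?kk s \<notin> {map f2 (map snd s)})))"
      by (rule sum_block_law_split[where F = "\<lambda>s w. of_bool (map ?kk s \<notin> {map f2 (map snd s)})"])
    also have "\<dots> = (\<Sum>s\<in>Len l. prod_list (map W s) * of_bool (map ?kk s \<noteq> map (\<lambda>x. f2 (snd x)) s))"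
      using kpmf unfolding is_pmf_def
      by (intro sum.cong refl) (simp add: sum_distrib_right[symmetric] sum_kernel_prod lenC o_def)
    finally show ?thesis using sum_disagreement[OF W_pmf, where l = l and ?f1.0 = f1 and ?f2.0 = f2] xi_le by simp
  qed
  \<comment> \<open>When only the second message is wrong, \<open>s1\<close> is shared and
    determines the key block, so the list never misses.\<close>
  have bad3: "(\<Sum>z\<in>Len l. ?J z * of_bool (map ?kk (map fst z) \<notin> {map f1 (map fst (map fst z))})) \<le> \<phi>"
    using phi_pos by (simp add: o_def)

  have H1: "cent W fst (\<lambda>(s1, s2). (s2, f1 s1)) = - (\<Sum>s\<in>UNIV. W s * ln (cnd W (\<lambda>s. (snd s, ?kk s)) s))"
  proof -
    have "(\<lambda>(s1, s2). (s2, f1 s1)) = (\<lambda>s :: 's1 \<times> 's2. (snd s, ?kk s))" by auto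
    then show ?thesis by (simp only:) (rule cent_eq_sum_cnd, auto simp: inj_def)
  qed
  have H2: "cent W snd (\<lambda>(s1, s2). (s1, f1 s1)) = - (\<Sum>s\<in>UNIV. W s * ln (cnd W (\<lambda>s. (fst s, ?kk s)) s))"
  proof -
    have "(\<lambda>(s1, s2). (s1, f1 s1)) = (\<lambda>s :: 's1 \<times> 's2. (fst s, ?kk s))" by auto
    then show ?thesis by (simp only:) (rule cent_eq_sum_cnd, auto simp: inj_def)
  qed
  \<comment> \<open>For a double error no source letter is shared: \<open>ps\<close> is constant
    with value \<open>()\<close>, which leaves conditioning on the key alone.\<close>
  have H3: "cent W (\<lambda>s. s) (\<lambda>(s1, s2). f1 s1) = - (\<Sum>s\<in>UNIV. W s * ln (cnd W (\<lambda>s. ((), ?kk s)) s))"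
  proof -
    have "cnd W (\<lambda>s. ((), ?kk s)) s = cnd W ?kk s" for s by (simp add: cnd_def push_def)
    then show ?thesis unfolding f1eq by (simp only:) (rule cent_eq_sum_cnd, auto simp: inj_def)
  qed

  have cards: "1 \<le> real CARD('s1)" "1 \<le> real CARD('s2)" "1 \<le> real CARD('v1)" "1 \<le> real CARD('v2)"
    by (simp_all add: Suc_le_eq)
  have cards2: "1 \<le> real (CARD('s1) * CARD('s2))" "1 \<le> real (CARD('v1) * CARD('v2))"
    using mult_mono[OF cards(1,2)] mult_mono[OF cards(3,4)] by simp_all
  have hl: "real l * Ll l \<phi> N = hb \<phi> + \<phi> * (real l * ln (real N))" for N using lpos by (simp add: Ll_def distrib_left)
  have hL: "LL \<phi> N = hb \<phi> + \<phi> * ln (real N)" for N by (simp add: LL_def Ll_def)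

  \<comment> \<open>In \<open>D1\<close> and \<open>D2\<close> the list of key blocks is a
    singleton, so \<open>m = 1\<close>. In \<open>D3\<close> it is the decoded bin, of up to
    \<open>B\<close> key blocks; its cost \<open>ln B \<le> l * \<beta>\<close> is the \<beta> of
    the third inequality.\<close>
  define D1 where "D1 = (\<lambda>z. source_metric \<phi> l W snd ?kk (\<lambda>b y. {map f2 b}) 1 (real CARD('s1)) (map fst z) (map ?w1 (map snd z)) *
          prod_list (map (codeword_metric \<phi> q ?w1 (real CARD('v1))) (map snd z)) / prod_list (map (\<lambda>w. pV1 (fst w)) (map snd z)))"
  define D2 where "D2 = (\<lambda>z. source_metric \<phi> l W fst ?kk (\<lambda>b y. {map f1 b}) 1 (real CARD('s2)) (map fst z) (map ?w2 (map snd z)) *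
          prod_list (map (codeword_metric \<phi> q ?w2 (real CARD('v2))) (map snd z)) / prod_list (map (\<lambda>w. pV2 (fst (snd w))) (map snd z)))"
  define D3 where "D3 = (\<lambda>z. source_metric \<phi> l W (\<lambda>_. ()) ?kk (\<lambda>b y. L y) (real B) (real (CARD('s1) * CARD('s2))) (map fst z) (map ?w3 (map snd z)) *
          prod_list (map (codeword_metric \<phi> q ?w3 (real (CARD('v1) * CARD('v2)))) (map snd z)) / prod_list (map (\<lambda>w. pV1 (fst w) * pV2 (fst (snd w))) (map snd z)))"
  note base = W_pmf kpmf pmfs(1) C C phi_pos phi_range(2)
  have B': "1 \<le> real B" using B by simp
  have kposA: "\<forall>u u' w. k u u' w \<noteq> 0 \<longrightarrow> 0 < pV1 (fst w)" "\<forall>u u' w. k u u' w \<noteq> 0 \<longrightarrow> 0 < pV2 (fst (snd w))"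
    "\<forall>u u' w. k u u' w \<noteq> 0 \<longrightarrow> 0 < pV1 (fst w) * pV2 (fst (snd w))"
    using kpos by (blast intro: mult_pos_pos)+
  note d1 = base order_refl cards(1) cards(3) q_def D1_def V0(1) kposA(1)
  note d2 = base order_refl cards(2) cards(4) q_def D2_def V0(2) kposA(2)
  have V12: "0 \<le> pV1 (fst w) * pV2 (fst (snd w))" for w :: "'v1 \<times> 'v2 \<times> 'y" by (simp add: V0)
  note d3 = base B' cards2 q_def D3_def V12 kposA(3)
  have fix_eqs: "(\<lambda>x. (snd (fst x), ?w1 (snd x))) = fix1" "(\<lambda>x. (fst (fst x), ?w2 (snd x))) = fix2"
    by (auto simp: fix1_def fix2_def)

  have m1: "0 < (\<Sum>z\<in>Len l. ?J z * ln (D1 z))"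
  proof -
    have Hq: "(\<Sum>w\<in>UNIV. k u u' w * ln (pV1 (fst w))) = (\<Sum>v1\<in>UNIV. \<Sum>v2\<in>UNIV. pV1 v1 * pV2 v2 * ln (pV1 v1))" for u u'
      unfolding k_def by (rule mac_kernel_marginal(2)[OF X, where g = "\<lambda>v1 v2. ln (pV1 v1)"])
    have "0 < real l * (cmi Q ?V1 ?Y ?V2
               - LL \<phi> CARD('v1) - (cent W fst (\<lambda>(s1, s2). (s2, f1 s1)) + Ll l \<phi> CARD('s1)))"
      using c1 lpos by simp
    then show ?thesis
      using metric_mean_ge[where k = k and ?C1.0 = ?C1 and ?C2.0 = ?C2, OF d1 bad1 bad2 Hq] unfolding I1 H1 hL by (simp add: right_diff_distrib distrib_left hl)
  qed
  have m2: "0 < (\<Sum>z\<in>Len l. ?J z * ln (D2 z))"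
  proof -
    have Hq: "(\<Sum>w\<in>UNIV. k u u' w * ln (pV2 (fst (snd w)))) = (\<Sum>v1\<in>UNIV. \<Sum>v2\<in>UNIV. pV1 v1 * pV2 v2 * ln (pV2 v2))" for u u'
      unfolding k_def by (rule mac_kernel_marginal(2)[OF X, where g = "\<lambda>v1 v2. ln (pV2 v2)"])
    have "0 < real l * (cmi Q ?V2 ?Y ?V1
               - LL \<phi> CARD('v2) - (cent W snd (\<lambda>(s1, s2). (s1, f1 s1)) + Ll l \<phi> CARD('s2)))"
      using c2 lpos by simp
    then show ?thesis
      using metric_mean_ge[where k = k and ?C1.0 = ?C1 and ?C2.0 = ?C2, OF d2 bad1 bad3 Hq] unfolding I2 H2 hL by (simp add: right_diff_distrib distrib_left hl)
  qed
  have m3: "0 < (\<Sum>z\<in>Len l. ?J z * ln (D3 z))"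
  proof -
    have Hq: "(\<Sum>w\<in>UNIV. k u u' w * ln (pV1 (fst w) * pV2 (fst (snd w)))) = (\<Sum>v1\<in>UNIV. \<Sum>v2\<in>UNIV. pV1 v1 * pV2 v2 * ln (pV1 v1 * pV2 v2))" for u u'
      unfolding k_def by (rule mac_kernel_marginal(2)[OF X, where g = "\<lambda>v1 v2. ln (pV1 v1 * pV2 v2)"])
    have "0 < real l * (mi Q ?V12 ?Y
               - LL \<phi> (CARD('v1) * CARD('v2)) - (\<beta> + cent W (\<lambda>s. s) (\<lambda>(s1, s2). f1 s1) + Ll l \<phi> (CARD('s1) * CARD('s2))))"
      using c3 lpos by simp
    then show ?thesis
      using metric_mean_ge[where k = k and ?C1.0 = ?C1 and ?C2.0 = ?C2, OF d3 bad1 bad Hq] B(2) unfolding I3 H3 hL by (simp add: right_diff_distrib distrib_left hl del: of_nat_mult)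
  qed

  have fib1: "(\<Sum>z | length z = l \<and> map fix1 z = b. prod_list (map (wt1 pV1) z) * D1 z) \<le> 1" if "length b = l" for b
    unfolding fix_eqs[symmetric]
  proof (rule metric_fiber_le[where k = k and ?C1.0 = ?C1 and ?C2.0 = ?C2, OF d1 that])
    show "real (card {s :: 's1 \<times> 's2. snd s = x}) \<le> real CARD('s1)" for x
      by (rule card_fiber_le[where h = "\<lambda>a. (a, x)"]) auto
    show "real (card {w. ?w1 w = x}) \<le> real CARD('v1)" for x
      by (rule card_fiber_le[where h = "\<lambda>a. (a, x)"]) auto
  qed auto
  have fib2: "(\<Sum>z | length z = l \<and> map fix2 z = b. prod_list (map (wt2 pV2) z) * D2 z) \<le> 1" if "length b = l" for b
    unfolding fix_eqs[symmetric]
  proof (rule metric_fiber_le[where k = k and ?C1.0 = ?C1 and ?C2.0 = ?C2, OF d2 that])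
    show "real (card {s :: 's1 \<times> 's2. fst s = x}) \<le> real CARD('s2)" for x
      by (rule card_fiber_le[where h = "\<lambda>a. (x, a)"]) auto
    show "real (card {w. ?w2 w = x}) \<le> real CARD('v2)" for x
      by (rule card_fiber_le[where h = "\<lambda>a. (fst x, a, snd x)"]) auto
  qed auto
  have fib3: "(\<Sum>z | length z = l \<and> map fix3 z = b. prod_list (map (\<lambda>x. wt1 pV1 x * wt2 pV2 x) z) * D3 z) \<le> 1" if "length b = l" for b
  proof -
    \<comment> \<open>The generic shared part carries a unit component here, so the fibres of
      \<open>fix3\<close> are matched through the injection \<open>Pair ()\<close>.\<close>
    have "map fix3 z = b \<longleftrightarrow> map (\<lambda>x. ((), ?w3 (snd x))) z = map (Pair ()) b" for z :: "(('s1 \<times> 's2) \<times> 'v1 \<times> 'v2 \<times> 'y) list"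
    proof -
      have eq: "map (\<lambda>x. ((), ?w3 (snd x))) z = map (Pair ()) (map fix3 z)"
        by (simp add: fix3_def split_def)
      have "inj (Pair () :: 'y \<Rightarrow> _)" by (simp add: inj_def)
      then have "inj (map (Pair ()) :: 'y list \<Rightarrow> _)" by (rule inj_mapI)
      then show ?thesis unfolding eq by (simp only: inj_eq)
    qed
    then have "(\<Sum>z | length z = l \<and> map fix3 z = b. prod_list (map (\<lambda>x. wt1 pV1 x * wt2 pV2 x) z) * D3 z)
      = (\<Sum>z | length z = l \<and> map (\<lambda>x. ((), ?w3 (snd x))) z = map (Pair ()) b. prod_list (map (\<lambda>x. pV1 (fst (snd x)) * pV2 (fst (snd (snd x)))) z) * D3 z)"
      by simp
    also have "\<dots> \<le> 1"
    proof (rule metric_fiber_le[where k = k and ?C1.0 = ?C1 and ?C2.0 = ?C2, OF d3])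
      show "real (card {s :: 's1 \<times> 's2. () = x}) \<le> real (CARD('s1) * CARD('s2))" for x
        using card_fiber_le[where h = "\<lambda>a :: 's1 \<times> 's2. a" and g = "\<lambda>s :: 's1 \<times> 's2. ()" and x = x] by simp
      show "real (card {w. ?w3 w = x}) \<le> real (CARD('v1) * CARD('v2))" for x
      proof -
        have "real (card {w. ?w3 w = x}) \<le> real CARD('v1 \<times> 'v2)"
        proof (rule card_fiber_le)
          fix w :: "'v1 \<times> 'v2 \<times> 'y" assume "?w3 w = x"
          then have "w = (fst (fst w, fst (snd w)), snd (fst w, fst (snd w)), x)" by auto
          then show "w \<in> range (\<lambda>a :: 'v1 \<times> 'v2. (fst a, snd a, x))" by blast
        qed
        then show ?thesis by simp
      qed
    qed (use L that in auto)
    finally show ?thesis .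
  qed
  show ?thesis
  proof (rule transmissible_block_coding[OF W_pmf _ pmfs(2,3) _ _ lpos, where Wc = Wc and ?C1.0 = ?C1 and ?C2.0 = ?C2 and ?D1.0 = D1 and ?D2.0 = D2 and ?D3.0 = D3 and ?pX1.0 = pX1 and ?pX2.0 = pX2, folded k_def])
    show "0 \<le> D1 z" "0 \<le> D2 z" "0 \<le> D3 z" for z
      using metric_nonneg[where k = k and ?C1.0 = ?C1 and ?C2.0 = ?C2, OF d1] metric_nonneg[where k = k and ?C1.0 = ?C1 and ?C2.0 = ?C2, OF d2] metric_nonneg[where k = k and ?C1.0 = ?C1 and ?C2.0 = ?C2, OF d3] by auto
    show "0 < D1 z" "0 < D2 z" "0 < D3 z" if "length z = l" "?J z \<noteq> 0" for z
      using metric_pos[where k = k and ?C1.0 = ?C1 and ?C2.0 = ?C2, OF d1 that] metric_pos[where k = k and ?C1.0 = ?C1 and ?C2.0 = ?C2, OF d2 that] metric_pos[where k = k and ?C1.0 = ?C1 and ?C2.0 = ?C2, OF d3 that] by auto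
  qed (use X lenC fib1 fib2 fib3 m1 m2 m3 in auto)
qed

end
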